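(* Let $N\in\mathbb N_+$, let $\boldsymbol{\bar\jmath}=(j_1,\dots,j_N)$ be an $N$-tuple of arbitrary spins in $\frac12\mathbb N_+$, $v_1,\dots,v_N\in\mathbb C^*$ and $j\in\frac12\mathbb N_+$. Then $$\psi^{(N)}_{\boldsymbol{\bar\jmath},\bar v}\big(\mathbf T^{(j,N)}(u)\big)=\Big[\prod_{n=1}^N\prod_{k=0}^{2j_n-2}\prod_{\ell=0}^{2j-1}c(uq^{j+j_n-k-\ell-1}v_n)\,c(uq^{j+j_n-k-\ell-1}v_n^{-1})\Big]^{-1}\boldsymbol t^{j,\boldsymbol{\bar\jmath}}(u).$$
   Context: **Conventions.** $q\in\mathbb C^*$ is not a root of unity, $\mathbb N=\{0,1,\dots\}$, $\mathbb N_+=\{1,2,\dots\}$, $\overline\ell=\ell\bmod2$, $[n]_q=\frac{q^n-q^{-n}}{q-q^{-1}}$, $[X,Y]_q=qXY-q^{-1}YX$, $c(u)=u-u^{-1}$, $X_1=X\otimes\mathbb I$, $X_2=\mathbb I\otimes X$. Fix $k_\pm\in\mathbb C^*$, $\varepsilon_\pm,\bar\varepsilon_\pm,\bar k_\pm\in\mathbb C$, $\rho=k_+k_-(q+q^{-1})^2$. **$\mathcal A_q$** is the unital associative algebra generated by $\mathsf W_{-k},\mathsf W_{k+1},\mathsf G_{k+1},\tilde{\mathsf G}_{k+1}$ ($k\in\mathbb N$) with, for $k,l\in\mathbb N$: $[\mathsf W_0,\mathsf W_{k+1}]=[\mathsf W_{-k},\mathsf W_1]=\frac{\tilde{\mathsf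 G}_{k+1}-\mathsf G_{k+1}}{q+q^{-1}}$; $[\mathsf W_0,\mathsf G_{k+1}]_q=[\tilde{\mathsf G}_{k+1},\mathsf W_0]_q=\rho(\mathsf W_{-k-1}-\mathsf W_{k+1})$; $[\mathsf G_{k+1},\mathsf W_1]_q=[\mathsf W_1,\tilde{\mathsf G}_{k+1}]_q=\rho(\mathsf W_{k+2}-\mathsf W_{-k})$; $[\mathsf W_{-k},\mathsf W_{-l}]=[\mathsf W_{k+1},\mathsf W_{l+1}]=[\mathsf G_{k+1},\mathsf G_{l+1}]=[\tilde{\mathsf G}_{k+1},\tilde{\mathsf G}_{l+1}]=0$; and $[X_k,Y_l]+[Y_k,X_l]=0$ for every pair $(X_k,Y_k)$ chosen from the families $\mathsf W_{-k},\mathsf W_{k+1},\mathsf G_{k+1},\tilde{\mathsf G}_{k+1}$. **$\mathcal A_q^{(N)}$** is the quotient of $\mathcal A_q$ by, for all $\ell\in\mathbb N$: $\sum_{k=0}^Nd_k^{(N)}\mathsf W_{-k-\ell}+\overline{\ell+1}\,\varepsilon_+^{(N)}+\overline\ell\,\varepsilon_-^{(N)}=0$, $\sum_{k=0}^Nd_k^{(N)}\mathsf W_{k+1+\ell}+\overline{\ell+1}\,\varepsilon_-^{(N)}+\overline\ell\,\varepsilon_+^{(N)}=0$, $\sum_{k=0}^Nd_k^{(N)}\mathsf G_{k+1+\ell}=0=\sum_{k=0}^Nd_k^{(N)}\tilde{\mathsf G}_{k+1+\ell}$; images of generators carry a superscript $(N)$. **Parameters.** $w_0^{(j)}=q^{2j+1}+q^{-2j-1}$;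 $\varepsilon_\pm^{(0)}=\varepsilon_\pm$, $\varepsilon_\pm^{(n)}=w_0^{(j_n)}\varepsilon_\mp^{(n-1)}-(v_n^2+v_n^{-2})\varepsilon_\pm^{(n-1)}$; $d_n^{(N)}=(-1)^{N+1-n}(q+q^{-1})^n\sum_{k_1<\dots<k_{N-n}}\alpha_{k_1}\cdots\alpha_{k_{N-n}}$ ($0\le n\le N$), with $\alpha_1=\frac{(v_1^2+v_1^{-2})w_0^{(j_1)}}{q+q^{-1}}+\frac{\varepsilon_+\varepsilon_-(q-q^{-1})^2}{k_+k_-(q+q^{-1})}$, $\alpha_n=\frac{(v_n^2+v_n^{-2})w_0^{(j_n)}}{q+q^{-1}}$ for $n\ge2$. **Truncated K-operators.** $U=\frac{qu^2+q^{-1}u^{-2}}{q+q^{-1}}$, $P_{-k}^{(N)}(u)=-\frac1{q+q^{-1}}\sum_{n=k}^{N-1}d_{n+1}^{(N)}U^{n-k}$, and $\mathsf W_+^{(N)}(u)=\sum_{k=0}^{N-1}P_{-k}^{(N)}(u)\mathsf W_{-k}^{(N)}$, $\mathsf W_-^{(N)}(u)=\sum P_{-k}^{(N)}(u)\mathsf W_{k+1}^{(N)}$, $\mathsf G_+^{(N)}(u)=\sum P_{-k}^{(N)}(u)\mathsf G_{k+1}^{(N)}$, $\mathsf G_-^{(N)}(u)=\sum P_{-k}^{(N)}(u)\tilde{\mathsf G}_{k+1}^{(N)}$. $\mathcal K^{(\frac12,N)}(u)=\begin{pmatrix}\mathcal A&\mathcal B\\\mathcal C&\mathcal D\end{pmatrix}$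 with $\mathcal A=u\varepsilon_+^{(N)}+u^{-1}\varepsilon_-^{(N)}+c(u^2)(uq\mathsf W_+^{(N)}(u)-u^{-1}q^{-1}\mathsf W_-^{(N)}(u))$, $\mathcal D=u\varepsilon_-^{(N)}+u^{-1}\varepsilon_+^{(N)}+c(u^2)(uq\mathsf W_-^{(N)}(u)-u^{-1}q^{-1}\mathsf W_+^{(N)}(u))$, $\mathcal B=\frac{c(u^2)}{k_-}\Big(\frac{k_+k_-(u^2q+u^{-2}q^{-1})}{q-q^{-1}}P_0^{(N)}(u)+\frac{\mathsf G_+^{(N)}(u)}{q+q^{-1}}+\omega_0^{(N)}\Big)$, $\mathcal C$ the same with $\frac1{k_-}\to\frac1{k_+}$, $\mathsf G_+^{(N)}\to\mathsf G_-^{(N)}$, and $\omega_0^{(N)}=-\frac{k_+k_-}{q-q^{-1}}d_0^{(N)}$. **Fusion.** $B_{j,j'}=\sqrt{[j+j']_q[j-j'+1]_q}$; spin-$j$ matrices $(S_+)_{mn}=B_{j,j+1-m}\delta_{m,n-1}$, $(S_-)_{mn}=B_{j,j+1-n}\delta_{m-1,n}$, $(S_3)_{mn}=2(j+1-n)\delta_{mn}$. $\mathcal E^{(j)}:\mathbb C^{2j+1}\to\mathbb C^2\otimes\mathbb C^{2j}$ has nonzero entries $\mathcal E_{1,1}=1$, $\mathcal E_{1+n,1+n}=\prod_{p=0}^{n-1}\frac{B_{j-1/2,j-p-1/2}}{B_{j,j-p}}$ ($1\le n\le2j-1$), $\mathcal E_{2j+m,1+m}=[m]_q\mathcal E_{m,m}/B_{j,j+1-m}$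 ($1\le m\le2j$). $\mathcal F^{(j)}:\mathbb C^2\otimes\mathbb C^{2j}\to\mathbb C^{2j+1}$ has nonzero entries $\mathcal F_{1,1}=1$, $\mathcal F_{n,n+2j-1}=\frac{\mathcal E_{n+2j-1,n}}{\mathcal E_{n,n}^2+\mathcal E_{n+2j-1,n}^2}$, $\mathcal F_{n,n}=\frac{1-\mathcal F_{n,n+2j-1}\mathcal E_{n+2j-1,n}}{\mathcal E_{n,n}}$ ($2\le n\le2j$), $\mathcal F_{2j+1,4j}=\mathcal E_{4j,2j+1}^{-1}$. $R^{(\frac12,0)}=\mathbb I_2$, $R^{(0,j)}=\mathbb I$, $R^{(\frac12,j)}(u)=\prod_{k=0}^{2j-2}c(uq^{j-\frac12-k})\Big((q-q^{-1})(\sigma_+\otimes S_-+\sigma_-\otimes S_+)+uq^{\frac12(\mathbb I+\sigma_z\otimes S_3)}-u^{-1}q^{-\frac12(\mathbb I+\sigma_z\otimes S_3)}\Big)$, and $R^{(j_1,j_2)}(u)=\mathcal F^{(j_1)}_{\langle12\rangle}R_{13}^{(\frac12,j_2)}(uq^{-j_1+\frac12})R_{23}^{(j_1-\frac12,j_2)}(uq^{\frac12})\mathcal E^{(j_1)}_{\langle12\rangle}$. Fused operators: $\mathcal K^{(j,N)}(u)=\mathcal F^{(j)}\mathcal K_1^{(\frac12,N)}(uq^{-j+\frac12})R^{(\frac12,j-\frac12)}(u^2q^{-j+1})\mathcal K_2^{(j-\frac12,N)}(uq^{\frac12})\mathcal E^{(j)}$, $\mathcal K^{(0,N)}=1$;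 the scalar K-matrices $K^{(j)}(u)$ are given by the same recursion with $K^{(0)}=1$, $K^{(\frac12)}(u)=\begin{pmatrix}u\varepsilon_++u^{-1}\varepsilon_-&k_+c(u^2)/(q-q^{-1})\\k_-c(u^2)/(q-q^{-1})&u\varepsilon_-+u^{-1}\varepsilon_+\end{pmatrix}$. Dual: $K^{+(j)}(u)=\frac1{f^{(j)}(u)}\big(K^{(j)}(u^{-1}q^{-1})\big)^t$ with $\varepsilon_\pm\to\bar\varepsilon_\mp$, $k_\pm\to-\bar k_\mp$, $f^{(j)}(u)=\prod_{k=1}^{2j-1}\prod_{\ell=1}^kc(u^2q^{k+\ell+2-2j})c(u^{-2}q^{-k-\ell+2j})$. **Generating function and transfer matrix.** $\mathbf T^{(j,N)}(u)=\mathrm{tr}_{\mathbb C^{2j+1}}\big(K^{+(j)}(u)\mathcal K^{(j,N)}(u)\big)$. $\boldsymbol t^{j,\boldsymbol{\bar\jmath}}(u)=\mathrm{tr}_{\mathbb C^{2j+1}}\big(K_a^{+(j)}(u)T_{a,N}(u)K_a^{(j)}(u)\hat T_{a,N}(u)\big)$, $T_{a,N}(u)=R_{Na}^{(j_N,j)}(uv_N)\cdots R_{1a}^{(j_1,j)}(uv_1)$, $\hat T_{a,N}(u)=R_{1a}^{(j_1,j)}(uv_1^{-1})\cdots R_{Na}^{(j_N,j)}(uv_N^{-1})$, $a$ denoting the auxiliary space $\mathbb C^{2j+1}$. **Spin-chain representation.** With $L^{(j',\frac12)}(u)=\begin{pmatrix}uq^{\frac12}q^{S_3/2}-u^{-1}q^{-\frac12}q^{-S_3/2}&(q-q^{-1})S_-\\(q-q^{-1})S_+&uq^{\frac12}q^{-S_3/2}-u^{-1}q^{-\frac12}q^{S_3/2}\end{pmatrix}$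 (entries: spin-$j'$ matrices on the quantum space), $\psi^{(N)}_{\boldsymbol{\bar\jmath},\bar v}:\mathcal A_q^{(N)}\to\mathrm{End}(\mathbb C^{2j_N+1}\otimes\dots\otimes\mathbb C^{2j_1+1})$ is the algebra map defined by identification of entries in $(\psi^{(N)}_{\boldsymbol{\bar\jmath},\bar v}\otimes\mathrm{id})(\mathcal K^{(\frac12,N)}(u))=L^{(j_N,\frac12)}_{[N]}(uv_N)\cdots L^{(j_1,\frac12)}_{[1]}(uv_1)K^{(\frac12)}(u)L^{(j_1,\frac12)}_{[1]}(uv_1^{-1})\cdots L^{(j_N,\frac12)}_{[N]}(uv_N^{-1})$ (known to be well defined), where $[n]$ labels the quantum space $\mathbb C^{2j_n+1}$ and products are $2\times2$ matrix products. *)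

theory Defs
  imports
    "HOL-Algebra.QuotRing"
    "HOL-Algebra.Module"
    "HOL-Library.Poly_Mapping"
    "Jordan_Normal_Form.Matrix"
begin

text \<open>
  Conventions. A spin \<open>j\<close> in \<open>\<nat>/2\<close> is represented by the natural number \<open>a = 2j\<close>.
  Half-integer powers of \<open>q\<close> refer to a fixed square root \<open>s\<close> of \<open>q\<close>, so \<open>q\<^bsup>x\<^esup>\<close> is
  \<open>s powi (2x)\<close>. Tensor products use the usual Kronecker ordering of the basis, the first
  factor being the slowest one.
\<close>

section \<open>Parameters\<close>

text \<open>
  Sites are numbered \<open>1, \<dots>, chain_len\<close>; \<open>spin2 n\<close> is \<open>2 j\<^sub>n\<close> and \<open>inhom n\<close> is \<open>v\<^sub>n\<close>.
  The \<open>dual_\<close> fields are the barred parameters of the dual K-matrix.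
\<close>

record chain =
  root_q :: complex
  k_plus :: complex
  k_minus :: complex
  eps_plus :: complex
  eps_minus :: complex
  dual_k_plus :: complex
  dual_k_minus :: complex
  dual_eps_plus :: complex
  dual_eps_minus :: complex
  chain_len :: nat
  spin2 :: "nat \<Rightarrow> nat"
  inhom :: "nat \<Rightarrow> complex"

definition q_of :: "chain \<Rightarrow> complex" where
  "q_of P = (root_q P)\<^sup>2"

definition cfun :: "complex \<Rightarrow> complex" where
  "cfun u = u - inverse u"

text \<open>\<open>qnum s t\<close> is the \<open>q\<close>-number of \<open>t/2\<close>, and \<open>Bcoef s (2j) (2j')\<close> is \<open>B\<close> at \<open>j, j'\<close>.\<close>

definition qnum :: "complex \<Rightarrow> int \<Rightarrow> complex" where
  "qnum s t = (s powi t - s powi (- t)) / cfun (s\<^sup>2)"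

definition Bcoef :: "complex \<Rightarrow> int \<Rightarrow> int \<Rightarrow> complex" where
  "Bcoef s a b = csqrt (qnum s (a + b) * qnum s (a - b + 2))"

section \<open>Matrices over an algebra\<close>

text \<open>
  A unital associative complex algebra is a record of type \<^typ>\<open>(complex, 'a) module\<close>, whose
  multiplication need not be commutative. The matrix type of \<open>Jordan_Normal_Form\<close> is used as a
  container for entries in the carrier of such an algebra.
\<close>

definition mat_mul :: "(complex, 'a) module \<Rightarrow> 'a mat \<Rightarrow> 'a mat \<Rightarrow> 'a mat" (infixl \<open>\<star>\<index>\<close> 70) where
  "X \<star>\<^bsub>A\<^esub> Y = mat (dim_row X) (dim_col Y)
     (\<lambda>(i, j). finsum A (\<lambda>k. X $$ (i, k) \<otimes>\<^bsub>A\<^esub> Y $$ (k, j)) {0..<dim_row Y})"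

definition mat_one :: "(complex, 'a) module \<Rightarrow> nat \<Rightarrow> 'a mat" where
  "mat_one A n = mat n n (\<lambda>(i, j). if i = j then \<one>\<^bsub>A\<^esub> else \<zero>\<^bsub>A\<^esub>)"

definition mat_trace :: "(complex, 'a) module \<Rightarrow> 'a mat \<Rightarrow> 'a" where
  "mat_trace A X = finsum A (\<lambda>i. X $$ (i, i)) {0..<dim_row X}"

definition scal_mat :: "(complex, 'a) module \<Rightarrow> complex mat \<Rightarrow> 'a mat" where
  "scal_mat A M = map_mat (\<lambda>c. c \<odot>\<^bsub>A\<^esub> \<one>\<^bsub>A\<^esub>) M"

definition kron_by :: "('a \<Rightarrow> 'a \<Rightarrow> 'a) \<Rightarrow> 'a mat \<Rightarrow> 'a mat \<Rightarrow> 'a mat" where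
  "kron_by f X Y = mat (dim_row X * dim_row Y) (dim_col X * dim_col Y)
     (\<lambda>(i, j). f (X $$ (i div dim_row Y, j div dim_col Y)) (Y $$ (i mod dim_row Y, j mod dim_col Y)))"

abbreviation kron :: "'a::times mat \<Rightarrow> 'a mat \<Rightarrow> 'a mat" where
  "kron \<equiv> kron_by (*)"

definition complex_alg :: "(complex, complex) module" where
  "complex_alg = \<lparr>carrier = UNIV, monoid.mult = (*), one = 1, zero = 0, add = (+), smult = (*)\<rparr>"

definition alg_hom :: "(complex, 'a) module \<Rightarrow> (complex, 'b) module \<Rightarrow> ('a \<Rightarrow> 'b) set" where
  "alg_hom A B = {h \<in> Ring.ring_hom A B. \<forall>c. \<forall>x\<in>carrier A. h (c \<odot>\<^bsub>A\<^esub> x) = c \<odot>\<^bsub>B\<^esub> h x}"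

definition mat22 :: "'a \<Rightarrow> 'a \<Rightarrow> 'a \<Rightarrow> 'a \<Rightarrow> 'a mat" where
  "mat22 a b c d = mat 2 2 (\<lambda>(i, j). if i = 0 then (if j = 0 then a else b) else (if j = 0 then c else d))"

text \<open>Matrices given by a formula whose row and column indices start at 1.\<close>

definition mat1 :: "nat \<Rightarrow> nat \<Rightarrow> (nat \<Rightarrow> nat \<Rightarrow> 'a) \<Rightarrow> 'a mat" where
  "mat1 r c f = mat r c (\<lambda>(i, j). f (i + 1) (j + 1))"

section \<open>Spin matrices, fusion and R-matrices\<close>

definition spin_plus :: "complex \<Rightarrow> nat \<Rightarrow> complex mat" where
  "spin_plus s a = mat1 (a + 1) (a + 1)
     (\<lambda>m n. if n = m + 1 then Bcoef s (int a) (int a + 2 - 2 * int m) else 0)"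

definition spin_minus :: "complex \<Rightarrow> nat \<Rightarrow> complex mat" where
  "spin_minus s a = mat1 (a + 1) (a + 1)
     (\<lambda>m n. if m = n + 1 then Bcoef s (int a) (int a + 2 - 2 * int n) else 0)"

definition spin_3 :: "nat \<Rightarrow> int mat" where
  "spin_3 a = mat1 (a + 1) (a + 1) (\<lambda>m n. if m = n then int a + 2 - 2 * int n else 0)"

text \<open>\<open>qexp s M\<close> is \<open>q\<^bsup>M/2\<^esup>\<close> for a diagonal integer matrix \<open>M\<close>.\<close>

definition qexp :: "complex \<Rightarrow> int mat \<Rightarrow> complex mat" where
  "qexp s M = mat (dim_row M) (dim_row M) (\<lambda>(i, j). if i = j then s powi (M $$ (i, i)) else 0)"

definition E_diag :: "complex \<Rightarrow> nat \<Rightarrow> nat \<Rightarrow> complex" where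
  "E_diag s a n = (\<Prod>p<n. Bcoef s (int a - 1) (int a - 2 * int p - 1) / Bcoef s (int a) (int a - 2 * int p))"

text \<open>The entries of the fusion matrices, with indices starting at 1; \<open>E_diag\<close> is
  the entry at \<open>(1 + n, 1 + n)\<close>, the empty product giving the entry at \<open>(1, 1)\<close>.\<close>

definition E_entry :: "complex \<Rightarrow> nat \<Rightarrow> nat \<Rightarrow> nat \<Rightarrow> complex" where
  "E_entry s a r k =
     (if r = k \<and> 1 \<le> r \<and> r \<le> a then E_diag s a (r - 1)
      else if 2 \<le> k \<and> k \<le> a + 1 \<and> r = a + k - 1 then
        (let m = k - 1 in qnum s (2 * int m) * E_diag s a (m - 1) / Bcoef s (int a) (int a + 2 - 2 * int m))
      else 0)"

definition E_mat :: "complex \<Rightarrow> nat \<Rightarrow> complex mat" where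
  "E_mat s a = mat1 (2 * a) (a + 1) (E_entry s a)"

definition F_upper :: "complex \<Rightarrow> nat \<Rightarrow> nat \<Rightarrow> complex" where
  "F_upper s a n = E_entry s a (n + a - 1) n / ((E_entry s a n n)\<^sup>2 + (E_entry s a (n + a - 1) n)\<^sup>2)"

definition F_entry :: "complex \<Rightarrow> nat \<Rightarrow> nat \<Rightarrow> nat \<Rightarrow> complex" where
  "F_entry s a r k =
     (if r = 1 \<and> k = 1 then 1
      else if 2 \<le> r \<and> r \<le> a \<and> k = r + a - 1 then F_upper s a r
      else if 2 \<le> r \<and> r \<le> a \<and> k = r then
        (1 - F_upper s a r * E_entry s a (r + a - 1) r) / E_entry s a r r
      else if r = a + 1 \<and> k = 2 * a then inverse (E_entry s a (2 * a) (a + 1))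
      else 0)"

definition F_mat :: "complex \<Rightarrow> nat \<Rightarrow> complex mat" where
  "F_mat s a = mat1 (a + 1) (2 * a) (F_entry s a)"

definition sigma_plus :: "complex mat" where
  "sigma_plus = mat22 0 1 0 0"

definition sigma_minus :: "complex mat" where
  "sigma_minus = mat22 0 0 1 0"

definition sigma_z :: "int mat" where
  "sigma_z = mat22 1 0 0 (- 1)"

definition R_half :: "complex \<Rightarrow> nat \<Rightarrow> complex \<Rightarrow> complex mat" where
  "R_half s b u =
     (if b = 0 then 1\<^sub>m 2
      else (\<Prod>k<b - 1. cfun (u * s powi (int b - 1 - 2 * int k))) \<cdot>\<^sub>m
        (cfun (s\<^sup>2) \<cdot>\<^sub>m (kron sigma_plus (spin_minus s b) + kron sigma_minus (spin_plus s b))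
         + u \<cdot>\<^sub>m qexp s (1\<^sub>m (2 * (b + 1)) + kron sigma_z (spin_3 b))
         - inverse u \<cdot>\<^sub>m qexp s (- (1\<^sub>m (2 * (b + 1)) + kron sigma_z (spin_3 b)))))"

text \<open>\<open>leg13 d1 d2 d3 M\<close> lets \<open>M\<close> act on the factors 1 and 3 of a triple tensor product
  with factors of dimension \<open>d1, d2, d3\<close>.\<close>

definition leg13 :: "nat \<Rightarrow> nat \<Rightarrow> nat \<Rightarrow> complex mat \<Rightarrow> complex mat" where
  "leg13 d1 d2 d3 M = mat (d1 * d2 * d3) (d1 * d2 * d3) (\<lambda>(i, j).
     if (i div d3) mod d2 = (j div d3) mod d2
     then M $$ ((i div (d2 * d3)) * d3 + i mod d3, (j div (d2 * d3)) * d3 + j mod d3)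
     else 0)"

text \<open>\<open>R_mat s (2 j\<^sub>1) (2 j\<^sub>2) u\<close> is the R-matrix of spins \<open>j\<^sub>1, j\<^sub>2\<close>; the factor 13 has a spin-1/2 first leg and
  the middle factor of its triple tensor product has spin \<open>j\<^sub>1 - 1/2\<close>.\<close>

fun R_mat :: "complex \<Rightarrow> nat \<Rightarrow> nat \<Rightarrow> complex \<Rightarrow> complex mat" where
  "R_mat s 0 b u = 1\<^sub>m (b + 1)"
| "R_mat s (Suc 0) b u = R_half s b u"
| "R_mat s (Suc (Suc n)) b u =
     kron (F_mat s (n + 2)) (1\<^sub>m (b + 1))
     * leg13 2 (n + 2) (b + 1) (R_half s b (u * s powi (1 - int (n + 2))))
     * kron (1\<^sub>m 2) (R_mat s (Suc n) b (u * s))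
     * kron (E_mat s (n + 2)) (1\<^sub>m (b + 1))"

text \<open>The fusion recursion for K-operators with entries in \<open>A\<close>, starting from the spin-1/2
  operator \<open>Kh\<close>.\<close>

fun fused_K :: "(complex, 'a) module \<Rightarrow> complex \<Rightarrow> (complex \<Rightarrow> 'a mat) \<Rightarrow> nat \<Rightarrow> complex \<Rightarrow> 'a mat" where
  "fused_K A s Kh 0 u = mat_one A 1"
| "fused_K A s Kh (Suc 0) u = Kh u"
| "fused_K A s Kh (Suc (Suc n)) u =
     scal_mat A (F_mat s (n + 2))
     \<star>\<^bsub>A\<^esub> kron_by ((\<otimes>\<^bsub>A\<^esub>)) (Kh (u * s powi (1 - int (n + 2)))) (mat_one A (n + 2))
     \<star>\<^bsub>A\<^esub> scal_mat A (R_half s (n + 1) (u\<^sup>2 * s powi (2 - int (n + 2))))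
     \<star>\<^bsub>A\<^esub> kron_by ((\<otimes>\<^bsub>A\<^esub>)) (mat_one A 2) (fused_K A s Kh (Suc n) (u * s))
     \<star>\<^bsub>A\<^esub> scal_mat A (E_mat s (n + 2))"

section \<open>Scalar K-matrices\<close>

definition K_half :: "complex \<Rightarrow> complex \<Rightarrow> complex \<Rightarrow> complex \<Rightarrow> complex \<Rightarrow> complex \<Rightarrow> complex mat" where
  "K_half s ep em kp km u = mat22
     (u * ep + inverse u * em) (kp * cfun (u\<^sup>2) / cfun (s\<^sup>2))
     (km * cfun (u\<^sup>2) / cfun (s\<^sup>2)) (u * em + inverse u * ep)"

definition K_mat :: "complex \<Rightarrow> complex \<Rightarrow> complex \<Rightarrow> complex \<Rightarrow> complex \<Rightarrow> nat \<Rightarrow> complex \<Rightarrow> complex mat" where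
  "K_mat s ep em kp km a u = fused_K complex_alg s (K_half s ep em kp km) a u"

definition f_norm :: "complex \<Rightarrow> nat \<Rightarrow> complex \<Rightarrow> complex" where
  "f_norm s a u = (\<Prod>k=1..a - 1. \<Prod>l=1..k.
     cfun (u\<^sup>2 * s powi (2 * (int k + int l + 2 - int a)))
     * cfun (inverse (u\<^sup>2) * s powi (2 * (int a - int k - int l))))"

definition K_dual :: "chain \<Rightarrow> nat \<Rightarrow> complex \<Rightarrow> complex mat" where
  "K_dual P a u = inverse (f_norm (root_q P) a u) \<cdot>\<^sub>m
     transpose_mat (K_mat (root_q P) (dual_eps_minus P) (dual_eps_plus P)
       (- dual_k_minus P) (- dual_k_plus P) a (inverse u * inverse (q_of P)))"

section \<open>The free algebra\<close>

text \<open>The generators \<open>W\<^bsub>-k\<^esub>, W\<^bsub>k+1\<^esub>, G\<^bsub>k+1\<^esub>\<close> and \<open>G\<close> tilde \<open>\<^bsub>k+1\<^esub>\<close> are \<open>WM k, WP k, GP k, GT k\<close>.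
  The free algebra on them is the monoid algebra of the monoid of words.\<close>

datatype gen = WM nat | WP nat | GP nat | GT nat

datatype gword = Word (letters: "gen list")

instantiation gword :: monoid_add
begin

definition zero_gword :: gword where
  "0 = Word []"

definition plus_gword :: "gword \<Rightarrow> gword \<Rightarrow> gword" where
  "x + y = Word (letters x @ letters y)"

instance
  by standard (auto simp: zero_gword_def plus_gword_def)

end

type_synonym falg = "gword \<Rightarrow>\<^sub>0 complex"

definition gvar :: "gen \<Rightarrow> falg" where
  "gvar g = Poly_Mapping.single (Word [g]) 1"

definition const :: "complex \<Rightarrow> falg" where
  "const c = Poly_Mapping.single 0 c"

definition free_alg :: "(complex, falg) module" where
  "free_alg = \<lparr>carrier = UNIV, monoid.mult = (*), one = 1, zero = 0, add = (+), smult = (\<lambda>c x. const c * x)\<rparr>"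

definition comm :: "falg \<Rightarrow> falg \<Rightarrow> falg" where
  "comm x y = x * y - y * x"

definition qcomm :: "complex \<Rightarrow> falg \<Rightarrow> falg \<Rightarrow> falg" where
  "qcomm q x y = const q * x * y - const (inverse q) * y * x"

section \<open>Quotient algebras\<close>

text \<open>The quotient of an algebra by the two-sided ideal generated by a set, and the projection
  onto it.\<close>

definition alg_quot :: "(complex, 'a) module \<Rightarrow> 'a set \<Rightarrow> (complex, 'a set) module" where
  "alg_quot A S = (let I = Idl\<^bsub>A\<^esub> S; Q = A Quot I in
     \<lparr>carrier = carrier Q, monoid.mult = monoid.mult Q, one = one Q, zero = zero Q, add = add Q,
      smult = (\<lambda>c X. \<Union>x\<in>X. I +>\<^bsub>A\<^esub> (c \<odot>\<^bsub>A\<^esub> x))\<rparr>)"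

definition quot_class :: "(complex, 'a) module \<Rightarrow> 'a set \<Rightarrow> 'a \<Rightarrow> 'a set" where
  "quot_class A S x = Idl\<^bsub>A\<^esub> S +>\<^bsub>A\<^esub> x"

section \<open>The algebra and its truncations\<close>

definition rho :: "chain \<Rightarrow> complex" where
  "rho P = k_plus P * k_minus P * (q_of P + inverse (q_of P))\<^sup>2"

inductive_set Aq_relators :: "chain \<Rightarrow> falg set" for P :: chain where
  "comm (gvar (WM 0)) (gvar (WP k))
     - const (inverse (q_of P + inverse (q_of P))) * (gvar (GT k) - gvar (GP k)) \<in> Aq_relators P"
| "comm (gvar (WM k)) (gvar (WP 0))
     - const (inverse (q_of P + inverse (q_of P))) * (gvar (GT k) - gvar (GP k)) \<in> Aq_relators P"
| "qcomm (q_of P) (gvar (WM 0)) (gvar (GP k))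
     - const (rho P) * (gvar (WM (k + 1)) - gvar (WP k)) \<in> Aq_relators P"
| "qcomm (q_of P) (gvar (GT k)) (gvar (WM 0))
     - const (rho P) * (gvar (WM (k + 1)) - gvar (WP k)) \<in> Aq_relators P"
| "qcomm (q_of P) (gvar (GP k)) (gvar (WP 0))
     - const (rho P) * (gvar (WP (k + 1)) - gvar (WM k)) \<in> Aq_relators P"
| "qcomm (q_of P) (gvar (WP 0)) (gvar (GT k))
     - const (rho P) * (gvar (WP (k + 1)) - gvar (WM k)) \<in> Aq_relators P"
| "X \<in> {WM, WP, GP, GT} \<Longrightarrow> comm (gvar (X k)) (gvar (X l)) \<in> Aq_relators P"
| "X \<in> {WM, WP, GP, GT} \<Longrightarrow> Y \<in> {WM, WP, GP, GT} \<Longrightarrow>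
     comm (gvar (X k)) (gvar (Y l)) + comm (gvar (Y k)) (gvar (X l)) \<in> Aq_relators P"

definition Aq :: "chain \<Rightarrow> (complex, falg set) module" where
  "Aq P = alg_quot free_alg (Aq_relators P)"

definition w0 :: "chain \<Rightarrow> nat \<Rightarrow> complex" where
  "w0 P n = root_q P powi (2 * int (spin2 P n) + 2) + root_q P powi (- 2 * int (spin2 P n) - 2)"

definition vv :: "chain \<Rightarrow> nat \<Rightarrow> complex" where
  "vv P n = (inhom P n)\<^sup>2 + inverse ((inhom P n)\<^sup>2)"

fun epsN_plus :: "chain \<Rightarrow> nat \<Rightarrow> complex" and epsN_minus :: "chain \<Rightarrow> nat \<Rightarrow> complex" where
  "epsN_plus P 0 = eps_plus P"
| "epsN_plus P (Suc n) = w0 P (Suc n) * epsN_minus P n - vv P (Suc n) * epsN_plus P n"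
| "epsN_minus P 0 = eps_minus P"
| "epsN_minus P (Suc n) = w0 P (Suc n) * epsN_plus P n - vv P (Suc n) * epsN_minus P n"

definition alpha :: "chain \<Rightarrow> nat \<Rightarrow> complex" where
  "alpha P n = vv P n * w0 P n / (q_of P + inverse (q_of P))
     + (if n = 1 then eps_plus P * eps_minus P * (cfun (q_of P))\<^sup>2
                      / (k_plus P * k_minus P * (q_of P + inverse (q_of P))) else 0)"

definition d_coef :: "chain \<Rightarrow> nat \<Rightarrow> complex" where
  "d_coef P n = (let N = chain_len P in
     (- 1) ^ (N + 1 - n) * (q_of P + inverse (q_of P)) ^ n
     * (\<Sum>S | S \<subseteq> {1..N} \<and> card S = N - n. \<Prod>k\<in>S. alpha P k))"

inductive_set trunc_relators :: "chain \<Rightarrow> falg set" for P :: chain where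
  "(\<Sum>k\<le>chain_len P. const (d_coef P k) * gvar (WM (k + l)))
     + const (of_nat ((l + 1) mod 2) * epsN_plus P (chain_len P)
              + of_nat (l mod 2) * epsN_minus P (chain_len P)) \<in> trunc_relators P"
| "(\<Sum>k\<le>chain_len P. const (d_coef P k) * gvar (WP (k + l)))
     + const (of_nat ((l + 1) mod 2) * epsN_minus P (chain_len P)
              + of_nat (l mod 2) * epsN_plus P (chain_len P)) \<in> trunc_relators P"
| "(\<Sum>k\<le>chain_len P. const (d_coef P k) * gvar (GP (k + l))) \<in> trunc_relators P"
| "(\<Sum>k\<le>chain_len P. const (d_coef P k) * gvar (GT (k + l))) \<in> trunc_relators P"

definition Aq_class :: "chain \<Rightarrow> falg \<Rightarrow> falg set" where
  "Aq_class P x = quot_class free_alg (Aq_relators P) x"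

definition AqN :: "chain \<Rightarrow> (complex, falg set set) module" where
  "AqN P = alg_quot (Aq P) (Aq_class P ` trunc_relators P)"

definition genN :: "chain \<Rightarrow> gen \<Rightarrow> falg set set" where
  "genN P g = quot_class (Aq P) (Aq_class P ` trunc_relators P) (Aq_class P (gvar g))"

section \<open>Truncated K-operators and the generating function\<close>

definition U_of :: "chain \<Rightarrow> complex \<Rightarrow> complex" where
  "U_of P u = (q_of P * u\<^sup>2 + inverse (q_of P) * inverse (u\<^sup>2)) / (q_of P + inverse (q_of P))"

text \<open>\<open>Ppoly P k\<close> is \<open>P\<^bsub>-k\<^esub>\<close>.\<close>

definition Ppoly :: "chain \<Rightarrow> nat \<Rightarrow> complex \<Rightarrow> complex" where
  "Ppoly P k u = - inverse (q_of P + inverse (q_of P))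
     * (\<Sum>n\<in>{k..<chain_len P}. d_coef P (n + 1) * U_of P u ^ (n - k))"

text \<open>For \<open>X\<close> among \<^term>\<open>WM\<close>, \<^term>\<open>WP\<close>, \<^term>\<open>GP\<close>, \<^term>\<open>GT\<close> this is
  \<open>W\<^sub>+(u), W\<^sub>-(u), G\<^sub>+(u), G\<^sub>-(u)\<close>, respectively.\<close>

definition current :: "chain \<Rightarrow> (nat \<Rightarrow> gen) \<Rightarrow> complex \<Rightarrow> falg set set" where
  "current P X u = finsum (AqN P) (\<lambda>k. Ppoly P k u \<odot>\<^bsub>AqN P\<^esub> genN P (X k)) {0..<chain_len P}"

definition omega0 :: "chain \<Rightarrow> complex" where
  "omega0 P = - (k_plus P * k_minus P / cfun (q_of P)) * d_coef P 0"

definition KN_diag :: "chain \<Rightarrow> complex \<Rightarrow> complex \<Rightarrow> (nat \<Rightarrow> gen) \<Rightarrow> (nat \<Rightarrow> gen) \<Rightarrow> complex \<Rightarrow> falg set set" where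
  "KN_diag P e1 e2 X Y u = (let A = AqN P; q = q_of P in
     (u * e1 + inverse u * e2) \<odot>\<^bsub>A\<^esub> \<one>\<^bsub>A\<^esub>
     \<oplus>\<^bsub>A\<^esub> cfun (u\<^sup>2) \<odot>\<^bsub>A\<^esub>
       ((u * q) \<odot>\<^bsub>A\<^esub> current P X u \<ominus>\<^bsub>A\<^esub> (inverse u * inverse q) \<odot>\<^bsub>A\<^esub> current P Y u))"

definition KN_offdiag :: "chain \<Rightarrow> complex \<Rightarrow> (nat \<Rightarrow> gen) \<Rightarrow> complex \<Rightarrow> falg set set" where
  "KN_offdiag P k X u = (let A = AqN P; q = q_of P in
     (cfun (u\<^sup>2) / k) \<odot>\<^bsub>A\<^esub>
       ((k_plus P * k_minus P * (u\<^sup>2 * q + inverse (u\<^sup>2) * inverse q) / cfun q * Ppoly P 0 u) \<odot>\<^bsub>A\<^esub> \<one>\<^bsub>A\<^esub>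
        \<oplus>\<^bsub>A\<^esub> inverse (q + inverse q) \<odot>\<^bsub>A\<^esub> current P X u
        \<oplus>\<^bsub>A\<^esub> omega0 P \<odot>\<^bsub>A\<^esub> \<one>\<^bsub>A\<^esub>))"

definition KN_half :: "chain \<Rightarrow> complex \<Rightarrow> falg set set mat" where
  "KN_half P u = (let ep = epsN_plus P (chain_len P); em = epsN_minus P (chain_len P) in mat22
     (KN_diag P ep em WM WP u) (KN_offdiag P (k_minus P) GP u)
     (KN_offdiag P (k_plus P) GT u) (KN_diag P em ep WP WM u))"

definition KN :: "chain \<Rightarrow> nat \<Rightarrow> complex \<Rightarrow> falg set set mat" where
  "KN P a u = fused_K (AqN P) (root_q P) (KN_half P) a u"

definition gen_fun_T :: "chain \<Rightarrow> nat \<Rightarrow> complex \<Rightarrow> falg set set" where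
  "gen_fun_T P a u = mat_trace (AqN P) (scal_mat (AqN P) (K_dual P a u) \<star>\<^bsub>AqN P\<^esub> KN P a u)"

section \<open>The spin chain\<close>

text \<open>The quantum space has its factors in the order \<open>N, \<dots>, 1\<close>; \<open>at_site P n X\<close> is \<open>X\<close>
  acting on the factor \<open>n\<close>.\<close>

definition qdim :: "chain \<Rightarrow> nat" where
  "qdim P = (\<Prod>n=1..chain_len P. spin2 P n + 1)"

definition qend :: "chain \<Rightarrow> (complex, complex mat) module" where
  "qend P = module_mat TYPE(complex) (qdim P) (qdim P)"

definition at_site :: "chain \<Rightarrow> nat \<Rightarrow> complex mat \<Rightarrow> complex mat" where
  "at_site P n X = kron (1\<^sub>m (\<Prod>m=n+1..chain_len P. spin2 P m + 1))
     (kron X (1\<^sub>m (\<Prod>m\<in>{1..<n}. spin2 P m + 1)))"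

text \<open>\<open>f N \<star> \<dots> \<star> f 1\<close> and \<open>f 1 \<star> \<dots> \<star> f N\<close> for matrices of size \<open>d\<close>.\<close>

fun prod_desc :: "(complex, 'a) module \<Rightarrow> nat \<Rightarrow> (nat \<Rightarrow> 'a mat) \<Rightarrow> nat \<Rightarrow> 'a mat" where
  "prod_desc A d f 0 = mat_one A d"
| "prod_desc A d f (Suc n) = f (Suc n) \<star>\<^bsub>A\<^esub> prod_desc A d f n"

fun prod_asc :: "(complex, 'a) module \<Rightarrow> nat \<Rightarrow> (nat \<Rightarrow> 'a mat) \<Rightarrow> nat \<Rightarrow> 'a mat" where
  "prod_asc A d f 0 = mat_one A d"
| "prod_asc A d f (Suc n) = prod_asc A d f n \<star>\<^bsub>A\<^esub> f (Suc n)"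

definition L_op :: "chain \<Rightarrow> nat \<Rightarrow> complex \<Rightarrow> complex mat mat" where
  "L_op P n u = (let s = root_q P; a = spin2 P n in mat22
     (at_site P n ((u * s) \<cdot>\<^sub>m qexp s (spin_3 a) - (inverse u * inverse s) \<cdot>\<^sub>m qexp s (- spin_3 a)))
     (at_site P n (cfun (q_of P) \<cdot>\<^sub>m spin_minus s a))
     (at_site P n (cfun (q_of P) \<cdot>\<^sub>m spin_plus s a))
     (at_site P n ((u * s) \<cdot>\<^sub>m qexp s (- spin_3 a) - (inverse u * inverse s) \<cdot>\<^sub>m qexp s (spin_3 a))))"

definition dressed_K :: "chain \<Rightarrow> complex \<Rightarrow> complex mat mat" where
  "dressed_K P u =
     prod_desc (qend P) 2 (\<lambda>n. L_op P n (u * inhom P n)) (chain_len P)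
     \<star>\<^bsub>qend P\<^esub> scal_mat (qend P) (K_half (root_q P) (eps_plus P) (eps_minus P) (k_plus P) (k_minus P) u)
     \<star>\<^bsub>qend P\<^esub> prod_asc (qend P) 2 (\<lambda>n. L_op P n (u * inverse (inhom P n))) (chain_len P)"

text \<open>The defining property of the spin-chain representation: an algebra map that identifies
  the entries of the spin-1/2 K-operator with those of the dressed K-matrix. Since \<open>d\<^sub>N\<close> is
  nonzero for generic \<open>q\<close>, it determines the map on the algebra.\<close>

definition spin_chain_rep :: "chain \<Rightarrow> (falg set set \<Rightarrow> complex mat) \<Rightarrow> bool" where
  "spin_chain_rep P \<psi> \<longleftrightarrow>
     \<psi> \<in> alg_hom (AqN P) (qend P) \<and> (\<forall>u. u \<noteq> 0 \<longrightarrow> map_mat \<psi> (KN_half P u) = dressed_K P u)"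

text \<open>\<open>R\<close> acting on the quantum factor \<open>n\<close> (first leg) and the auxiliary space of spin \<open>a/2\<close>
  (second leg), as a matrix on the auxiliary space with entries in the endomorphisms of the
  quantum space.\<close>

definition R_site :: "chain \<Rightarrow> nat \<Rightarrow> nat \<Rightarrow> complex \<Rightarrow> complex mat mat" where
  "R_site P a n u = mat (a + 1) (a + 1) (\<lambda>(\<alpha>, \<beta>). at_site P n
     (mat (spin2 P n + 1) (spin2 P n + 1)
        (\<lambda>(m, m'). R_mat (root_q P) (spin2 P n) a u $$ (m * (a + 1) + \<alpha>, m' * (a + 1) + \<beta>))))"

definition T_mono :: "chain \<Rightarrow> nat \<Rightarrow> complex \<Rightarrow> complex mat mat" where
  "T_mono P a u = prod_desc (qend P) (a + 1) (\<lambda>n. R_site P a n (u * inhom P n)) (chain_len P)"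

definition T_mono_hat :: "chain \<Rightarrow> nat \<Rightarrow> complex \<Rightarrow> complex mat mat" where
  "T_mono_hat P a u = prod_asc (qend P) (a + 1) (\<lambda>n. R_site P a n (u * inverse (inhom P n))) (chain_len P)"

definition transfer :: "chain \<Rightarrow> nat \<Rightarrow> complex \<Rightarrow> complex mat" where
  "transfer P a u = mat_trace (qend P)
     (scal_mat (qend P) (K_dual P a u)
      \<star>\<^bsub>qend P\<^esub> T_mono P a u
      \<star>\<^bsub>qend P\<^esub> scal_mat (qend P)
          (K_mat (root_q P) (eps_plus P) (eps_minus P) (k_plus P) (k_minus P) a u)
      \<star>\<^bsub>qend P\<^esub> T_mono_hat P a u)"

definition c_factor :: "chain \<Rightarrow> nat \<Rightarrow> complex \<Rightarrow> complex" where
  "c_factor P a u = (\<Prod>n=1..chain_len P. \<Prod>k<spin2 P n - 1. \<Prod>l<a.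
     (let x = u * root_q P powi (int a + int (spin2 P n) - 2 * int k - 2 * int l - 2)
      in cfun (x * inhom P n) * cfun (x * inverse (inhom P n))))"

end

theory Submission
  imports Defs
begin

text \<open>
  The fused operators are determined by their spin-1/2 versions through a recursion that uses the
  fusion maps \<open>E\<close> and \<open>F\<close>. For the L-operators a direct computation shows that \<open>E\<close> intertwines the
  fused operator with the product of unfused ones; by induction on the spins this extends to all
  R-operators and, with the RLL relation, gives the Yang-Baxter equation with one spin-1/2 space.
  For K-operators the intertwining follows from the reflection equation at the point where \<open>R\<close>
  degenerates, and the reflection equation follows from the intertwining at smaller spin. Since \<open>E\<close>
  intertwines each factor of \<open>T(u) K(u) T'(u)\<close>, and since the Yang-Baxter equation moves the factors of
  different auxiliary spaces past each other, the dressed K-operator satisfies the same fusion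
  recursion as the operator \<open>K\<close> over the truncated algebra. Both agree at spin 1/2, by the definition of
  the representation, up to the scalar prefactors of the R-matrices, which multiply to \<open>c_factor\<close>.
  Multiplying by the dual K-matrix and taking traces gives the theorem.
\<close>

text \<open>A fused operator has the form F X E. The entries of F are chosen so that F E = 1, but E
  F is only a projection onto the range of E, so E (F X E) = X E requires X to preserve that range.
  This is the obstacle in every fusion relation: for L it is settled by computation, for R it is
  inherited from smaller spins, and for K it needs the reflection equation. Conversely, F E = 1
  makes E injective: an identity of operators on a spin (b+1)/2 leg may be checked after E has split
  that leg into a spin-1/2 leg and a spin b/2 leg, and E is then cancelled. This replaces appeals to
  invertibility of R or to generic spectral parameters, so the relations hold for every nonzero
  argument, including zeros of the prefactors. The dressed operator needs no reflection equation of
  its own, because its three factors are fused separately.\<close>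

section \<open>Operators on legs\<close>

text \<open>A configuration assigns a basis index to every leg, and a state is a function of configurations.
  \<open>leg_op a b i j M\<close> is the operator with kernel \<open>M\<close> on legs \<open>i\<close> and \<open>j\<close>: this encodes
  operators such as \<open>R\<^sub>i\<^sub>j\<close> on a multiple tensor product without Kronecker products.\<close>

type_synonym state = "(nat \<Rightarrow> nat) \<Rightarrow> complex"

definition leg_op :: "nat \<Rightarrow> nat \<Rightarrow> nat \<Rightarrow> nat \<Rightarrow> (nat \<Rightarrow> nat \<Rightarrow> nat \<Rightarrow> nat \<Rightarrow> complex) \<Rightarrow> state \<Rightarrow> state" where
  "leg_op a b i j M f = (\<lambda>c. \<Sum>k<a. \<Sum>l<b. M (c i) (c j) k l * f (c(i := k, j := l)))"

text \<open>Expresses that X ignores leg i. States carry no explicit tensor factorization, so this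
  is stated as commutation with freezing the index of leg i.\<close>

definition indep :: "nat \<Rightarrow> (state \<Rightarrow> state) \<Rightarrow> bool" where
  "indep i X \<longleftrightarrow> (\<forall>f v. X (\<lambda>c. f (c(i := v))) = (\<lambda>c. X f (c(i := v))))"

lemma leg_op_pairs: "leg_op a b i j M f c = (\<Sum>(k,l)\<in>{..<a}\<times>{..<b}. M (c i) (c j) k l * f (c(i := k, j := l)))"
  by (simp add: leg_op_def sum.cartesian_product)

text \<open>The legs i and j, or k and l, may coincide. One-leg operators such as \<open>Kop\<close>
  are encoded that way, so they are covered too.\<close>

lemma leg_op_commute:
  assumes "i \<noteq> k" "i \<noteq> l" "j \<noteq> k" "j \<noteq> l"
  shows "leg_op a b i j M (leg_op a' b' k l M' f) = leg_op a' b' k l M' (leg_op a b i j M f)"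
proof
  fix c :: "nat \<Rightarrow> nat"
  have upd: "c(i := x, j := y, k := z, l := w) = c(k := z, l := w, i := x, j := y)" for x y z w
    using assms by (auto simp: fun_eq_iff)
  have "leg_op a b i j M (leg_op a' b' k l M' f) c =
    (\<Sum>p\<in>{..<a}\<times>{..<b}. \<Sum>r\<in>{..<a'}\<times>{..<b'}. M (c i) (c j) (fst p) (snd p) *
       (M' (c k) (c l) (fst r) (snd r) * f (c(i := fst p, j := snd p, k := fst r, l := snd r))))"
    using assms by (simp add: leg_op_pairs case_prod_unfold sum_distrib_left)
  also have "\<dots> = (\<Sum>r\<in>{..<a'}\<times>{..<b'}. \<Sum>p\<in>{..<a}\<times>{..<b}. M' (c k) (c l) (fst r) (snd r) *
       (M (c i) (c j) (fst p) (snd p) * f (c(k := fst r, l := snd r, i := fst p, j := snd p))))"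
    by (subst sum.swap) (simp add: upd mult_ac)
  also have "\<dots> = leg_op a' b' k l M' (leg_op a b i j M f) c"
    using assms by (simp add: leg_op_pairs case_prod_unfold sum_distrib_left)
  finally show "leg_op a b i j M (leg_op a' b' k l M' f) c = leg_op a' b' k l M' (leg_op a b i j M f) c" .
qed

lemma indep_leg_op:
  assumes "v \<noteq> i" "v \<noteq> j"
  shows "indep v (leg_op a b i j M)"
  using assms by (auto simp: indep_def leg_op_def fun_eq_iff fun_upd_twist)

lemma indep_comp: "indep i X \<Longrightarrow> indep i Y \<Longrightarrow> indep i (\<lambda>f. X (Y f))"
  by (simp add: indep_def)

lemma indepD: "indep i X \<Longrightarrow> X (\<lambda>c. f (c(i := v))) = (\<lambda>c. X f (c(i := v)))"
  by (simp add: indep_def)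

lemma leg_op_scale: "leg_op a b i j M (\<lambda>c. x * f c) = (\<lambda>c. x * leg_op a b i j M f c)"
  by (simp add: leg_op_def sum_distrib_left mult_ac)

lemma leg_op_scale_kernel: "leg_op a b i j (\<lambda>p q k l. x * M p q k l) f = (\<lambda>c. x * leg_op a b i j M f c)"
  by (simp add: leg_op_def sum_distrib_left mult_ac)

lemma leg_op_cong:
  assumes "\<And>p q k l. k < a \<Longrightarrow> l < b \<Longrightarrow> M p q k l = M' p q k l"
  shows "leg_op a b i j M = leg_op a b i j M'"
  unfolding leg_op_def using assms by (intro ext sum.cong refl) auto

lemma leg_op_swap:
  assumes "i \<noteq> j"
  shows "leg_op a b i j M = leg_op b a j i (\<lambda>p q k l. M q p l k)"
proof (intro ext)
  fix f and c :: "nat \<Rightarrow> nat"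
  have "c(i := k, j := l) = c(j := l, i := k)" for k l
    using assms by (simp add: fun_upd_twist)
  then show "leg_op a b i j M f c = leg_op b a j i (\<lambda>p q k l. M q p l k) f c"
    unfolding leg_op_def by (subst sum.swap) simp
qed

section \<open>Fusion maps and L-operators\<close>

text \<open>Matrix element of \<open>spin_plus\<close> and \<open>spin_minus\<close> between the
  basis indices m - 1 and m, counted from 0. It vanishes at m = 0 and m = b + 1, so boundary terms
  disappear by themselves.\<close>

definition ladder :: "complex \<Rightarrow> nat \<Rightarrow> nat \<Rightarrow> complex" where
  "ladder s b m = Bcoef s (int b) (int b + 2 - 2 * int m)"

text \<open>Lower block of \<open>E_mat\<close>: the entry from the fused index m to index 1 on the
  spin-1/2 leg and m - 1 on the other leg.\<close>

definition E_low :: "complex \<Rightarrow> nat \<Rightarrow> nat \<Rightarrow> complex" where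
  "E_low s a m = qnum s (2 * int m) * E_diag s a (m - 1) / ladder s a m"

text \<open>This is \<open>R_half\<close> without its scalar prefactor. Leg indices are arbitrary
  naturals, so output indices outside the representation give 0; input indices are bounded by the
  sums in \<open>leg_op\<close>.\<close>

definition L_ker :: "complex \<Rightarrow> nat \<Rightarrow> complex \<Rightarrow> nat \<Rightarrow> nat \<Rightarrow> nat \<Rightarrow> nat \<Rightarrow> complex" where
  "L_ker s b u i m i' m' =
    (if m \<le> b then
       if i = 0 then
         if i' = 0 \<and> m' = m then cfun (u * s powi (1 + int b - 2 * int m))
         else if i' = 1 \<and> Suc m' = m then cfun (s\<^sup>2) * ladder s b m else 0
       else if i = 1 then
         if i' = 1 \<and> m' = m then cfun (u * s powi (1 - int b + 2 * int m))
         else if i' = 0 \<and> m' = Suc m then cfun (s\<^sup>2) * ladder s b (Suc m) else 0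
       else 0
     else 0)"

definition E_ker :: "complex \<Rightarrow> nat \<Rightarrow> nat \<Rightarrow> nat \<Rightarrow> nat \<Rightarrow> nat \<Rightarrow> complex" where
  "E_ker s a i n k m =
     (if n < a then
        if i = 0 \<and> m = n then E_diag s a n
        else if i = 1 \<and> m = Suc n then E_low s a m else 0
      else 0)"

text \<open>The output index p does not enter: F returns a state that ignores leg i, while E reads
  its argument at index 0 of that leg. Hence F E is the identity up to setting leg i to 0.\<close>

definition F_ker :: "complex \<Rightarrow> nat \<Rightarrow> nat \<Rightarrow> nat \<Rightarrow> nat \<Rightarrow> nat \<Rightarrow> complex" where
  "F_ker s a p m k l = (if m \<le> a then F_mat s a $$ (m, k * a + l) else 0)"

text \<open>The fusion maps relate a spin-1/2 leg \<open>i\<close> and a leg \<open>j\<close> to the fused space, which sits on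
  leg \<open>j\<close>, the leg \<open>i\<close> being frozen at the index 0.\<close>

abbreviation Lop where "Lop s b u i j \<equiv> leg_op 2 (Suc b) i j (L_ker s b u)"
abbreviation Eop where "Eop s a i j \<equiv> leg_op (Suc 0) (Suc a) i j (E_ker s a)"
abbreviation Fop where "Fop s a i j \<equiv> leg_op 2 a i j (F_ker s a)"

lemma powi_via_power:
  assumes "s \<noteq> (0::complex)"
  shows "s powi (2 * int n) = (s ^ n)\<^sup>2"
  by (metis of_nat_mult of_nat_numeral power_int_of_nat power_mult mult.commute)

locale generic_root =
  fixes s :: complex
  assumes s0: "s \<noteq> 0" and s_generic: "\<And>n::nat. n \<ge> 1 \<Longrightarrow> s ^ n \<noteq> 1"
begin

lemma cfun_sq_nonzero: "cfun (s\<^sup>2) \<noteq> 0"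
proof
  assume "cfun (s\<^sup>2) = 0"
  then have "s ^ 4 = 1"
    using s0 by (simp add: cfun_def field_simps power2_eq_square power4_eq_xxxx)
  then show False using s_generic[of 4] by simp
qed

lemma cfun_powi_nonzero: "k > 0 \<Longrightarrow> cfun (s powi (- k)) \<noteq> 0"
proof
  assume "k > 0" "cfun (s powi (- k)) = 0"
  then have "s powi (- k) * s powi (- k) = 1"
    using s0 by (simp add: cfun_def field_simps)
  then have "s powi (2 * k) = 1"
    using s0 by (simp add: power_int_minus field_simps flip: power_int_add)
  then have "s ^ nat (2 * k) = 1" using \<open>k > 0\<close> by (simp add: power_int_def split: if_splits)
  then show False using s_generic[of "nat (2*k)"] \<open>k > 0\<close> by simp
qed

lemma qnum_nonzero: "m > 0 \<Longrightarrow> qnum s (2 * int m) \<noteq> 0"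
  using cfun_powi_nonzero[of "2 * int m"] cfun_sq_nonzero s0
  by (simp add: qnum_def cfun_def power_int_minus)

lemma qnum_zero [simp]: "qnum s 0 = 0"
  by (simp add: qnum_def)

text \<open>Apart from the normalization \<open>ladder_one\<close>, this is all that is used about
  \<open>csqrt\<close>: wherever a ladder coefficient has to be evaluated, it is brought into a
  square first.\<close>

lemma ladder_sq: "m \<le> Suc b \<Longrightarrow> ladder s b m * ladder s b m = qnum s (2 * int (Suc b - m)) * qnum s (2 * int m)"
  unfolding ladder_def Bcoef_def
  by (simp add: of_nat_diff power2_eq_square[symmetric] algebra_simps)

lemma ladder_zero [simp]: "ladder s b 0 = 0" "ladder s b (Suc b) = 0"
  using ladder_sq[of 0 b] ladder_sq[of "Suc b" b] by auto

lemma ladder_nonzero: "1 \<le> m \<Longrightarrow> m \<le> b \<Longrightarrow> ladder s b m \<noteq> 0"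
  using ladder_sq[of m b] qnum_nonzero[of m] qnum_nonzero[of "Suc b - m"] by auto

lemma ladder_one [simp]: "ladder s 1 1 = 1" "ladder s (Suc 0) (Suc 0) = 1"
proof -
  have "qnum s 2 = 1" using cfun_sq_nonzero s0 by (simp add: qnum_def cfun_def power_int_minus)
  then show "ladder s 1 1 = 1" "ladder s (Suc 0) (Suc 0) = 1"
    by (simp_all add: ladder_def Bcoef_def)
qed

lemma E_diag_0 [simp]: "E_diag s a 0 = 1"
  by (simp add: E_diag_def)

lemma E_diag_Suc: "E_diag s (Suc b) (Suc m) = E_diag s (Suc b) m * ladder s b (Suc m) / ladder s (Suc b) (Suc m)"
  by (simp add: E_diag_def ladder_def algebra_simps)

lemma E_diag_nonzero: "m < a \<Longrightarrow> E_diag s a m \<noteq> 0"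
proof (cases a)
  case (Suc b)
  show "m < a \<Longrightarrow> E_diag s a m \<noteq> 0"
  proof (induction m)
    case (Suc m)
    then show ?case using \<open>a = Suc b\<close> ladder_nonzero[of "Suc m" b] ladder_nonzero[of "Suc m" "Suc b"]
      by (simp add: E_diag_Suc)
  qed auto
qed simp

lemma E_low_nonzero: "1 \<le> m \<Longrightarrow> m \<le> a \<Longrightarrow> E_low s a m \<noteq> 0"
  using E_diag_nonzero[of "m - 1" a] qnum_nonzero[of m] ladder_nonzero[of m a]
  by (simp add: E_low_def)

text \<open>For \<open>c j = 0\<close> the index \<open>c j - 1\<close> is truncated, and for
  \<open>c j = b\<close> the index \<open>Suc (c j)\<close> is out of range; both terms may stay in
  the formula because \<open>ladder\<close> vanishes there.\<close>

lemma Lop_eval: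
  assumes "i \<noteq> j"
  shows "Lop s b u i j f c =
    (if c j \<le> b then
       if c i = 0 then cfun (u * s powi (1 + int b - 2 * int (c j))) * f (c(i := 0, j := c j))
         + cfun (s\<^sup>2) * ladder s b (c j) * f (c(i := 1, j := c j - 1))
       else if c i = 1 then cfun (u * s powi (1 - int b + 2 * int (c j))) * f (c(i := 1, j := c j))
         + cfun (s\<^sup>2) * ladder s b (Suc (c j)) * f (c(i := 0, j := Suc (c j)))
       else 0
     else 0)"
proof -
  have d1: "(\<Sum>l<Suc b. (if l = m then x else 0) * g l) = (if m \<le> b then x * g m else 0)" for m x and g :: "nat \<Rightarrow> complex"
    using sum.delta[of "{..<Suc b}" m "\<lambda>l. x * g l"]
    by (simp add: if_distrib[of "\<lambda>x. x * _"] cong: if_cong)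
  have d2: "(\<Sum>l<Suc b. (if Suc l = m then x else 0) * g l) = (if 1 \<le> m \<and> m \<le> Suc b then x * g (m - 1) else 0)" for m x and g :: "nat \<Rightarrow> complex"
  proof (cases m)
    case (Suc n)
    show ?thesis unfolding Suc by (simp only: nat.inject d1) auto
  qed simp
  have two: "(\<Sum>k<(2::nat). g k) = g 0 + g 1" for g :: "nat \<Rightarrow> complex"
    by (simp add: numeral_2_eq_2)
  have d3: "(\<Sum>l<Suc b. (if l = Suc m then x else 0) * g l) = (if m < b then x * g (Suc m) else 0)" for m x and g :: "nat \<Rightarrow> complex"
    using d1[of "Suc m" x g] by (simp only: Suc_le_eq)
  have z: "ladder s b (c j) = 0" if "\<not> 1 \<le> c j"
    using that by (simp add: not_le)
  have z': "ladder s b (Suc (c j)) = 0" if "c j \<le> b" "\<not> c j < b"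
    using that by simp
  consider "\<not> c j \<le> b" | "c j \<le> b" "c i = 0" | "c j \<le> b" "c i = 1" | "c j \<le> b" "c i \<noteq> 0" "c i \<noteq> 1"
    by blast
  then show ?thesis
  proof cases
    case 2
    then show ?thesis
      unfolding leg_op_def two L_ker_def using z
      by (cases "1 \<le> c j") (simp_all add: d1 d2 del: sum.lessThan_Suc cong: if_cong)
  next
    case 3
    then show ?thesis
      unfolding leg_op_def two L_ker_def using z'
      by (cases "c j < b") (simp_all add: d1 d3 del: sum.lessThan_Suc cong: if_cong)
  qed (simp_all add: leg_op_def L_ker_def del: sum.lessThan_Suc)
qed

lemma Eop_eval:
  "Eop s a i j f c =
    (if c j < a then
       if c i = 0 then E_diag s a (c j) * f (c(i := 0, j := c j))
       else if c i = 1 then E_low s a (Suc (c j)) * f (c(i := 0, j := Suc (c j)))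
       else 0
     else 0)"
proof -
  have d1: "m \<le> a \<Longrightarrow> (\<Sum>l<Suc a. (if l = m then x l else 0) * g l) = x m * g m" for m x and g :: "nat \<Rightarrow> complex"
    using sum.delta[of "{..<Suc a}" m "\<lambda>l. x l * g l"]
    by (simp add: if_distrib[of "\<lambda>x. x * _"] cong: if_cong)
  have one: "(\<Sum>k<Suc 0. g k) = g 0" for g :: "nat \<Rightarrow> complex"
    by simp
  show ?thesis
    unfolding leg_op_def E_ker_def one
    by (cases "c j < a"; cases "c i = 0"; cases "c i = 1") (simp_all add: d1 del: sum.lessThan_Suc cong: if_cong)
qed

lemma E_entry_diag: "m < a \<Longrightarrow> E_entry s a (Suc m) (Suc m) = E_diag s a m"
  by (simp add: E_entry_def)

lemma E_entry_lower: "1 \<le> m \<Longrightarrow> m \<le> a \<Longrightarrow> E_entry s a (m + a) (Suc m) = E_low s a m"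
  by (auto simp: E_entry_def E_low_def Let_def ladder_def algebra_simps)

lemma E_mat_ker:
  assumes "i < 2" "n < a" "m \<le> a"
  shows "E_mat s a $$ (i * a + n, m) = E_ker s a i n 0 m"
proof -
  have "E_mat s a $$ (i * a + n, m) = E_entry s a (Suc (i * a + n)) (Suc m)"
    using assms by (auto simp: E_mat_def mat1_def less_2_cases_iff)
  also have "\<dots> = E_ker s a i n 0 m"
    using assms less_2_cases[OF assms(1)]
    by (auto simp: E_entry_def E_ker_def E_low_def Let_def ladder_def algebra_simps)
  finally show ?thesis .
qed

definition F_left :: "nat \<Rightarrow> nat \<Rightarrow> complex" where
  "F_left a m = F_entry s a (Suc m) (Suc m)"

definition F_right :: "nat \<Rightarrow> nat \<Rightarrow> complex" where
  "F_right a m = F_entry s a (Suc m) (m + a)"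

lemma F_ker_sparse:
  assumes "k < 2" "l < a"
  shows "F_ker s a p m k l =
    (if m \<le> a then if k = 0 \<and> l = m then F_left a m else if k = 1 \<and> Suc l = m then F_right a m else 0 else 0)"
proof (cases "m \<le> a")
  case True
  then have "F_ker s a p m k l = F_entry s a (Suc m) (Suc (k * a + l))"
    using assms by (auto simp: F_ker_def F_mat_def mat1_def less_2_cases_iff)
  also have "\<dots> = (if k = 0 \<and> l = m then F_left a m else if k = 1 \<and> Suc l = m then F_right a m else 0)"
    using assms less_2_cases[OF assms(1)] True
    by (auto simp: F_entry_def F_left_def F_right_def)
  finally show ?thesis using True by simp
qed (simp add: F_ker_def)

text \<open>The diagonal entry of \<open>F_mat\<close> is defined as whatever makes this sum equal
  to 1. So the formula for \<open>F_upper\<close>, and whether its denominator vanishes, does not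
  matter.\<close>

lemma F_left_inverse:
  assumes "m < a"
  shows "F_left a m * E_diag s a m + (if 1 \<le> m then F_right a m * E_low s a m else 0) = 1"
proof (cases "m = 0")
  case True
  then show ?thesis by (simp add: F_left_def F_entry_def)
next
  case False
  have "F_left a m = (1 - F_upper s a (Suc m) * E_low s a m) / E_diag s a m"
    using assms False by (simp add: F_left_def F_entry_def E_entry_diag E_entry_lower)
  moreover have "F_right a m = F_upper s a (Suc m)"
    using assms False by (auto simp: F_right_def F_entry_def)
  ultimately show ?thesis using False E_diag_nonzero[OF assms] by simp
qed

lemma F_right_inverse:
  assumes "1 \<le> a"
  shows "F_right a a * E_low s a a = 1"
proof -
  have "F_right a a = inverse (E_low s a a)"
    using assms E_entry_lower[of a a] by (simp add: F_right_def F_entry_def mult_2)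
  then show ?thesis using E_low_nonzero[of a a] assms by simp
qed

lemma Fop_eval:
  assumes "i \<noteq> j"
  shows "Fop s a i j f c =
    (if c j \<le> a then
       (if c j < a then F_left a (c j) * f (c(i := 0, j := c j)) else 0)
       + (if 1 \<le> c j then F_right a (c j) * f (c(i := 1, j := c j - 1)) else 0)
     else 0)"
proof -
  have d1: "(\<Sum>l<a. (if l = m then x else 0) * g l) = (if m < a then x * g m else 0)" for m x and g :: "nat \<Rightarrow> complex"
    using sum.delta[of "{..<a}" m "\<lambda>l. x * g l"]
    by (simp add: if_distrib[of "\<lambda>x. x * _"] cong: if_cong)
  have d2: "m \<le> a \<Longrightarrow> (\<Sum>l<a. (if Suc l = m then x else 0) * g l) = (if 1 \<le> m then x * g (m - 1) else 0)" for m x and g :: "nat \<Rightarrow> complex"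
  proof (cases m)
    case (Suc n)
    show "m \<le> a \<Longrightarrow> ?thesis" unfolding Suc by (simp only: nat.inject d1) auto
  qed simp
  have two: "(\<Sum>k<(2::nat). g k) = g 0 + g 1" for g :: "nat \<Rightarrow> complex"
    by (simp add: numeral_2_eq_2)
  have "Fop s a i j f c = (\<Sum>k<2. \<Sum>l<a. (if c j \<le> a then if k = 0 \<and> l = c j then F_left a (c j)
      else if k = 1 \<and> Suc l = c j then F_right a (c j) else 0 else 0) * f (c(i := k, j := l)))"
    unfolding leg_op_def
    by (intro sum.cong refl) (subst F_ker_sparse, auto)
  also have "\<dots> = (if c j \<le> a then
       (if c j < a then F_left a (c j) * f (c(i := 0, j := c j)) else 0)
       + (if 1 \<le> c j then F_right a (c j) * f (c(i := 1, j := c j - 1)) else 0)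
     else 0)"
    unfolding two by (cases "c j \<le> a") (simp_all add: d1 d2 cong: if_cong)
  finally show ?thesis .
qed

text \<open>Row m of F and column m' of E are both supported where the two indices of the unfused
  legs add up to m and m', respectively. They overlap only for m = m', and there
  \<open>F_left_inverse\<close> and \<open>F_right_inverse\<close> give 1.\<close>

lemma FE_id:
  assumes "i \<noteq> j" "1 \<le> a"
  shows "Fop s a i j (Eop s a i j f) c = (if c j \<le> a then f (c(i := 0)) else 0)"
proof -
  have *: "c j = x \<Longrightarrow> c(i := 0, j := x) = c(i := 0)" for x using assms by (auto simp: fun_eq_iff)
  have **: "c(i := 1, j := x, i := 0, j := c j) = c(i := 0)" 
     "c(i := 0, j := x, i := 0, j := c j) = c(i := 0)" for x using assms by (auto simp: fun_eq_iff)
  consider "\<not> c j \<le> a" | "c j < a" | "c j = a" by linarith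
  then show ?thesis
  proof cases
    case 2
    have "Fop s a i j (Eop s a i j f) c =
       (F_left a (c j) * E_diag s a (c j) + (if 1 \<le> c j then F_right a (c j) * E_low s a (c j) else 0)) * f (c(i:=0))"
      using 2 assms by (cases "c j") (auto simp: Fop_eval Eop_eval * ** algebra_simps)
    then show ?thesis using 2 by (simp only: F_left_inverse) simp
  next
    case 3
    have "Fop s a i j (Eop s a i j f) c = (F_right a a * E_low s a a) * f (c(i:=0))"
      using 3 assms ** by (cases a) (auto simp: Fop_eval Eop_eval * ** algebra_simps)
    then show ?thesis using 3 assms by (simp only: F_right_inverse) simp
  qed (simp add: Fop_eval assms)
qed

lemma Eop_reset: 
  assumes "i \<noteq> j"
  shows "Eop s a i j (\<lambda>c. f (c(i := 0))) = Eop s a i j f"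
proof -
  have "c(i := 0, j := l, i := 0) = c(i := 0, j := l)" for c :: "nat \<Rightarrow> nat" and l
    using assms by (auto simp: fun_eq_iff)
  then show ?thesis by (simp add: leg_op_def)
qed

lemma EFE:
  assumes "i \<noteq> j" "1 \<le> a"
  shows "Eop s a i j (Fop s a i j (Eop s a i j f)) = Eop s a i j f"
proof -
  have "Eop s a i j (Fop s a i j (Eop s a i j f)) = Eop s a i j (\<lambda>c. f (c(i := 0)))"
    unfolding FE_id[OF assms, abs_def] by (rule ext) (auto simp: leg_op_def)
  then show ?thesis by (simp only: Eop_reset[OF assms(1)])
qed

text \<open>The cancellation principle: X and Y act on leg j, while i is an auxiliary leg that they
  ignore. Applying F to the hypothesis on E removes E, and the support conditions handle the indices
  of leg j on which E loses information.\<close>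

lemma Eop_cancel:
  assumes "i \<noteq> j" "1 \<le> a" "indep i X" "indep i Y"
    and "\<And>f. Eop s a i j (X f) = Eop s a i j (Y f)"
    and "\<And>f c. c j > a \<Longrightarrow> X f c = 0" "\<And>f c. c j > a \<Longrightarrow> Y f c = 0"
  shows "X f = Y f"
proof
  fix c :: "nat \<Rightarrow> nat"
  have upd: "c(i := 0, i := c i) = c" by simp
  show "X f c = Y f c"
  proof (cases "c j \<le> a")
    case True
    \<comment> \<open>F E returns values at index 0 of leg i only. Freezing leg i of the argument at
      \<open>c i\<close> beforehand makes this no loss, since X and Y commute with freezing.\<close>
    let ?f = "\<lambda>d. f (d(i := c i))"
    have "X ?f (c(i := 0)) = Y ?f (c(i := 0))"
      using FE_id[OF assms(1,2), of "X ?f" c] FE_id[OF assms(1,2), of "Y ?f" c] True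
      by (simp add: assms(5))
    then show ?thesis by (simp add: indepD[OF assms(3)] indepD[OF assms(4)])
  next
    case False
    then show ?thesis using assms(6,7) by simp
  qed
qed

end

section \<open>R-matrices as two-leg kernels\<close>

definition R_ker :: "complex \<Rightarrow> nat \<Rightarrow> nat \<Rightarrow> complex \<Rightarrow> nat \<Rightarrow> nat \<Rightarrow> nat \<Rightarrow> nat \<Rightarrow> complex" where
  "R_ker s a b u m n m' n' =
     (if m \<le> a \<and> n \<le> b then R_mat s a b u $$ (m * Suc b + n, m' * Suc b + n') else 0)"

abbreviation Rop where "Rop s a b u i j \<equiv> leg_op (Suc a) (Suc b) i j (R_ker s a b u)"

definition R_pref :: "complex \<Rightarrow> nat \<Rightarrow> complex \<Rightarrow> complex" where
  "R_pref s b u = (\<Prod>k<b - 1. cfun (u * s powi (int b - 1 - 2 * int k)))"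

lemma pair_less: "x < A \<Longrightarrow> y < B \<Longrightarrow> x * B + y < A * (B::nat)"
proof -
  assume "x < A" "y < B"
  then have "x * B + y < Suc x * B" by simp
  also have "\<dots> \<le> A * B" using \<open>x < A\<close> by (intro mult_right_mono) auto
  finally show ?thesis .
qed

lemma R_half_ker:
  assumes "1 \<le> b" "i < 2" "i' < 2" "m \<le> b" "m' \<le> b"
  shows "R_half s b u $$ (i * Suc b + m, i' * Suc b + m') = R_pref s b u * L_ker s b u i m i' m'"
proof -
  define I J where "I = i * Suc b + m" and "J = i' * Suc b + m'"
  have lt: "I < 2 * Suc b" "J < 2 * Suc b"
    unfolding I_def J_def using assms by (auto intro!: pair_less simp del: mult_Suc mult_Suc_right)
  have dm: "I div Suc b = i" "I mod Suc b = m" "J div Suc b = i'" "J mod Suc b = m'"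
    unfolding I_def J_def using assms by (simp_all del: mult_Suc mult_Suc_right)
  have eq: "I = J \<longleftrightarrow> i = i' \<and> m = m'"
    using dm unfolding I_def J_def by metis
  have dims: "dim_row (spin_minus s b) = Suc b" "dim_col (spin_minus s b) = Suc b"
     "dim_row (spin_plus s b) = Suc b" "dim_col (spin_plus s b) = Suc b"
     "dim_row (spin_3 b) = Suc b" "dim_col (spin_3 b) = Suc b"
     "dim_row sigma_plus = 2" "dim_col sigma_plus = 2" "dim_row sigma_minus = 2" "dim_col sigma_minus = 2"
     "dim_row sigma_z = 2" "dim_col sigma_z = 2"
    by (simp_all add: spin_minus_def spin_plus_def spin_3_def mat1_def sigma_plus_def sigma_minus_def sigma_z_def mat22_def)
  have k1: "kron sigma_plus (spin_minus s b) $$ (I, J) =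
      (if i = 0 \<and> i' = 1 \<and> Suc m' = m then ladder s b m else 0)"
    using lt assms less_2_cases[OF assms(2)] less_2_cases[OF assms(3)]
    by (auto simp: kron_by_def dims dm sigma_plus_def mat22_def spin_minus_def mat1_def ladder_def algebra_simps)
  have k2: "kron sigma_minus (spin_plus s b) $$ (I, J) =
      (if i = 1 \<and> i' = 0 \<and> m' = Suc m then ladder s b (Suc m) else 0)"
    using lt assms less_2_cases[OF assms(2)] less_2_cases[OF assms(3)]
    by (auto simp: kron_by_def dims dm sigma_minus_def mat22_def spin_plus_def mat1_def ladder_def algebra_simps)
  have k3: "kron sigma_z (spin_3 b) $$ (I, I) =
      (if i = 0 then int b - 2 * int m else 2 * int m - int b)"
    using lt assms less_2_cases[OF assms(2)]
    by (auto simp: kron_by_def dims dm sigma_z_def mat22_def spin_3_def mat1_def algebra_simps)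
  have kd: "dim_row (kron X Y) = dim_row X * dim_row Y" "dim_col (kron X Y) = dim_col X * dim_col Y" for X Y :: "'b::times mat"
    by (simp_all add: kron_by_def)
  define ex where "ex = (if i = 0 then 1 + int b - 2 * int m else 1 - int b + 2 * int m)"
  have M: "(1\<^sub>m (2 * (b + 1)) + kron sigma_z (spin_3 b)) $$ (I, I) = ex"
    using lt k3 by (simp add: kd dims ex_def)
  have q1: "qexp s (1\<^sub>m (2 * (b + 1)) + kron sigma_z (spin_3 b)) $$ (I, J)
     = (if i = i' \<and> m = m' then s powi ex else 0)"
    using lt eq M by (auto simp: qexp_def kd dims)
  have q2: "qexp s (- (1\<^sub>m (2 * (b + 1)) + kron sigma_z (spin_3 b))) $$ (I, J)
     = (if i = i' \<and> m = m' then inverse (s powi ex) else 0)"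
    using lt eq M by (auto simp: qexp_def kd dims power_int_minus[symmetric])
  have qd: "dim_row (qexp s M) = dim_row M" "dim_col (qexp s M) = dim_row M" for M
    by (simp_all add: qexp_def)
  have b0: "b \<noteq> 0" using assms by simp
  have "R_half s b u $$ (I, J) = R_pref s b u * (cfun (s\<^sup>2) * (kron sigma_plus (spin_minus s b) $$ (I, J)
     + kron sigma_minus (spin_plus s b) $$ (I, J))
     + u * (qexp s (1\<^sub>m (2 * (b + 1)) + kron sigma_z (spin_3 b)) $$ (I, J))
     - inverse u * (qexp s (- (1\<^sub>m (2 * (b + 1)) + kron sigma_z (spin_3 b))) $$ (I, J)))"
    using lt b0 by (simp add: R_half_def R_pref_def kd dims qd)
  also have "\<dots> = R_pref s b u * L_ker s b u i m i' m'"
    unfolding k1 k2 q1 q2 using assms less_2_cases[OF assms(2)] less_2_cases[OF assms(3)]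
    by (auto simp: L_ker_def cfun_def ex_def)
  finally show ?thesis unfolding I_def J_def .
qed

lemma Rop_half:
  assumes "1 \<le> b"
  shows "Rop s (Suc 0) b u i j f = (\<lambda>c. R_pref s b u * Lop s b u i j f c)"
proof -
  have "leg_op 2 (Suc b) i j (R_ker s (Suc 0) b u) = leg_op 2 (Suc b) i j (\<lambda>p q k l. R_pref s b u * L_ker s b u p q k l)"
  proof (rule leg_op_cong)
    fix p q k l :: nat assume kl: "k < 2" "l < Suc b"
    show "R_ker s (Suc 0) b u p q k l = R_pref s b u * L_ker s b u p q k l"
    proof (cases "p < 2 \<and> q \<le> b")
      case True
      then show ?thesis using kl assms R_half_ker[of b p k q l s u] by (simp add: R_ker_def)
    next
      case False
      then show ?thesis by (auto simp: R_ker_def L_ker_def)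
    qed
  qed
  then show ?thesis by (simp add: leg_op_scale_kernel numeral_2_eq_2)
qed

section \<open>Fusion of L-operators\<close>

definition L_diag0 :: "complex \<Rightarrow> nat \<Rightarrow> complex \<Rightarrow> nat \<Rightarrow> complex" where
  "L_diag0 s b u m = cfun (u * s powi (1 + int b - 2 * int m))"

definition L_diag1 :: "complex \<Rightarrow> nat \<Rightarrow> complex \<Rightarrow> nat \<Rightarrow> complex" where
  "L_diag1 s b u m = cfun (u * s powi (1 - int b + 2 * int m))"

definition qint :: "complex \<Rightarrow> nat \<Rightarrow> complex" where
  "qint s m = qnum s (2 * int m)"

context generic_root begin

lemma Lop_ev:
  assumes "i \<noteq> j"
  shows "Lop s b u i j f c =
    (if c j \<le> b then
       if c i = 0 then L_diag0 s b u (c j) * f (c(i := 0, j := c j))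
         + cfun (s\<^sup>2) * ladder s b (c j) * f (c(i := 1, j := c j - 1))
       else if c i = 1 then L_diag1 s b u (c j) * f (c(i := 1, j := c j))
         + cfun (s\<^sup>2) * ladder s b (Suc (c j)) * f (c(i := 0, j := Suc (c j)))
       else 0
     else 0)"
  by (simp only: Lop_eval[OF assms] L_diag0_def L_diag1_def)

text \<open>The prefactor clears the denominator of the q-integer, so that only Laurent polynomials
  in s remain in the coefficient identities.\<close>

lemma cfun_qint: "cfun (s\<^sup>2) * qint s k = (s ^ k)\<^sup>2 - inverse ((s ^ k)\<^sup>2)"
  using cfun_sq_nonzero s0 by (simp add: qint_def qnum_def power_int_minus powi_via_power)

text \<open>This and the next five relations are all that is needed about the entries of E when
  L-operators are compared. Each one either trades a ladder coefficient for a q-integer or moves it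
  between the spins b/2 and (b+1)/2.\<close>

lemma E_low_ladder: "1 \<le> m \<Longrightarrow> m \<le> b \<Longrightarrow> E_low s (Suc b) m * ladder s b m = qint s m * E_diag s (Suc b) m"
  by (cases m) (auto simp: E_low_def qint_def E_diag_Suc)

lemma E_diag_ladder: "1 \<le> m \<Longrightarrow> m \<le> b \<Longrightarrow> E_diag s (Suc b) m * ladder s b m = qint s (Suc b - m) * E_low s (Suc b) m"
proof (cases m)
  case (Suc n)
  assume "1 \<le> m" "m \<le> b"
  then show ?thesis using ladder_sq[of m b, folded qint_def] unfolding Suc
    by (simp add: E_low_def qint_def E_diag_Suc)
qed simp

lemma E_diag_ladder_Suc: "Suc m \<le> b \<Longrightarrow> E_diag s (Suc b) (Suc m) * ladder s (Suc b) (Suc m) = ladder s b (Suc m) * E_diag s (Suc b) m"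
  using ladder_nonzero[of "Suc m" "Suc b"] by (simp add: E_diag_Suc)

lemma E_low_ladder_Suc: "m \<le> b \<Longrightarrow> E_low s (Suc b) (Suc m) * ladder s (Suc b) (Suc m) = qint s (Suc m) * E_diag s (Suc b) m"
  using ladder_nonzero[of "Suc m" "Suc b"] by (simp add: E_low_def qint_def)

lemma E_diag_ladder_E_low: "m \<le> b \<Longrightarrow> E_diag s (Suc b) m * ladder s (Suc b) (Suc m) = qint s (Suc b - m) * E_low s (Suc b) (Suc m)"
proof -
  assume "m \<le> b"
  then have "ladder s (Suc b) (Suc m) * ladder s (Suc b) (Suc m) = qint s (Suc b - m) * qint s (Suc m)"
    "ladder s (Suc b) (Suc m) \<noteq> 0"
    using ladder_sq[of "Suc m" "Suc b", folded qint_def] ladder_nonzero[of "Suc m" "Suc b"] by auto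
  then show ?thesis by (simp add: E_low_def qint_def field_simps)
qed

lemma ladder_E_low_Suc: "m < b \<Longrightarrow> ladder s b (Suc m) * E_low s (Suc b) (Suc (Suc m)) = ladder s (Suc b) (Suc (Suc m)) * E_low s (Suc b) (Suc m)"
proof -
  assume m: "m < b"
  have nz: "ladder s (Suc b) (Suc (Suc m)) \<noteq> 0" "ladder s b (Suc m) \<noteq> 0"
    using m ladder_nonzero by auto
  have sq: "ladder s (Suc b) (Suc (Suc m)) * ladder s (Suc b) (Suc (Suc m)) = qint s (b - m) * qint s (Suc (Suc m))"
    "ladder s b (Suc m) * ladder s b (Suc m) = qint s (b - m) * qint s (Suc m)"
    using ladder_sq[of "Suc (Suc m)" "Suc b", folded qint_def] ladder_sq[of "Suc m" b, folded qint_def] m by auto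
  have e: "E_low s (Suc b) (Suc (Suc m)) * ladder s (Suc b) (Suc (Suc m)) = qint s (Suc (Suc m)) * E_diag s (Suc b) (Suc m)"
    "E_low s (Suc b) (Suc m) * ladder s b (Suc m) = qint s (Suc m) * E_diag s (Suc b) (Suc m)"
    using E_low_ladder_Suc[of "Suc m" b] E_low_ladder[of "Suc m" b] m by auto
  \<comment> \<open>Multiplying by both ladder coefficients leaves only squares of them and products
    known from \<open>e\<close>; they are divided out at the end.\<close>
  have "(ladder s b (Suc m) * E_low s (Suc b) (Suc (Suc m))) * (ladder s b (Suc m) * ladder s (Suc b) (Suc (Suc m)))
    = (ladder s b (Suc m) * ladder s b (Suc m)) * (E_low s (Suc b) (Suc (Suc m)) * ladder s (Suc b) (Suc (Suc m)))"
    by (simp only: mult_ac)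
  also have "\<dots> = (ladder s (Suc b) (Suc (Suc m)) * ladder s (Suc b) (Suc (Suc m))) * (E_low s (Suc b) (Suc m) * ladder s b (Suc m))"
    unfolding e sq by (simp only: mult_ac)
  also have "\<dots> = (ladder s (Suc b) (Suc (Suc m)) * E_low s (Suc b) (Suc m)) * (ladder s b (Suc m) * ladder s (Suc b) (Suc (Suc m)))"
    by (simp only: mult_ac)
  finally show ?thesis using nz by simp
qed

text \<open>Splits exponents that are affine in b and m, so that s^b and s^m become independent
  variables for \<open>field_simps\<close>.\<close>

lemmas powi_split = power_int_add power_int_diff power_int_minus powi_via_power

text \<open>The four coefficient identities are what remains of \<open>L_fusion\<close> after the
  entries of E have been factored out. They are identities of Laurent polynomials in u, s, s^b and
  s^m; where b - m occurs, the bound m \<le> b turns s^(b-m) into a quotient.\<close>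

lemma L_fusion_coef1:
  assumes "u \<noteq> 0" "m \<le> b"
  shows "L_diag1 s (Suc b) u 0 * L_diag0 s (Suc b) u m + cfun (s\<^sup>2) * (cfun (s\<^sup>2) * qint s (b - m))
   = L_diag1 s (Suc b) u 1 * L_diag0 s (Suc b) u (Suc m)"
proof -
  have e: "s ^ (b - m) = s ^ b / s ^ m"
    using s0 assms(2) by (simp add: power_diff)
  have nz: "s ^ b \<noteq> 0" "s ^ m \<noteq> 0" using s0 by auto
  show ?thesis
    unfolding cfun_qint e L_diag0_def L_diag1_def using assms nz s0
    by (simp add: cfun_def powi_split) (simp add: field_simps power2_eq_square)
qed

lemma L_fusion_coef2:
  assumes "u \<noteq> 0"
  shows "L_diag1 s (Suc b) u 0 * (cfun (s\<^sup>2) * qint s m) + cfun (s\<^sup>2) * L_diag1 s (Suc b) u (Suc m)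
   = L_diag1 s (Suc b) u 1 * (cfun (s\<^sup>2) * qint s (Suc m))"
proof -
  have nz: "s ^ b \<noteq> 0" "s ^ m \<noteq> 0" using s0 by auto
  show ?thesis
    unfolding cfun_qint L_diag0_def L_diag1_def using assms nz s0
    by (simp add: cfun_def powi_split) (simp add: field_simps power2_eq_square)
qed

lemma L_fusion_coef3:
  assumes "u \<noteq> 0" "m \<le> b"
  shows "L_diag1 s (Suc b) u 0 * (cfun (s\<^sup>2) * qint s (b - m)) + cfun (s\<^sup>2) * L_diag0 s (Suc b) u m
   = L_diag1 s (Suc b) u 1 * (cfun (s\<^sup>2) * qint s (Suc b - m))"
proof -
  have e: "s ^ (b - m) = s ^ b / s ^ m" "s ^ (Suc b - m) = s * s ^ b / s ^ m"
    using s0 assms(2) by (simp_all add: power_diff)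
  have nz: "s ^ b \<noteq> 0" "s ^ m \<noteq> 0" using s0 by auto
  show ?thesis
    unfolding cfun_qint e L_diag0_def L_diag1_def using assms nz s0
    by (simp add: cfun_def powi_split) (simp add: field_simps power2_eq_square)
qed

lemma L_fusion_coef4:
  assumes "u \<noteq> 0"
  shows "L_diag1 s (Suc b) u 0 * L_diag1 s (Suc b) u (Suc m) + cfun (s\<^sup>2) * (cfun (s\<^sup>2) * qint s m)
   = L_diag1 s (Suc b) u 1 * L_diag1 s (Suc b) u m"
proof -
  have nz: "s ^ b \<noteq> 0" "s ^ m \<noteq> 0" using s0 by auto
  show ?thesis
    unfolding cfun_qint L_diag0_def L_diag1_def using assms nz s0
    by (simp add: cfun_def powi_split) (simp add: field_simps power2_eq_square)
qed

text \<open>The shifts of the spectral parameter in the fusion recursion are exactly those that turn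
  all diagonal entries into entries of the spin (b+1)/2 operator at u.\<close>

lemma L_diag0_shift: "L_diag0 s b (u * s) m = L_diag0 s (Suc b) u m"
  using s0 power_int_add[of s 1 "1 + int b - 2 * int m"] by (simp add: L_diag0_def algebra_simps)

lemma L_diag1_shift: "L_diag1 s b (u * s) m = L_diag1 s (Suc b) u (Suc m)"
  using s0 power_int_add[of s 1 "1 - int b + 2 * int m"] by (simp add: L_diag1_def algebra_simps)

lemma L_diag_half_shift:
  "L_diag0 s 1 (u * s powi (- int b)) 0 = L_diag1 s (Suc b) u 1" "L_diag0 s 1 (u * s powi (- int b)) 1 = L_diag1 s (Suc b) u 0"
  "L_diag1 s 1 (u * s powi (- int b)) 0 = L_diag1 s (Suc b) u 0" "L_diag1 s 1 (u * s powi (- int b)) 1 = L_diag1 s (Suc b) u 1"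
  using s0 power_int_add[of s "- int b" 2] by (simp_all add: L_diag1_def L_diag0_def mult.assoc)

end

text \<open>A normal form for three coordinates of a configuration: nested updates of these legs
  collapse by \<open>cfg3_simps\<close>.\<close>

definition cfg3 :: "(nat \<Rightarrow> nat) \<Rightarrow> nat \<Rightarrow> nat \<Rightarrow> nat \<Rightarrow> nat \<Rightarrow> nat \<Rightarrow> nat \<Rightarrow> nat \<Rightarrow> nat" where
  "cfg3 c i j k x y z = c(i := x, j := y, k := z)"

lemma cfg3_simps:
  assumes "i \<noteq> j" "i \<noteq> k" "j \<noteq> k"
  shows "cfg3 c i j k x y z i = x" "cfg3 c i j k x y z j = y" "cfg3 c i j k x y z k = z"
    "(cfg3 c i j k x y z)(i := x') = cfg3 c i j k x' y z"
    "(cfg3 c i j k x y z)(j := x') = cfg3 c i j k x x' z"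
    "(cfg3 c i j k x y z)(k := x') = cfg3 c i j k x y x'"
  using assms by (auto simp: cfg3_def fun_eq_iff)

lemma cfg3_eqI:
  assumes "i \<noteq> j" "i \<noteq> k" "j \<noteq> k"
    and "\<And>c x y z. X (cfg3 c i j k x y z) = Y (cfg3 c i j k x y z)"
  shows "X = (Y :: state)"
proof
  fix c
  show "X c = Y c" using assms(4)[of c "c i" "c j" "c k"] by (simp add: cfg3_def)
qed

context generic_root begin

text \<open>The right-hand side shows that the unfused product preserves the range of E. The scalar
  is \<open>cfun\<close> of u s^(2-b), which is the last factor of the prefactor at spin (b+1)/2;
  see \<open>R_pref_Suc\<close>.\<close>

lemma L_fusion:
  assumes "i \<noteq> j" "i \<noteq> k" "j \<noteq> k" "u \<noteq> 0"
  shows "Lop s 1 (u * s powi (- int b)) k i (Lop s b (u * s) k j (Eop s (Suc b) i j f))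
    = (\<lambda>c. L_diag1 s (Suc b) u 1 * Eop s (Suc b) i j (Lop s (Suc b) u k j f) c)"
proof (rule cfg3_eqI[OF assms(1-3)])
  fix c and x y z :: nat
  note Lki = Lop_ev[OF assms(2)[symmetric], where b = 1] and Lkj = Lop_ev[OF assms(3)[symmetric]]
    and cs = cfg3_simps[OF assms(1-3)]
  note ev = Lkj Eop_eval cs L_diag0_shift L_diag1_shift
  let ?f = "\<lambda>y z. f (cfg3 c i j k 0 y z)"
  let ?d = "L_diag0 s (Suc b) u" and ?e = "L_diag1 s (Suc b) u" and ?P = "E_diag s (Suc b)" and ?Q = "E_low s (Suc b)"
  let ?cs = "cfun (s\<^sup>2)"
  let ?g = "Lop s b (u * s) k j (Eop s (Suc b) i j f)"
  have A: "?g (cfg3 c i j k 0 y 0) = ?d y * ?P y * ?f y 0 + ?cs * ladder s b y * ?P (y - 1) * ?f (y - 1) 1" if "y \<le> b"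
    using that by (simp add: ev)
  have B: "?g (cfg3 c i j k 1 y 0) = ?d y * ?Q (Suc y) * ?f (Suc y) 0 + ?cs * ladder s b y * ?Q y * ?f y 1" if "y \<le> b"
    using that by (cases y) (simp_all add: ev)
  have C: "?g (cfg3 c i j k 0 y 1) = ?e (Suc y) * ?P y * ?f y 1 + ?cs * (if y < b then ladder s b (Suc y) * ?P (Suc y) else 0) * ?f (Suc y) 0"
     if "y \<le> b"
    using that by (simp add: ev)
  have D: "?g (cfg3 c i j k 1 y 1) = ?e (Suc y) * ?Q (Suc y) * ?f (Suc y) 1
     + ?cs * (if y < b then ladder s b (Suc y) * ?Q (Suc (Suc y)) else 0) * ?f (Suc (Suc y)) 0" if "y \<le> b"
    using that by (simp add: ev)
  \<comment> \<open>For y = b the right-hand side vanishes through the q-integer of 0, so it absorbs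
    the boundary case.\<close>
  have bP: "(if y < b then ladder s b (Suc y) * ?P (Suc y) else 0) = qint s (b - y) * ?Q (Suc y)" if "y \<le> b"
    using that E_diag_ladder[of "Suc y" b] by (auto simp: qint_def mult_ac)
  have bQ: "ladder s b y * ?Q y = qint s y * ?P y" if "y \<le> b"
    using that E_low_ladder[of y b] by (cases y) (auto simp: mult_ac qint_def)
  have sub: "?cs * ladder s b y * ?Q y = ?cs * (ladder s b y * ?Q y)" by simp
  \<comment> \<open>The spin-1/2 operator on k and i acts diagonally when x = z, so those cases
    follow from the entries of E alone. For x \<noteq> z it mixes two configurations, and the
    coefficient identities are needed.\<close>
  consider "\<not> y \<le> b \<or> x \<ge> 2 \<or> z \<ge> 2" | "y \<le> b" "z = 0" "x = 0" | "y \<le> b" "z = 0" "x = 1"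
     | "y \<le> b" "z = 1" "x = 0" | "y \<le> b" "z = 1" "x = 1" by linarith
  then show "Lop s 1 (u * s powi (- int b)) k i ?g (cfg3 c i j k x y z)
    = ?e 1 * Eop s (Suc b) i j (Lop s (Suc b) u k j f) (cfg3 c i j k x y z)"
  proof cases
    case 1
    then show ?thesis by (subst Lki) (auto simp: ev)
  next
    case 2
    have "Lop s 1 (u * s powi (- int b)) k i ?g (cfg3 c i j k 0 y 0) = ?e 1 * ?g (cfg3 c i j k 0 y 0)"
      by (subst Lki) (simp only: cs L_diag_half_shift, simp)
    moreover have "ladder s b y * ?P (y - 1) = ?P y * ladder s (Suc b) y"
      using 2 E_diag_ladder_Suc[of "y - 1" b] by (cases y) auto
    ultimately show ?thesis using 2 by (simp add: A) (simp add: ev algebra_simps)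
  next
    case 3
    have "Lop s 1 (u * s powi (- int b)) k i ?g (cfg3 c i j k 1 y 0)
      = ?e 0 * ?g (cfg3 c i j k 1 y 0) + ?cs * ?g (cfg3 c i j k 0 y 1)"
      by (subst Lki) (simp only: cs L_diag_half_shift, simp)
    also have "\<dots> = (?e 0 * ?d y + ?cs * (?cs * qint s (b - y))) * ?Q (Suc y) * ?f (Suc y) 0
       + (?e 0 * (?cs * qint s y) + ?cs * ?e (Suc y)) * ?P y * ?f y 1"
      using 3 by (simp only: B C bP sub bQ) (simp only: algebra_simps)
    also have "\<dots> = (?e 1 * ?d (Suc y)) * ?Q (Suc y) * ?f (Suc y) 0 + ?e 1 * ?cs * (?Q (Suc y) * ladder s (Suc b) (Suc y)) * ?f y 1"
      using 3 by (simp only: L_fusion_coef1[OF assms(4)] L_fusion_coef2[OF assms(4)] E_low_ladder_Suc) (simp only: mult_ac)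
    finally show ?thesis using 3 by (simp add: ev algebra_simps)
  next
    case 4
    have "Lop s 1 (u * s powi (- int b)) k i ?g (cfg3 c i j k 0 y 1)
      = ?e 0 * ?g (cfg3 c i j k 0 y 1) + ?cs * ?g (cfg3 c i j k 1 y 0)"
      by (subst Lki) (simp only: cs L_diag_half_shift, simp)
    also have "\<dots> = (?e 0 * ?e (Suc y) + ?cs * (?cs * qint s y)) * ?P y * ?f y 1
       + (?e 0 * (?cs * qint s (b - y)) + ?cs * ?d y) * ?Q (Suc y) * ?f (Suc y) 0"
      using 4 by (simp only: B C bP sub bQ) (simp only: algebra_simps)
    also have "\<dots> = (?e 1 * ?e y) * ?P y * ?f y 1 + ?e 1 * ?cs * (?P y * ladder s (Suc b) (Suc y)) * ?f (Suc y) 0"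
      using 4 by (simp only: L_fusion_coef4[OF assms(4)] L_fusion_coef3[OF assms(4)] E_diag_ladder_E_low) (simp only: mult_ac)
    finally show ?thesis using 4 by (simp add: ev algebra_simps)
  next
    case 5
    have 1: "Lop s 1 (u * s powi (- int b)) k i ?g (cfg3 c i j k 1 y 1) = ?e 1 * ?g (cfg3 c i j k 1 y 1)"
      by (subst Lki) (simp only: cs L_diag_half_shift, simp)
    have 2: "(if y < b then ladder s b (Suc y) * ?Q (Suc (Suc y)) else 0) = (if y < b then ?Q (Suc y) * ladder s (Suc b) (Suc (Suc y)) else 0)"
      using ladder_E_low_Suc[of y b] by simp
    show ?thesis using 5 by (simp only: 1 D 2) (simp add: ev algebra_simps)
  qed
qed

lemma L_fusion_opposite_coef1:
  assumes "u \<noteq> 0"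
  shows "L_diag0 s (Suc b) u (Suc m) * L_diag0 s (Suc b) u 0 + cfun (s\<^sup>2) * (cfun (s\<^sup>2) * qint s m)
   = L_diag0 s (Suc b) u 1 * L_diag0 s (Suc b) u m"
proof -
  have nz: "s ^ b \<noteq> 0" "s ^ m \<noteq> 0" using s0 by auto
  show ?thesis
    unfolding cfun_qint L_diag0_def L_diag1_def using assms nz s0
    by (simp add: cfun_def powi_split) (simp add: field_simps power2_eq_square)
qed

lemma L_fusion_opposite_coef2:
  assumes "u \<noteq> 0"
  shows "cfun (s\<^sup>2) * L_diag0 s (Suc b) u (Suc m) + L_diag0 s (Suc b) u 0 * (cfun (s\<^sup>2) * qint s m)
   = L_diag0 s (Suc b) u 1 * (cfun (s\<^sup>2) * qint s (Suc m))"
proof -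
  have nz: "s ^ b \<noteq> 0" "s ^ m \<noteq> 0" using s0 by auto
  show ?thesis
    unfolding cfun_qint L_diag0_def L_diag1_def using assms nz s0
    by (simp add: cfun_def powi_split) (simp add: field_simps power2_eq_square)
qed

lemma L_fusion_opposite_coef3:
  assumes "u \<noteq> 0" "m \<le> b"
  shows "cfun (s\<^sup>2) * L_diag1 s (Suc b) u m + L_diag0 s (Suc b) u 0 * (cfun (s\<^sup>2) * qint s (b - m))
   = L_diag0 s (Suc b) u 1 * (cfun (s\<^sup>2) * qint s (Suc b - m))"
proof -
  have e: "s ^ (b - m) = s ^ b / s ^ m" "s ^ (Suc b - m) = s * s ^ b / s ^ m"
    using s0 assms(2) by (simp_all add: power_diff)
  have nz: "s ^ b \<noteq> 0" "s ^ m \<noteq> 0" using s0 by auto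
  show ?thesis
    unfolding cfun_qint e L_diag0_def L_diag1_def using assms nz s0
    by (simp add: cfun_def powi_split) (simp add: field_simps power2_eq_square)
qed

lemma L_fusion_opposite_coef4:
  assumes "u \<noteq> 0" "m \<le> b"
  shows "L_diag1 s (Suc b) u m * L_diag0 s (Suc b) u 0 + cfun (s\<^sup>2) * (cfun (s\<^sup>2) * qint s (b - m))
   = L_diag0 s (Suc b) u 1 * L_diag1 s (Suc b) u (Suc m)"
proof -
  have e: "s ^ (b - m) = s ^ b / s ^ m"
    using s0 assms(2) by (simp_all add: power_diff)
  have nz: "s ^ b \<noteq> 0" "s ^ m \<noteq> 0" using s0 by auto
  show ?thesis
    unfolding cfun_qint e L_diag0_def L_diag1_def using assms nz s0
    by (simp add: cfun_def powi_split) (simp add: field_simps power2_eq_square)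
qed

lemma L_diag0_shift_down: "L_diag0 s b (u * s powi (- 1)) m = L_diag0 s (Suc b) u (Suc m)"
  using s0 power_int_add[of s "-1" "1 + int b - 2 * int m"] by (simp add: L_diag0_def mult.assoc algebra_simps)

lemma L_diag1_shift_down: "L_diag1 s b (u * s powi (- 1)) m = L_diag1 s (Suc b) u m"
  using s0 power_int_add[of s "-1" "1 - int b + 2 * int m"] by (simp add: L_diag1_def mult.assoc algebra_simps)

lemma L_diag_half_shift_down:
  "L_diag0 s 1 (u * s powi int b) 0 = L_diag0 s (Suc b) u 0" "L_diag0 s 1 (u * s powi int b) 1 = L_diag0 s (Suc b) u 1"
  "L_diag1 s 1 (u * s powi int b) 0 = L_diag0 s (Suc b) u 1" "L_diag1 s 1 (u * s powi int b) 1 = L_diag0 s (Suc b) u 0"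
  using s0 power_int_add[of s "int b" 2] by (simp_all add: L_diag1_def L_diag0_def mult.assoc add.commute)

text \<open>The same fusion with the factors in the opposite order and opposite shifts. It is needed
  because the reflection equation also contains R at x/y, where a shift of y acts inversely. The
  scalar is now the first factor of the prefactor at spin (b+1)/2.\<close>

lemma L_fusion_opposite:
  assumes "i \<noteq> j" "i \<noteq> k" "j \<noteq> k" "u \<noteq> 0"
  shows "Lop s b (u * s powi (- 1)) k j (Lop s 1 (u * s powi int b) k i (Eop s (Suc b) i j f))
    = (\<lambda>c. L_diag0 s (Suc b) u 1 * Eop s (Suc b) i j (Lop s (Suc b) u k j f) c)"
proof (rule cfg3_eqI[OF assms(1-3)])
  fix c and x y z :: nat
  note Lki = Lop_ev[OF assms(2)[symmetric], where b = 1] and Lkj = Lop_ev[OF assms(3)[symmetric]]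
    and cs = cfg3_simps[OF assms(1-3)]
  note ev = Lkj Eop_eval cs
  let ?f = "\<lambda>y z. f (cfg3 c i j k 0 y z)"
  let ?d = "L_diag0 s (Suc b) u" and ?e = "L_diag1 s (Suc b) u" and ?P = "E_diag s (Suc b)" and ?Q = "E_low s (Suc b)"
  let ?cs = "cfun (s\<^sup>2)"
  let ?h = "Lop s 1 (u * s powi int b) k i (Eop s (Suc b) i j f)"
  have A: "?h (cfg3 c i j k 0 y 0) = ?d 0 * ?P y * ?f y 0" if "y \<le> b" for y
    using that by (subst Lki) (simp only: cs L_diag_half_shift_down, simp add: Eop_eval cs)
  have B: "?h (cfg3 c i j k 1 y 0) = ?d 1 * ?Q (Suc y) * ?f (Suc y) 0 + ?cs * ?P y * ?f y 1" if "y \<le> b" for y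
    using that by (subst Lki) (simp only: cs L_diag_half_shift_down, simp add: Eop_eval cs)
  have C: "?h (cfg3 c i j k 0 y 1) = ?d 1 * ?P y * ?f y 1 + ?cs * ?Q (Suc y) * ?f (Suc y) 0" if "y \<le> b" for y
    using that by (subst Lki) (simp only: cs L_diag_half_shift_down, simp add: Eop_eval cs)
  have D: "?h (cfg3 c i j k 1 y 1) = ?d 0 * ?Q (Suc y) * ?f (Suc y) 1" if "y \<le> b" for y
    using that by (subst Lki) (simp only: cs L_diag_half_shift_down, simp add: Eop_eval cs)
  have bP: "(if y < b then ladder s b (Suc y) * ?P (Suc y) else 0) = qint s (b - y) * ?Q (Suc y)" if "y \<le> b"
    using that E_diag_ladder[of "Suc y" b] by (auto simp: qint_def mult_ac)
  have bQ: "ladder s b y * ?Q y = qint s y * ?P y" if "y \<le> b"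
    using that E_low_ladder[of y b] by (cases y) (auto simp: mult_ac qint_def)
  have bQ2: "(if y < b then ladder s b (Suc y) * ?Q (Suc (Suc y)) else 0) = (if y < b then ?Q (Suc y) * ladder s (Suc b) (Suc (Suc y)) else 0)"
    using ladder_E_low_Suc[of y b] by simp
  have bP2: "ladder s b y * ?P (y - 1) = ?P y * ladder s (Suc b) y" if "y \<le> b"
    using that E_diag_ladder_Suc[of "y - 1" b] by (cases y) auto
  have K0: "Lop s b (u * s powi (- 1)) k j ?h (cfg3 c i j k x y 0) =
     ?d (Suc y) * ?h (cfg3 c i j k x y 0) + ?cs * ladder s b y * ?h (cfg3 c i j k x (y - 1) 1)" if "y \<le> b" for x
    using that by (subst Lkj) (simp only: cs L_diag0_shift_down L_diag1_shift_down, simp)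
  have K1: "Lop s b (u * s powi (- 1)) k j ?h (cfg3 c i j k x y 1) =
     ?e y * ?h (cfg3 c i j k x y 1) + ?cs * (if y < b then ladder s b (Suc y) * ?h (cfg3 c i j k x (Suc y) 0) else 0)" if "y \<le> b" for x
    using that by (subst Lkj) (simp only: cs L_diag0_shift_down L_diag1_shift_down, simp)
  consider "\<not> y \<le> b \<or> x \<ge> 2 \<or> z \<ge> 2" | "y \<le> b" "z = 0" "x = 0" | "y \<le> b" "z = 0" "x = 1"
     | "y \<le> b" "z = 1" "x = 0" | "y \<le> b" "z = 1" "x = 1" by linarith
  then show "Lop s b (u * s powi (- 1)) k j ?h (cfg3 c i j k x y z)
    = ?d 1 * Eop s (Suc b) i j (Lop s (Suc b) u k j f) (cfg3 c i j k x y z)"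
  proof cases
    case 1
    have "?h (cfg3 c i j k x y z) = 0" if "x \<ge> 2" for y z
      using that by (subst Lki) (auto simp: Eop_eval cs)
    then show ?thesis using 1 by (subst Lkj) (auto simp: ev)
  next
    case 2
    then have "y - 1 \<le> b" "Suc (y - 1) = y \<or> y = 0" by auto
    then have "Lop s b (u * s powi (- 1)) k j ?h (cfg3 c i j k 0 y 0) =
       (?d (Suc y) * ?d 0) * ?P y * ?f y 0 + ?cs * ?cs * (ladder s b y * ?Q y) * ?f y 0
        + ?cs * ?d 1 * (ladder s b y * ?P (y - 1)) * ?f (y - 1) 1"
      unfolding K0[OF 2(1)] A[OF 2(1)] C[OF \<open>y - 1 \<le> b\<close>] using \<open>Suc (y - 1) = y \<or> y = 0\<close> by (auto simp: algebra_simps)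
    also have "\<dots> = (?d (Suc y) * ?d 0 + ?cs * (?cs * qint s y)) * ?P y * ?f y 0 + ?cs * ?d 1 * (?P y * ladder s (Suc b) y) * ?f (y - 1) 1"
      using 2 by (simp only: bQ bP2) (simp only: algebra_simps)
    also have "\<dots> = ?d 1 * ?P y * (?d y * ?f y 0 + ?cs * ladder s (Suc b) y * ?f (y - 1) 1)"
      by (simp only: L_fusion_opposite_coef1[OF assms(4)]) (simp only: algebra_simps)
    finally show ?thesis using 2 by (simp add: ev algebra_simps)
  next
    case 3
    then have "y - 1 \<le> b" "Suc (y - 1) = y \<or> y = 0" by auto
    then have "Lop s b (u * s powi (- 1)) k j ?h (cfg3 c i j k 1 y 0) =
       ?d (Suc y) * ?d 1 * ?Q (Suc y) * ?f (Suc y) 0 + ?d (Suc y) * ?cs * ?P y * ?f y 1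
        + ?cs * ?d 0 * (ladder s b y * ?Q y) * ?f y 1"
      unfolding K0[OF 3(1)] B[OF 3(1)] D[OF \<open>y - 1 \<le> b\<close>] using \<open>Suc (y - 1) = y \<or> y = 0\<close> by (auto simp: algebra_simps)
    also have "\<dots> = ?d (Suc y) * ?d 1 * ?Q (Suc y) * ?f (Suc y) 0 + (?cs * ?d (Suc y) + ?d 0 * (?cs * qint s y)) * ?P y * ?f y 1"
      using 3 by (simp only: bQ bP2) (simp only: algebra_simps)
    also have "\<dots> = ?d 1 * ?Q (Suc y) * ?d (Suc y) * ?f (Suc y) 0 + ?d 1 * ?cs * (?Q (Suc y) * ladder s (Suc b) (Suc y)) * ?f y 1"
      using 3 by (simp only: L_fusion_opposite_coef2[OF assms(4)] E_low_ladder_Suc) (simp only: algebra_simps)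
    finally show ?thesis using 3 by (simp add: ev algebra_simps)
  next
    case 4
    have "Lop s b (u * s powi (- 1)) k j ?h (cfg3 c i j k 0 y 1) =
       ?e y * ?d 1 * ?P y * ?f y 1 + ?e y * ?cs * ?Q (Suc y) * ?f (Suc y) 0
        + ?cs * ?d 0 * (if y < b then ladder s b (Suc y) * ?P (Suc y) else 0) * ?f (Suc y) 0"
      unfolding K1[OF 4(1)] C[OF 4(1)] using A[of "Suc y"] by (cases "y < b") (simp_all only: Suc_le_eq if_True if_False, simp_all add: algebra_simps)
    also have "\<dots> = ?e y * ?d 1 * ?P y * ?f y 1 + (?cs * ?e y + ?d 0 * (?cs * qint s (b - y))) * ?Q (Suc y) * ?f (Suc y) 0"
      using 4 by (simp only: bP) (simp only: algebra_simps)
    also have "\<dots> = ?d 1 * ?P y * ?e y * ?f y 1 + ?d 1 * ?cs * (?P y * ladder s (Suc b) (Suc y)) * ?f (Suc y) 0"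
      using 4 by (simp only: L_fusion_opposite_coef3[OF assms(4)] E_diag_ladder_E_low) (simp only: algebra_simps)
    finally show ?thesis using 4 by (simp add: ev algebra_simps)
  next
    case 5
    have "Lop s b (u * s powi (- 1)) k j ?h (cfg3 c i j k 1 y 1) =
       ?e y * ?d 0 * ?Q (Suc y) * ?f (Suc y) 1
        + ?cs * ?d 1 * (if y < b then ladder s b (Suc y) * ?Q (Suc (Suc y)) else 0) * ?f (Suc (Suc y)) 0
        + ?cs * ?cs * (if y < b then ladder s b (Suc y) * ?P (Suc y) else 0) * ?f (Suc y) 1"
      unfolding K1[OF 5(1)] D[OF 5(1)] using B[of "Suc y"] by (cases "y < b") (simp_all only: Suc_le_eq if_True if_False, simp_all add: algebra_simps)
    also have "\<dots> = (?e y * ?d 0 + ?cs * (?cs * qint s (b - y))) * ?Q (Suc y) * ?f (Suc y) 1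
        + ?cs * ?d 1 * (if y < b then ?Q (Suc y) * ladder s (Suc b) (Suc (Suc y)) else 0) * ?f (Suc (Suc y)) 0"
      using 5 by (simp only: bP bQ2) (simp only: algebra_simps)
    also have "\<dots> = ?d 1 * ?Q (Suc y) * ?e (Suc y) * ?f (Suc y) 1
       + ?cs * ?d 1 * (if y < b then ?Q (Suc y) * ladder s (Suc b) (Suc (Suc y)) else 0) * ?f (Suc (Suc y)) 0"
      using 5 by (simp only: L_fusion_opposite_coef4[OF assms(4)]) (simp only: algebra_simps)
    finally show ?thesis using 5 by (simp add: ev algebra_simps)
  qed
qed

section \<open>The RLL relation\<close>

lemma rll_coef1:
  assumes "x \<noteq> 0" "y \<noteq> 0"
  shows "L_diag0 s 1 (x * y) 0 * L_diag0 s b x (Suc m) + cfun (s\<^sup>2) * L_diag1 s b y m = L_diag0 s 1 (x * y) 1 * L_diag0 s b x m"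
proof -
  have nz: "s ^ b \<noteq> 0" "s ^ m \<noteq> 0" using s0 by auto
  show ?thesis
    unfolding L_diag0_def L_diag1_def using assms nz s0
    by (simp add: cfun_def powi_split) (simp add: field_simps power2_eq_square)
qed

lemma rll_coef2:
  assumes "x \<noteq> 0" "y \<noteq> 0"
  shows "cfun (s\<^sup>2) * L_diag0 s b x (Suc m) + L_diag0 s 1 (x * y) 0 * L_diag1 s b y m = L_diag0 s 1 (x * y) 1 * L_diag1 s b y (Suc m)"
proof -
  have nz: "s ^ b \<noteq> 0" "s ^ m \<noteq> 0" using s0 by auto
  show ?thesis
    unfolding L_diag0_def L_diag1_def using assms nz s0
    by (simp add: cfun_def powi_split) (simp add: field_simps eval_nat_numeral)
qed

lemma rll_coef3:
  assumes "x \<noteq> 0" "y \<noteq> 0" "m \<le> b"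
  shows "L_diag0 s b x m * L_diag0 s b y m + cfun (s\<^sup>2) * L_diag0 s 1 (x * y) 0 * (ladder s b m * ladder s b m)
     = L_diag1 s b x m * L_diag1 s b y m + cfun (s\<^sup>2) * L_diag0 s 1 (x * y) 0 * (ladder s b (Suc m) * ladder s b (Suc m))"
proof -
  have nz: "s ^ b \<noteq> 0" "s ^ m \<noteq> 0" using s0 by auto
  have e: "s ^ (b - m) = s ^ b / s ^ m" "s ^ (Suc b - m) = s * s ^ b / s ^ m"
    using s0 assms(3) by (simp_all add: power_diff)
  have b: "ladder s b m * ladder s b m = qint s (Suc b - m) * qint s m"
     "ladder s b (Suc m) * ladder s b (Suc m) = qint s (b - m) * qint s (Suc m)"
    using assms ladder_sq[of m b] ladder_sq[of "Suc m" b] by (simp_all add: qint_def)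
  \<comment> \<open>One extra factor is supplied so that each of the two q-integers in a squared
    ladder coefficient has its own factor for \<open>cfun_qint\<close>.\<close>
  have "cfun (s\<^sup>2) * (L_diag0 s b x m * L_diag0 s b y m + cfun (s\<^sup>2) * L_diag0 s 1 (x * y) 0 * (ladder s b m * ladder s b m))
    = cfun (s\<^sup>2) * (L_diag0 s b x m * L_diag0 s b y m) + L_diag0 s 1 (x * y) 0 * ((cfun (s\<^sup>2) * qint s (Suc b - m)) * (cfun (s\<^sup>2) * qint s m))"
    unfolding b by (simp only: algebra_simps)
  also have "\<dots> = cfun (s\<^sup>2) * (L_diag1 s b x m * L_diag1 s b y m) + L_diag0 s 1 (x * y) 0 * ((cfun (s\<^sup>2) * qint s (b - m)) * (cfun (s\<^sup>2) * qint s (Suc m)))"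
    unfolding cfun_qint e L_diag0_def L_diag1_def using assms nz s0
    by (simp add: cfun_def powi_split) (simp add: field_simps power2_eq_square)
  also have "\<dots> = cfun (s\<^sup>2) * (L_diag1 s b x m * L_diag1 s b y m + cfun (s\<^sup>2) * L_diag0 s 1 (x * y) 0 * (ladder s b (Suc m) * ladder s b (Suc m)))"
    unfolding b by (simp only: algebra_simps)
  finally show ?thesis using cfun_sq_nonzero by simp
qed

lemma rll:
  assumes "i \<noteq> j" "i \<noteq> k" "j \<noteq> k" "x \<noteq> 0" "y \<noteq> 0"
  shows "Lop s b x i j (Lop s 1 (x * y) i k (Lop s b y k j f))
    = Lop s b y k j (Lop s 1 (x * y) i k (Lop s b x i j f))"
proof (rule cfg3_eqI[OF assms(1-3)])
  fix c and e m e' :: nat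
  note Lik = Lop_ev[OF assms(2), where b = 1] and Lij = Lop_ev[OF assms(1)] and Lkj = Lop_ev[OF assms(3)[symmetric]]
    and cs = cfg3_simps[OF assms(1-3)]
  have c3: "y * x \<noteq> 0" using assms by simp
  have r1: "L_diag0 s 1 (x * y) 0 = L_diag1 s 1 (x * y) 1" "L_diag0 s 1 (x * y) 1 = L_diag1 s 1 (x * y) 0"
    by (simp_all add: L_diag0_def L_diag1_def)
  let ?p = "L_diag0 s 1 (x * y) 0" and ?r = "L_diag0 s 1 (x * y) 1" and ?cs = "cfun (s\<^sup>2)"
  have ik: "Lop s 1 (x * y) i k g (cfg3 c i j k 0 m 0) = ?p * g (cfg3 c i j k 0 m 0)"
     "Lop s 1 (x * y) i k g (cfg3 c i j k 0 m 1) = ?r * g (cfg3 c i j k 0 m 1) + ?cs * g (cfg3 c i j k 1 m 0)"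
     "Lop s 1 (x * y) i k g (cfg3 c i j k 1 m 0) = ?r * g (cfg3 c i j k 1 m 0) + ?cs * g (cfg3 c i j k 0 m 1)"
     "Lop s 1 (x * y) i k g (cfg3 c i j k 1 m 1) = ?p * g (cfg3 c i j k 1 m 1)" for g m
    by (subst Lik, simp add: cs r1[unfolded One_nat_def])+
  have ikz: "Lop s 1 (x * y) i k g (cfg3 c i j k e m e') = 0" if "e \<ge> 2 \<or> e' \<ge> 2" for g e m e'
    using that by (subst Lik) (auto simp: cs)
  have ij: "Lop s b x i j g (cfg3 c i j k 0 m z) = (if m \<le> b then L_diag0 s b x m * g (cfg3 c i j k 0 m z) + ?cs * ladder s b m * g (cfg3 c i j k 1 (m - 1) z) else 0)"
      "Lop s b x i j g (cfg3 c i j k 1 m z) = (if m \<le> b then L_diag1 s b x m * g (cfg3 c i j k 1 m z) + ?cs * ladder s b (Suc m) * g (cfg3 c i j k 0 (Suc m) z) else 0)"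
     for g m z by (subst Lij, simp add: cs)+
  have kj: "Lop s b y k j g (cfg3 c i j k z m 0) = (if m \<le> b then L_diag0 s b y m * g (cfg3 c i j k z m 0) + ?cs * ladder s b m * g (cfg3 c i j k z (m - 1) 1) else 0)"
      "Lop s b y k j g (cfg3 c i j k z m 1) = (if m \<le> b then L_diag1 s b y m * g (cfg3 c i j k z m 1) + ?cs * ladder s b (Suc m) * g (cfg3 c i j k z (Suc m) 0) else 0)"
     for g m z by (subst Lkj, simp add: cs)+
  note C1 = rll_coef1[OF assms(4,5)] and C2 = rll_coef2[OF assms(4,5)] and C3 = rll_coef3[OF assms(4,5)]
  \<comment> \<open>Exchanging x with y together with i and k interchanges the two sides of the
    relation, so the coefficient identities are also needed with x and y swapped.\<close>
  have D1: "?p * L_diag0 s b y (Suc m) + ?cs * L_diag1 s b x m = ?r * L_diag0 s b y m" for m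
    using rll_coef1[OF assms(5,4)] by (simp only: mult.commute[of y x])
  have D2: "?cs * L_diag0 s b y (Suc m) + ?p * L_diag1 s b x m = ?r * L_diag1 s b x (Suc m)" for m
    using rll_coef2[OF assms(5,4)] by (simp only: mult.commute[of y x])
  let ?F = "\<lambda>x y z. f (cfg3 c i j k x y z)"
  let ?lhs = "Lop s b x i j (Lop s 1 (x * y) i k (Lop s b y k j f))"
  let ?rhs = "Lop s b y k j (Lop s 1 (x * y) i k (Lop s b x i j f))"
  have bz: "ladder s b (Suc m) = 0" if "m \<le> b" "\<not> Suc m \<le> b" for m
    using that by (simp add: le_antisym not_less_eq_eq)
  consider "\<not> m \<le> b \<or> e \<ge> 2 \<or> e' \<ge> 2" | "m \<le> b" "e = 0" "e' = 0" | "m \<le> b" "e = 0" "e' = 1"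
     | "m \<le> b" "e = 1" "e' = 0" | "m \<le> b" "e = 1" "e' = 1" by linarith
  then show "?lhs (cfg3 c i j k e m e') = ?rhs (cfg3 c i j k e m e')"
  proof cases
    case 1
    show ?thesis using 1
      by (subst Lij, subst Lkj) (auto simp: cs ikz[unfolded One_nat_def])
  next
    case 2
    show ?thesis
    proof (cases m)
      case 0
      then show ?thesis using 2 by (simp only: ik ij kj ladder_zero) simp
    next
      case (Suc n)
      have n: "n \<le> b" "m - 1 = n" using Suc 2 by auto
      have "?lhs (cfg3 c i j k 0 m 0) = ?p * L_diag0 s b x m * L_diag0 s b y m * ?F 0 m 0
         + ?cs * ladder s b m * (?p * L_diag0 s b x (Suc n) + ?cs * L_diag1 s b y n) * ?F 0 n 1
         + ?cs * ladder s b m * ?r * L_diag0 s b y n * ?F 1 n 0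
         + ?cs * ladder s b m * ?r * ?cs * ladder s b n * ?F 1 (n - 1) 1
         + ?cs * ?cs * ?cs * ladder s b m * ladder s b m * ?F 0 m 0"
        using 2(1) n unfolding Suc by (simp only: ik ij kj if_True) (simp add: algebra_simps)
      also have "\<dots> = ?p * L_diag0 s b x m * L_diag0 s b y m * ?F 0 m 0
         + ?cs * ladder s b m * ?r * L_diag0 s b x n * ?F 0 n 1
         + ?cs * ladder s b m * (?p * L_diag0 s b y (Suc n) + ?cs * L_diag1 s b x n) * ?F 1 n 0
         + ?cs * ladder s b m * ?r * ?cs * ladder s b n * ?F 1 (n - 1) 1
         + ?cs * ?cs * ?cs * ladder s b m * ladder s b m * ?F 0 m 0"
        by (simp only: C1 D1) (simp only: mult_ac)
      also have "\<dots> = ?rhs (cfg3 c i j k 0 m 0)"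
        using 2(1) n unfolding Suc by (simp only: ik ij kj if_True) (simp add: algebra_simps)
      finally show ?thesis using 2 by simp
    qed
  next
    case 3
    have m1: "m - 1 \<le> b" using 3 by simp
    let ?B = "if Suc m \<le> b then ladder s b (Suc m) * ?p else 0"
    have B2: "ladder s b m * ladder s b m * ?p = 0" if "m = 0" using that by simp
    have "?lhs (cfg3 c i j k 0 m 1) = ?r * L_diag0 s b x m * L_diag1 s b y m * ?F 0 m 1
        + ?cs * ladder s b (Suc m) * (?r * L_diag0 s b x m) * ?F 0 (Suc m) 0
        + ?cs * (L_diag0 s b x m * L_diag0 s b y m + ?cs * ?p * (ladder s b m * ladder s b m)) * ?F 1 m 0
        + ?cs * (if m = 0 then 0 else ladder s b m * (?cs * L_diag0 s b x (Suc (m - 1)) + ?p * L_diag1 s b y (m - 1))) * ?F 1 (m - 1) 1"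
      using 3 m1 by (simp only: ik ij kj if_True) (cases m; simp add: algebra_simps)
    also have "\<dots> = ?r * L_diag0 s b x m * L_diag1 s b y m * ?F 0 m 1
        + ?cs * (if Suc m \<le> b then ladder s b (Suc m) * (?p * L_diag0 s b x (Suc m) + ?cs * L_diag1 s b y m) else 0) * ?F 0 (Suc m) 0
        + ?cs * (L_diag1 s b x m * L_diag1 s b y m + ?cs * ?p * (ladder s b (Suc m) * ladder s b (Suc m))) * ?F 1 m 0
        + ?cs * (ladder s b m * (?r * L_diag1 s b y m)) * ?F 1 (m - 1) 1"
      using 3(1) bz[of m] by (simp only: C1 C2 C3) (cases m; auto simp: algebra_simps)
    also have "\<dots> = ?rhs (cfg3 c i j k 0 m 1)"
      using 3 m1 bz[of m] by (simp only: ik ij kj if_True) (cases "Suc m \<le> b"; simp add: algebra_simps)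
    finally show ?thesis using 3 by simp
  next
    case 4
    have m1: "m - 1 \<le> b" using 4 by simp
    have "?lhs (cfg3 c i j k 1 m 0) = ?r * L_diag1 s b x m * L_diag0 s b y m * ?F 1 m 0
        + ?cs * (if Suc m \<le> b then ladder s b (Suc m) * (?p * L_diag0 s b y (Suc m) + ?cs * L_diag1 s b x m) else 0) * ?F 0 (Suc m) 0
        + ?cs * (L_diag1 s b x m * L_diag1 s b y m + ?cs * ?p * (ladder s b (Suc m) * ladder s b (Suc m))) * ?F 0 m 1
        + ?cs * (ladder s b m * (?r * L_diag1 s b x m)) * ?F 1 (m - 1) 1"
      using 4 m1 bz[of m] by (simp only: ik ij kj if_True) (cases "Suc m \<le> b"; simp add: algebra_simps)
    also have "\<dots> = ?r * L_diag0 s b y m * L_diag1 s b x m * ?F 1 m 0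
        + ?cs * ladder s b (Suc m) * (?r * L_diag0 s b y m) * ?F 0 (Suc m) 0
        + ?cs * (L_diag0 s b x m * L_diag0 s b y m + ?cs * ?p * (ladder s b m * ladder s b m)) * ?F 0 m 1
        + ?cs * (if m = 0 then 0 else ladder s b m * (?cs * L_diag0 s b y (Suc (m - 1)) + ?p * L_diag1 s b x (m - 1))) * ?F 1 (m - 1) 1"
      using 4(1) bz[of m] by (simp only: D1 D2 C3) (cases m; auto simp: algebra_simps)
    also have "\<dots> = ?rhs (cfg3 c i j k 1 m 0)"
      using 4 m1 by (simp only: ik ij kj if_True) (cases m; simp add: algebra_simps)
    finally show ?thesis using 4 by simp
  next
    case 5
    show ?thesis
    proof (cases "Suc m \<le> b")
      case True
      have "?lhs (cfg3 c i j k 1 m 1) = ?p * L_diag1 s b x m * L_diag1 s b y m * ?F 1 m 1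
         + ?cs * ladder s b (Suc m) * (?cs * L_diag0 s b y (Suc m) + ?p * L_diag1 s b x m) * ?F 1 (Suc m) 0
         + ?cs * ladder s b (Suc m) * (?r * L_diag1 s b y (Suc m)) * ?F 0 (Suc m) 1
         + ?cs * ladder s b (Suc m) * ?r * ?cs * ladder s b (Suc (Suc m)) * ?F 0 (Suc (Suc m)) 0
         + ?cs * ?cs * ?cs * ladder s b (Suc m) * ladder s b (Suc m) * ?F 1 m 1"
        using 5(1) True by (simp only: ik ij kj if_True) (simp add: algebra_simps)
      also have "\<dots> = ?p * L_diag1 s b x m * L_diag1 s b y m * ?F 1 m 1
         + ?cs * ladder s b (Suc m) * (?r * L_diag1 s b x (Suc m)) * ?F 1 (Suc m) 0
         + ?cs * ladder s b (Suc m) * (?cs * L_diag0 s b x (Suc m) + ?p * L_diag1 s b y m) * ?F 0 (Suc m) 1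
         + ?cs * ladder s b (Suc m) * ?r * ?cs * ladder s b (Suc (Suc m)) * ?F 0 (Suc (Suc m)) 0
         + ?cs * ?cs * ?cs * ladder s b (Suc m) * ladder s b (Suc m) * ?F 1 m 1"
        by (simp only: C2 D2) 
      also have "\<dots> = ?rhs (cfg3 c i j k 1 m 1)"
        using 5(1) True by (simp only: ik ij kj if_True) (simp add: algebra_simps)
      finally show ?thesis using 5 by simp
    next
      case False
      then show ?thesis using 5 bz[of m] by (simp only: ik ij kj if_True) simp
    qed
  qed
qed

end

section \<open>R-operators\<close>

definition matvec :: "complex mat \<Rightarrow> (nat \<Rightarrow> complex) \<Rightarrow> nat \<Rightarrow> complex" where
  "matvec M v p = (\<Sum>r<dim_col M. M $$ (p, r) * v r)"

lemma matvec_mult: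
  assumes "dim_col A = dim_row B" "p < dim_row A"
  shows "matvec (A * B) v p = matvec A (matvec B v) p"
proof -
  have "matvec (A * B) v p = (\<Sum>r<dim_col B. \<Sum>t<dim_row B. A $$ (p, t) * B $$ (t, r) * v r)"
    using assms by (simp add: matvec_def scalar_prod_def sum_distrib_right atLeast0LessThan)
  also have "\<dots> = (\<Sum>t<dim_row B. \<Sum>r<dim_col B. A $$ (p, t) * B $$ (t, r) * v r)"
    by (rule sum.swap)
  also have "\<dots> = matvec A (matvec B v) p"
    using assms by (simp add: matvec_def sum_distrib_left mult.assoc)
  finally show ?thesis .
qed

lemma matvec_cong: "(\<And>r. r < dim_col M \<Longrightarrow> v r = w r) \<Longrightarrow> matvec M v p = matvec M w p"
  by (simp add: matvec_def)

lemma sum_pair: "(\<Sum>r<A * B. g r) = (\<Sum>x<A. \<Sum>y<B. g (x * B + y :: nat))"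
proof -
  have "(\<Sum>r<A * B. g r) = (\<Sum>x<A. \<Sum>r\<in>{x * B..<x * B + B}. g r)"
    using sum.nat_group[of g B A] by (simp add: atLeast0LessThan)
  also have "\<dots> = (\<Sum>x<A. \<Sum>y<B. g (x * B + y))"
  proof (rule sum.cong[OF refl])
    fix x
    show "(\<Sum>r\<in>{x * B..<x * B + B}. g r) = (\<Sum>y<B. g (x * B + y))"
      using sum.shift_bounds_nat_ivl[of g 0 "x * B" B] by (simp add: atLeast0LessThan add.commute)
  qed
  finally show ?thesis .
qed

lemma sum_triple: "(\<Sum>r<A * B * C. g r) = (\<Sum>x<A. \<Sum>y<B. \<Sum>z<C. g ((x * B + y) * C + z :: nat))"
  by (simp only: sum_pair[of g "A * B" C] sum_pair[of _ A B])

lemma div_mod_pair: "z < C \<Longrightarrow> (x * C + z) div C = x" "z < C \<Longrightarrow> (x * C + z) mod C = (z :: nat)"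
  by auto

lemma div_mod_triple:
  assumes "y < B" "z < (C :: nat)"
  shows "((x * B + y) * C + z) div (B * C) = x" "((x * B + y) * C + z) div C mod B = y" "((x * B + y) * C + z) mod C = z"
  using assms by (auto simp: div_mod_pair div_mult2_eq mult.commute[of B C])

lemma triple_less: "x < A \<Longrightarrow> y < B \<Longrightarrow> z < C \<Longrightarrow> (x * B + y) * C + z < A * B * (C :: nat)"
  by (intro pair_less)

text \<open>The coordinates of a state along the legs i, j, k in Kronecker order, all other legs
  being held at c. This connects matrices acting on vectors with operators on legs.\<close>

definition vec3 :: "nat \<Rightarrow> nat \<Rightarrow> nat \<Rightarrow> nat \<Rightarrow> nat \<Rightarrow> state \<Rightarrow> (nat \<Rightarrow> nat) \<Rightarrow> nat \<Rightarrow> complex" where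
  "vec3 B C i j k f c r = f (c(i := r div (B * C), j := r div C mod B, k := r mod C))"

lemma kron_dims [simp]: "dim_row (kron X Y) = dim_row X * dim_row Y" "dim_col (kron X Y) = dim_col X * dim_col Y"
  for X Y :: "'b::times mat"
  by (simp_all add: kron_by_def)

lemma kron_index:
  fixes X Y :: "'b::times mat"
  assumes "x < dim_row X" "y < dim_row Y" "x' < dim_col X" "y' < dim_col Y"
  shows "kron X Y $$ (x * dim_row Y + y, x' * dim_col Y + y') = X $$ (x, x') * Y $$ (y, y')"
  using assms pair_less[of x "dim_row X" y "dim_row Y"] pair_less[of x' "dim_col X" y' "dim_col Y"]
  by (simp add: kron_by_def)

lemma sum_single: "(\<Sum>z'<(C::nat). (if z = z' then g z' else 0)) = (if z < C then g z else (0 :: 'b::comm_monoid_add))"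
  using sum.delta[of "{..<C}" z g] by (simp add: eq_commute)

lemma matvec_kron_one_right:
  assumes "p < dim_row M" "z < C"
  shows "matvec (kron M (1\<^sub>m C)) v (p * C + z) = (\<Sum>r<dim_col M. M $$ (p, r) * v (r * C + z))"
proof -
  have "matvec (kron M (1\<^sub>m C)) v (p * C + z)
     = (\<Sum>r<dim_col M. \<Sum>z'<C. (if z = z' then M $$ (p, r) * v (r * C + z') else 0))"
    unfolding matvec_def kron_dims index_one_mat sum_pair
    using assms kron_index[of p M z "1\<^sub>m C"] by (intro sum.cong refl) auto
  then show ?thesis using assms by (simp add: sum_single)
qed

lemma matvec_kron_one_left:
  assumes "p < dim_row M" "x < A"
  shows "matvec (kron (1\<^sub>m A) M) v (x * dim_row M + p) = (\<Sum>r<dim_col M. M $$ (p, r) * v (x * dim_col M + r))"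
proof -
  have "matvec (kron (1\<^sub>m A) M) v (x * dim_row M + p)
     = (\<Sum>x'<A. \<Sum>r<dim_col M. (if x = x' then M $$ (p, r) * v (x' * dim_col M + r) else 0))"
    unfolding matvec_def kron_dims index_one_mat sum_pair
    using assms kron_index[of x "1\<^sub>m A" p M] by (intro sum.cong refl) auto
  also have "\<dots> = (\<Sum>x'<A. (if x = x' then \<Sum>r<dim_col M. M $$ (p, r) * v (x' * dim_col M + r) else 0))"
    by (intro sum.cong refl) auto
  finally show ?thesis using assms by (simp add: sum_single)
qed

lemma matvec_leg13:
  assumes "x < A" "y < B" "z < C"
  shows "matvec (leg13 A B C M) v ((x * B + y) * C + z)
     = (\<Sum>x'<A. \<Sum>z'<C. M $$ (x * C + z, x' * C + z') * v ((x' * B + y) * C + z'))"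
proof -
  have "matvec (leg13 A B C M) v ((x * B + y) * C + z)
    = (\<Sum>x'<A. \<Sum>y'<B. \<Sum>z'<C. if y = y' then M $$ (x * C + z, x' * C + z') * v ((x' * B + y') * C + z') else 0)"
    unfolding matvec_def leg13_def dim_col_mat sum_triple
  proof (intro sum.cong refl)
    fix x' y' z' assume "x' \<in> {..<A}" "y' \<in> {..<B}" "z' \<in> {..<C}"
    then show "mat (A * B * C) (A * B * C) (\<lambda>(i, j). if i div C mod B = j div C mod B
         then M $$ (i div (B * C) * C + i mod C, j div (B * C) * C + j mod C) else 0) $$
         ((x * B + y) * C + z, (x' * B + y') * C + z') * v ((x' * B + y') * C + z') =
       (if y = y' then M $$ (x * C + z, x' * C + z') * v ((x' * B + y') * C + z') else 0)"
      using assms triple_less[of x A y B z C] triple_less[of x' A y' B z' C]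
      by (simp add: div_mod_triple)
  qed
  also have "\<dots> = (\<Sum>x'<A. \<Sum>y'<B. (if y = y' then \<Sum>z'<C. M $$ (x * C + z, x' * C + z') * v ((x' * B + y') * C + z') else 0))"
    by (intro sum.cong refl) auto
  finally show ?thesis using assms by (simp add: sum_single)
qed

lemma R_half_dims: "dim_row (R_half s b u) = 2 * Suc b" "dim_col (R_half s b u) = 2 * Suc b"
  by (simp_all add: R_half_def qexp_def spin_minus_def spin_plus_def spin_3_def mat1_def sigma_plus_def sigma_minus_def sigma_z_def mat22_def)

lemma E_mat_dims [simp]: "dim_row (E_mat s a) = 2 * a" "dim_col (E_mat s a) = Suc a"
  by (simp_all add: E_mat_def mat1_def)

lemma F_mat_dims [simp]: "dim_row (F_mat s a) = Suc a" "dim_col (F_mat s a) = 2 * a"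
  by (simp_all add: F_mat_def mat1_def)

lemma R_mat_dims: "dim_row (R_mat s a b u) = Suc a * Suc b" "dim_col (R_mat s a b u) = Suc a * Suc b"
proof -
  show "dim_row (R_mat s a b u) = Suc a * Suc b"
    by (cases "(s, a, b, u)" rule: R_mat.cases) (simp_all add: R_half_dims)
  show "dim_col (R_mat s a b u) = Suc a * Suc b"
    by (cases "(s, a, b, u)" rule: R_mat.cases) (simp_all add: R_half_dims)
qed

section \<open>The R-matrix recursion on legs\<close>

context generic_root begin

lemma matvec_E:
  assumes "i \<noteq> j" "i \<noteq> k" "j \<noteq> k" "r < 2 * a * C"
  shows "matvec (kron (E_mat s a) (1\<^sub>m C)) (\<lambda>r. f (c(i := 0, j := r div C, k := r mod C))) r
    = vec3 a C i j k (Eop s a i j f) c r"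
proof -
  obtain x y z where r: "r = (x * a + y) * C + z" "x < 2" "y < a" "z < C"
  proof
    have "C > 0" "a > 0" using assms(4) by (auto intro: gr0I)
    show "r = (r div C div a * a + r div C mod a) * C + r mod C" by simp
    show "r div C div a < 2" using assms(4) by (simp add: less_mult_imp_div_less mult.commute)
    show "r div C mod a < a" "r mod C < C" using \<open>C > 0\<close> \<open>a > 0\<close> by auto
  qed
  have xy: "x * a + y < 2 * a" using r by (auto intro: pair_less)
  have "matvec (kron (E_mat s a) (1\<^sub>m C)) (\<lambda>r. f (c(i := 0, j := r div C, k := r mod C))) r
     = (\<Sum>m<Suc a. E_mat s a $$ (x * a + y, m) * f (c(i := 0, j := m, k := z)))"
    unfolding r(1) using r xy by (subst matvec_kron_one_right) (simp_all add: div_mod_pair)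
  also have "\<dots> = (\<Sum>m<Suc a. E_ker s a x y 0 m * f (c(i := 0, j := m, k := z)))"
    using r by (intro sum.cong refl) (simp add: E_mat_ker)
  also have "\<dots> = vec3 a C i j k (Eop s a i j f) c r"
  proof -
    have "c(i := x', j := y', k := z, i := 0, j := m) = c(i := 0, j := m, k := z)" for x' y' m
      using assms by (auto simp: fun_eq_iff)
    then show ?thesis unfolding r(1) vec3_def using r assms by (simp add: div_mod_triple leg_op_def)
  qed
  finally show ?thesis .
qed

lemma matvec_F:
  assumes "i \<noteq> j" "i \<noteq> k" "j \<noteq> k" "m \<le> a" "z < C"
  shows "matvec (kron (F_mat s a) (1\<^sub>m C)) (vec3 a C i j k f c) (m * C + z)
    = Fop s a i j f (c(j := m, k := z))"
proof -
  have "matvec (kron (F_mat s a) (1\<^sub>m C)) (vec3 a C i j k f c) (m * C + z)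
     = (\<Sum>x<2. \<Sum>y<a. F_mat s a $$ (m, x * a + y) * f (c(i := x, j := y, k := z)))"
    using assms by (subst matvec_kron_one_right) (simp_all add: sum_pair[of _ 2 a] vec3_def div_mod_triple)
  also have "\<dots> = Fop s a i j f (c(j := m, k := z))"
  proof -
    have "c(j := m, k := z, i := x, j := y) = c(i := x, j := y, k := z)" for x y
      using assms by (auto simp: fun_eq_iff)
    then show ?thesis using assms by (simp add: leg_op_def F_ker_def)
  qed
  finally show ?thesis .
qed

lemma matvec_R13:
  assumes "i \<noteq> j" "i \<noteq> k" "j \<noteq> k" "r < 2 * B * Suc b"
  shows "matvec (leg13 2 B (Suc b) (R_half s b u)) (vec3 B (Suc b) i j k f c) r
    = vec3 B (Suc b) i j k (Rop s (Suc 0) b u i k f) c r"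
proof -
  obtain x y z where r: "r = (x * B + y) * Suc b + z" "x < 2" "y < B" "z < Suc b"
  proof
    have "B > 0" using assms(4) by (auto intro: gr0I)
    show "r = (r div Suc b div B * B + r div Suc b mod B) * Suc b + r mod Suc b" by (simp only: div_mult_mod_eq)
    show "r div Suc b div B < 2" using assms(4) by (simp add: less_mult_imp_div_less mult.commute)
    show "r div Suc b mod B < B" "r mod Suc b < Suc b" using \<open>B > 0\<close> by auto
  qed
  have "c(i := x, j := y, k := z, i := x', k := z') = c(i := x', j := y, k := z')" for x' z'
    using assms by (auto simp: fun_eq_iff)
  then show ?thesis
    unfolding r(1) using r assms
    by (subst matvec_leg13) (simp_all add: vec3_def div_mod_triple leg_op_def R_ker_def numeral_2_eq_2 del: sum.lessThan_Suc mult_Suc_right)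
qed

lemma matvec_R23:
  assumes "i \<noteq> j" "i \<noteq> k" "j \<noteq> k" "r < 2 * Suc a * Suc b"
  shows "matvec (kron (1\<^sub>m 2) (R_mat s a b u)) (vec3 (Suc a) (Suc b) i j k f c) r
    = vec3 (Suc a) (Suc b) i j k (Rop s a b u j k f) c r"
proof -
  obtain x y z where r: "r = (x * Suc a + y) * Suc b + z" "x < 2" "y < Suc a" "z < Suc b"
  proof
    show "r = (r div Suc b div Suc a * Suc a + r div Suc b mod Suc a) * Suc b + r mod Suc b" by (simp only: div_mult_mod_eq)
    show "r div Suc b div Suc a < 2" using assms(4) by (metis less_mult_imp_div_less)
    show "r div Suc b mod Suc a < Suc a" "r mod Suc b < Suc b" by auto
  qed
  have r': "r = x * dim_row (R_mat s a b u) + (y * Suc b + z)"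
    unfolding r(1) R_mat_dims by (simp only: algebra_simps)
  have lt: "y * Suc b + z < Suc a * Suc b" using r by (auto intro!: pair_less simp del: mult_Suc mult_Suc_right)
  have upd: "c(i := x, j := y, k := z, j := y', k := z') = c(i := x, j := y', k := z')" for y' z'
    using assms by (auto simp: fun_eq_iff)
  have "matvec (kron (1\<^sub>m 2) (R_mat s a b u)) (vec3 (Suc a) (Suc b) i j k f c) r
    = (\<Sum>y'<Suc a. \<Sum>z'<Suc b. R_mat s a b u $$ (y * Suc b + z, y' * Suc b + z') *
        vec3 (Suc a) (Suc b) i j k f c ((x * Suc a + y') * Suc b + z'))"
    unfolding r' using r lt
    by (subst matvec_kron_one_left) (simp_all only: R_mat_dims sum_pair[of _ "Suc a" "Suc b"], simp only: algebra_simps)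
  also have "\<dots> = (\<Sum>y'<Suc a. \<Sum>z'<Suc b. R_mat s a b u $$ (y * Suc b + z, y' * Suc b + z') * f (c(i := x, j := y', k := z')))"
    by (intro sum.cong refl) (simp add: vec3_def div_mod_triple del: mult_Suc mult_Suc_right)
  also have "\<dots> = vec3 (Suc a) (Suc b) i j k (Rop s a b u j k f) c r"
    unfolding r(1) vec3_def using r assms
    by (simp add: div_mod_triple leg_op_def R_ker_def upd del: sum.lessThan_Suc mult_Suc mult_Suc_right)
  finally show ?thesis .
qed

text \<open>The Kronecker recursion of \<open>R_mat\<close> translated factor by factor. The fused
  space sits on leg j, so the result is compared with the fused operator at index 0 of leg
  i.\<close>

lemma R_rec:
  assumes "i \<noteq> j" "i \<noteq> k" "j \<noteq> k" "1 \<le> a"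
  shows "Fop s (Suc a) i j (Rop s (Suc 0) b (u * s powi (- int a)) i k (Rop s a b (u * s) j k (Eop s (Suc a) i j f))) c
     = Rop s (Suc a) b u j k f (c(i := 0))"
proof (cases "c j \<le> Suc a \<and> c k \<le> b")
  case False
  then consider "\<not> c j \<le> Suc a" | "\<not> c k \<le> b" by auto
  then show ?thesis
  proof cases
    case 1
    then show ?thesis using assms by (simp add: leg_op_def F_ker_def R_ker_def)
  next
    case 2
    then show ?thesis using assms by (simp add: leg_op_def R_ker_def)
  qed
next
  case True
  obtain n where a: "a = Suc n" using assms by (cases a) auto
  define m z where "m = c j" and "z = c k"
  have mz: "m \<le> Suc a" "z < Suc b" using True by (auto simp: m_def z_def)
  define M where "M = R_half s b (u * s powi (- int a))"
  define R where "R = R_mat s a b (u * s)"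
  have e: "1 - int (n + 2) = - int a" by (simp add: a)
  have R: "R_mat s (Suc a) b u = kron (F_mat s (Suc a)) (1\<^sub>m (Suc b)) * leg13 2 (Suc a) (Suc b) M
     * kron (1\<^sub>m 2) R * kron (E_mat s (Suc a)) (1\<^sub>m (Suc b))"
    unfolding a R_mat.simps e M_def R_def by simp
  have d13: "dim_row (leg13 2 (Suc a) (Suc b) M) = 2 * Suc a * Suc b" "dim_col (leg13 2 (Suc a) (Suc b) M) = 2 * Suc a * Suc b"
    by (simp_all add: leg13_def)
  have dR: "dim_row R = Suc a * Suc b" "dim_col R = Suc a * Suc b" by (simp_all only: R_def R_mat_dims)
  let ?v = "\<lambda>r. f (c(i := 0, j := r div Suc b, k := r mod Suc b))"
  have p: "m * Suc b + z < Suc (Suc a) * Suc b" using mz by (intro pair_less) auto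
  have "Rop s (Suc a) b u j k f (c(i := 0)) = (\<Sum>y<Suc (Suc a). \<Sum>x<Suc b. R_mat s (Suc a) b u $$ (m * Suc b + z, y * Suc b + x) * ?v (y * Suc b + x))"
    using assms True unfolding leg_op_def
    by (intro sum.cong refl) (simp add: R_ker_def m_def z_def div_mod_pair del: R_mat.simps mult_Suc_right)
  also have "\<dots> = matvec (R_mat s (Suc a) b u) ?v (m * Suc b + z)"
    by (simp only: matvec_def R_mat_dims sum_pair)
  also have "\<dots> = matvec (kron (F_mat s (Suc a)) (1\<^sub>m (Suc b))) (matvec (leg13 2 (Suc a) (Suc b) M)
      (matvec (kron (1\<^sub>m 2) R) (matvec (kron (E_mat s (Suc a)) (1\<^sub>m (Suc b))) ?v))) (m * Suc b + z)"
    unfolding R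
    by (subst matvec_mult, simp_all only: dR d13 kron_dims E_mat_dims F_mat_dims index_one_mat index_mult_mat mult.assoc p)+
  also have "\<dots> = matvec (kron (F_mat s (Suc a)) (1\<^sub>m (Suc b))) (vec3 (Suc a) (Suc b) i j k
      (Rop s (Suc 0) b (u * s powi (- int a)) i k (Rop s a b (u * s) j k (Eop s (Suc a) i j f))) c) (m * Suc b + z)"
  proof (rule matvec_cong)
    fix r assume "r < dim_col (kron (F_mat s (Suc a)) (1\<^sub>m (Suc b)))"
    then have r: "r < 2 * Suc a * Suc b" by (simp only: kron_dims F_mat_dims index_one_mat)
    have "matvec (leg13 2 (Suc a) (Suc b) M) (matvec (kron (1\<^sub>m 2) R) (matvec (kron (E_mat s (Suc a)) (1\<^sub>m (Suc b))) ?v)) r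
      = matvec (leg13 2 (Suc a) (Suc b) M) (matvec (kron (1\<^sub>m 2) R) (vec3 (Suc a) (Suc b) i j k (Eop s (Suc a) i j f) c)) r"
      by (intro matvec_cong matvec_E[OF assms(1-3)]) (simp_all only: dR kron_dims index_one_mat mult.assoc)
    also have "\<dots> = matvec (leg13 2 (Suc a) (Suc b) M) (vec3 (Suc a) (Suc b) i j k (Rop s a b (u * s) j k (Eop s (Suc a) i j f)) c) r"
      unfolding R_def by (intro matvec_cong matvec_R23[OF assms(1-3)]) (simp_all only: d13)
    also have "\<dots> = vec3 (Suc a) (Suc b) i j k
      (Rop s (Suc 0) b (u * s powi (- int a)) i k (Rop s a b (u * s) j k (Eop s (Suc a) i j f))) c r"
      unfolding M_def by (rule matvec_R13[OF assms(1-3) r])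
    finally show "matvec (leg13 2 (Suc a) (Suc b) M) (matvec (kron (1\<^sub>m 2) R) (matvec (kron (E_mat s (Suc a)) (1\<^sub>m (Suc b))) ?v)) r = \<dots>" .
  qed
  also have "\<dots> = Fop s (Suc a) i j (Rop s (Suc 0) b (u * s powi (- int a)) i k (Rop s a b (u * s) j k (Eop s (Suc a) i j f))) (c(j := m, k := z))"
    using mz by (intro matvec_F[OF assms(1-3)]) auto
  also have "c(j := m, k := z) = c" by (simp add: m_def z_def)
  finally show ?thesis by (rule sym)
qed

section \<open>Fusion of R-operators\<close>

abbreviation R where "R a b u i j \<equiv> Rop s a b u i j"
abbreviation E where "E a i j \<equiv> Eop s a i j"

lemma R_pref_one [simp]: "R_pref s (Suc 0) u = 1"
  by (simp add: R_pref_def)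

text \<open>After the shift by s the product at b runs over all factors at b + 1 except the last
  one, and that one is the scalar of \<open>L_fusion\<close>.\<close>

lemma R_pref_Suc:
  assumes "1 \<le> b"
  shows "R_pref s b (u * s) * L_diag1 s (Suc b) u 1 = R_pref s (Suc b) u"
proof -
  obtain n where b: "b = Suc n" using assms by (cases b) auto
  have "R_pref s b (u * s) = (\<Prod>k<n. cfun (u * s powi (int b - 2 * int k)))"
    unfolding R_pref_def b
  proof (intro prod.cong)
    fix k
    have "s * s powi (int (Suc n) - 1 - 2 * int k) = s powi (1 + (int (Suc n) - 1 - 2 * int k))"
      by (simp add: power_int_add s0)
    also have "1 + (int (Suc n) - 1 - 2 * int k) = int (Suc n) - 2 * int k" by simp
    finally show "cfun (u * s * s powi (int (Suc n) - 1 - 2 * int k)) = cfun (u * s powi (int (Suc n) - 2 * int k))"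
      by (simp only: mult.assoc)
  qed simp
  moreover have "L_diag1 s (Suc b) u 1 = cfun (u * s powi (int b - 2 * int n))"
    by (simp add: L_diag1_def b)
  ultimately show ?thesis by (simp add: R_pref_def b)
qed

text \<open>Here the shift by the inverse of s leaves out the first factor, the scalar of
  \<open>L_fusion_opposite\<close>.\<close>

lemma R_pref_Suc_opposite:
  assumes "1 \<le> b"
  shows "R_pref s b (u * s powi (- 1)) * L_diag0 s (Suc b) u 1 = R_pref s (Suc b) u"
proof -
  obtain n where b: "b = Suc n" using assms by (cases b) auto
  have "R_pref s b (u * s powi (- 1)) = (\<Prod>k<n. cfun (u * s powi (int b - 2 * int (Suc k))))"
    unfolding R_pref_def b
  proof (intro prod.cong)
    fix k
    have "s powi (- 1) * s powi (int (Suc n) - 1 - 2 * int k) = s powi ((- 1) + (int (Suc n) - 1 - 2 * int k))"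
      by (simp only: power_int_add s0 not_False_eq_True simp_thms)
    also have "(- 1) + (int (Suc n) - 1 - 2 * int k) = int (Suc n) - 2 * int (Suc k)" by simp
    finally show "cfun (u * s powi (- 1) * s powi (int (Suc n) - 1 - 2 * int k)) = cfun (u * s powi (int (Suc n) - 2 * int (Suc k)))"
      by (simp only: mult.assoc)
  qed simp
  moreover have "L_diag0 s (Suc b) u 1 = cfun (u * s powi (int b - 2 * int 0))"
    by (simp add: L_diag0_def b)
  moreover have "R_pref s (Suc b) u = (\<Prod>k<Suc n. cfun (u * s powi (int b - 2 * int k)))"
    by (simp only: R_pref_def b diff_Suc_1 of_nat_Suc) simp
  ultimately show ?thesis by (simp only: prod.lessThan_Suc_shift) (simp only: mult_ac)
qed

lemma Rop_half_half: "R (Suc 0) (Suc 0) u i j f = Lop s 1 u i j f"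
  by (simp add: Rop_half)

lemma R_half_fusion:
  assumes "i \<noteq> j" "i \<noteq> k" "j \<noteq> k" "u \<noteq> 0" "1 \<le> b"
  shows "R (Suc 0) (Suc 0) (u * s powi (- int b)) k i (R (Suc 0) b (u * s) k j (E (Suc b) i j f))
    = E (Suc b) i j (R (Suc 0) (Suc b) u k j f)"
proof -
  have b: "1 \<le> Suc b" by simp
  show ?thesis
    unfolding Rop_half_half Rop_half[OF assms(5)] Rop_half[OF b] leg_op_scale L_fusion[OF assms(1-4)]
      R_pref_Suc[OF assms(5), symmetric] mult.assoc ..
qed

lemma R_half_fusion_opposite:
  assumes "i \<noteq> j" "i \<noteq> k" "j \<noteq> k" "u \<noteq> 0" "1 \<le> b"
  shows "R (Suc 0) b (u * s powi (- 1)) k j (R (Suc 0) (Suc 0) (u * s powi int b) k i (E (Suc b) i j f))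
    = E (Suc b) i j (R (Suc 0) (Suc b) u k j f)"
proof -
  have b: "1 \<le> Suc b" by simp
  show ?thesis
    unfolding Rop_half_half Rop_half[OF assms(5)] Rop_half[OF b] leg_op_scale L_fusion_opposite[OF assms(1-4)]
      R_pref_Suc_opposite[OF assms(5), symmetric] mult.assoc ..
qed

lemma R_range1: "i \<noteq> j \<Longrightarrow> c i > a \<Longrightarrow> R a b u i j f c = 0"
  by (simp add: leg_op_def R_ker_def)

lemma R_range2: "i \<noteq> j \<Longrightarrow> c j > b \<Longrightarrow> R a b u i j f c = 0"
  by (simp add: leg_op_def R_ker_def)

text \<open>The six-vertex matrix of two spins 1/2 is symmetric under exchange of its two
  spaces.\<close>

lemma R_half_half_swap:
  assumes "i \<noteq> j"
  shows "R (Suc 0) (Suc 0) u i j = R (Suc 0) (Suc 0) u j i"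
proof -
  have "Lop s (Suc 0) u i j = Lop s (Suc 0) u j i"
  proof -
    have "leg_op 2 2 i j (L_ker s 1 u) = leg_op 2 2 j i (\<lambda>p q k l. L_ker s 1 u q p l k)"
      by (rule leg_op_swap[OF assms])
    also have "\<dots> = leg_op 2 2 j i (L_ker s 1 u)"
    proof (rule leg_op_cong)
      fix p q k l :: nat assume kl: "k < 2" "l < 2"
      have "\<And>x y :: nat. x < 2 \<Longrightarrow> (x = y) = (y = x)" by auto
      show "L_ker s 1 u q p l k = L_ker s 1 u p q k l"
        using less_2_cases[OF kl(1)] less_2_cases[OF kl(2)]
        by (cases "p = 0"; cases "q = 0"; cases "p = 1"; cases "q = 1") (auto simp: L_ker_def)
    qed
    finally show ?thesis by (simp add: numeral_2_eq_2)
  qed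
  then show ?thesis by (intro ext) (simp add: Rop_half)
qed

text \<open>By \<open>R_rec\<close> the fused operator is F X E with X the unfused product. Fusion
  in the first space thus amounts to E F acting as the identity on X E f.\<close>

lemma R_fusion_leftI:
  assumes "i \<noteq> j" "i \<noteq> k" "j \<noteq> k" "1 \<le> a"
    and "E (Suc a) i j (Fop s (Suc a) i j (R (Suc 0) b (u * s powi (- int a)) i k (R a b (u * s) j k (E (Suc a) i j f))))
      = R (Suc 0) b (u * s powi (- int a)) i k (R a b (u * s) j k (E (Suc a) i j f))"
  shows "E (Suc a) i j (R (Suc a) b u j k f)
      = R (Suc 0) b (u * s powi (- int a)) i k (R a b (u * s) j k (E (Suc a) i j f))"
proof -
  have "E (Suc a) i j (R (Suc a) b u j k f) = E (Suc a) i j (\<lambda>c. R (Suc a) b u j k f (c(i := 0)))"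
    using Eop_reset[OF assms(1), where f = "R (Suc a) b u j k f"] by simp
  also have "(\<lambda>c. R (Suc a) b u j k f (c(i := 0))) =
     Fop s (Suc a) i j (R (Suc 0) b (u * s powi (- int a)) i k (R a b (u * s) j k (E (Suc a) i j f)))"
    by (rule ext) (rule R_rec[OF assms(1-4), symmetric])
  finally show ?thesis by (simp only: assms(5))
qed

text \<open>The recursion builds R with large first spin, whereas L has its spin-1/2 space first;
  the swap identifies the two. It must be proved together with fusion: the swap at a rewrites the
  unfused product so that \<open>R_half_fusion\<close> puts it into the range of E, and cancelling E
  then yields the swap at a + 1.\<close>

lemma R_fusion_left_half_and_swap:
  assumes "1 \<le> a"
  shows "(\<forall>i j k u f. i \<noteq> j \<longrightarrow> i \<noteq> k \<longrightarrow> j \<noteq> k \<longrightarrow> u \<noteq> 0 \<longrightarrow>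
      E (Suc a) i j (R (Suc a) (Suc 0) u j k f)
      = R (Suc 0) (Suc 0) (u * s powi (- int a)) i k (R a (Suc 0) (u * s) j k (E (Suc a) i j f)))
    \<and> (\<forall>j k u. j \<noteq> k \<longrightarrow> u \<noteq> 0 \<longrightarrow> R a (Suc 0) u j k = R (Suc 0) a u k j)"
proof -
  have step: "E (Suc a) i j (R (Suc a) (Suc 0) u j k f)
      = R (Suc 0) (Suc 0) (u * s powi (- int a)) i k (R a (Suc 0) (u * s) j k (E (Suc a) i j f))
      \<and> R (Suc 0) (Suc 0) (u * s powi (- int a)) i k (R a (Suc 0) (u * s) j k (E (Suc a) i j f))
       = E (Suc a) i j (R (Suc 0) (Suc a) u k j f)"
    if "\<And>j k u. j \<noteq> k \<Longrightarrow> u \<noteq> 0 \<Longrightarrow> R a (Suc 0) u j k = R (Suc 0) a u k j" "1 \<le> a"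
      "i \<noteq> j" "i \<noteq> k" "j \<noteq> k" "u \<noteq> 0" for a i j k u f
  proof -
    have us: "u * s \<noteq> 0" using that s0 by simp
    have X: "R (Suc 0) (Suc 0) (u * s powi (- int a)) i k (R a (Suc 0) (u * s) j k (E (Suc a) i j f))
        = E (Suc a) i j (R (Suc 0) (Suc a) u k j f)"
      using R_half_fusion[OF that(3-6,2), of f]
      by (simp only: that(1)[OF that(5) us] R_half_half_swap[OF that(4)])
    show ?thesis
    proof
      show "E (Suc a) i j (R (Suc a) (Suc 0) u j k f)
        = R (Suc 0) (Suc 0) (u * s powi (- int a)) i k (R a (Suc 0) (u * s) j k (E (Suc a) i j f))"
        \<comment> \<open>By X the unfused product is E applied to a state, so E F fixes it.\<close>
        by (rule R_fusion_leftI[OF that(3-5,2)]) (unfold X, rule EFE[OF that(3)], simp)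
    qed (rule X)
  qed
  have sw: "R (Suc a) (Suc 0) u j k = R (Suc 0) (Suc a) u k j"
    if "\<And>j k u. j \<noteq> k \<Longrightarrow> u \<noteq> 0 \<Longrightarrow> R a (Suc 0) u j k = R (Suc 0) a u k j" "1 \<le> a"
      "j \<noteq> k" "u \<noteq> 0" for a j k u
  proof
    fix f
    \<comment> \<open>A fresh leg that receives the spin-1/2 constituent of the spin on leg
      j.\<close>
    define i where "i = Suc (j + k)"
    have i: "i \<noteq> j" "i \<noteq> k" by (auto simp: i_def)
    show "R (Suc a) (Suc 0) u j k f = R (Suc 0) (Suc a) u k j f"
    proof (rule Eop_cancel[OF i(1), where a = "Suc a" and X = "R (Suc a) (Suc 0) u j k" and Y = "R (Suc 0) (Suc a) u k j"])
      show "indep i (R (Suc a) (Suc 0) u j k)" "indep i (R (Suc 0) (Suc a) u k j)"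
        using i by (auto intro: indep_leg_op)
      show "E (Suc a) i j (R (Suc a) (Suc 0) u j k f) = E (Suc a) i j (R (Suc 0) (Suc a) u k j f)" for f
        using step[OF that(1,2) i(1,2) that(3,4), of f] by simp
    next
      show "R (Suc a) (Suc 0) u j k f c = 0" if "Suc a < c j" for f c
        using \<open>j \<noteq> k\<close> that by (simp add: leg_op_def R_ker_def)
      show "R (Suc 0) (Suc a) u k j f c = 0" if "Suc a < c j" for f c
        using \<open>j \<noteq> k\<close> that by (simp add: leg_op_def R_ker_def)
    qed simp
  qed
  show ?thesis
    using assms
  proof (induction a rule: nat_induct_at_least)
    case base
    show ?case unfolding One_nat_def
    proof (intro conjI allI impI)
      fix i j k :: nat and u :: complex and f assume d: "i \<noteq> j" "i \<noteq> k" "j \<noteq> k" "u \<noteq> 0"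
      show "E (Suc (Suc 0)) i j (R (Suc (Suc 0)) (Suc 0) u j k f)
        = R (Suc 0) (Suc 0) (u * s powi (- int (Suc 0))) i k (R (Suc 0) (Suc 0) (u * s) j k (E (Suc (Suc 0)) i j f))"
        by (rule conjunct1[OF step[OF R_half_half_swap _ d]]) simp_all
    qed (rule R_half_half_swap)
  next
    case (Suc a)
    have sa: "\<And>j k u. j \<noteq> k \<Longrightarrow> u \<noteq> 0 \<Longrightarrow> R (Suc a) (Suc 0) u j k = R (Suc 0) (Suc a) u k j"
      by (rule sw[OF Suc.IH[THEN conjunct2, rule_format] Suc.hyps])
    show ?case
    proof (intro conjI allI impI)
      fix i j k :: nat and u :: complex and f assume d: "i \<noteq> j" "i \<noteq> k" "j \<noteq> k" "u \<noteq> 0"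
      show "E (Suc (Suc a)) i j (R (Suc (Suc a)) (Suc 0) u j k f)
        = R (Suc 0) (Suc 0) (u * s powi (- int (Suc a))) i k (R (Suc a) (Suc 0) (u * s) j k (E (Suc (Suc a)) i j f))"
        by (rule conjunct1[OF step[OF sa _ d]]) simp_all
    qed (rule sa)
  qed
qed

lemmas R_fusion_left_half = conjunct1[OF R_fusion_left_half_and_swap, rule_format]
lemmas R_swap = conjunct2[OF R_fusion_left_half_and_swap, rule_format]

end

lemma leg_op_zero:
  assumes "k \<noteq> i" "k \<noteq> j" "\<And>c. c k > n \<Longrightarrow> g c = 0" "c k > n"
  shows "leg_op a b i j M g c = 0"
  using assms by (simp add: leg_op_def)

lemma indep_id: "indep v (\<lambda>f. f)"
  by (simp add: indep_def)

lemma indep_leg_op_comp: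
  assumes "v \<noteq> i" "v \<noteq> j" "indep v X"
  shows "indep v (\<lambda>f. leg_op a b i j M (X f))"
  using indep_comp[OF indep_leg_op[OF assms(1,2)] assms(3)] .

context generic_root begin

text \<open>Both fusion relations are proved by induction on the spins: an induction step in one of them
  uses the other one for smaller spins.\<close>

definition fuses_first :: "nat \<Rightarrow> nat \<Rightarrow> bool" where
  "fuses_first a b \<longleftrightarrow> (\<forall>i j k u f. i \<noteq> j \<longrightarrow> i \<noteq> k \<longrightarrow> j \<noteq> k \<longrightarrow> u \<noteq> 0 \<longrightarrow>
     E (Suc a) i j (R (Suc a) b u j k f) = R (Suc 0) b (u * s powi (- int a)) i k (R a b (u * s) j k (E (Suc a) i j f)))"

definition fuses_second :: "nat \<Rightarrow> nat \<Rightarrow> bool" where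
  "fuses_second a b \<longleftrightarrow> (\<forall>i j k u f. i \<noteq> j \<longrightarrow> i \<noteq> k \<longrightarrow> j \<noteq> k \<longrightarrow> u \<noteq> 0 \<longrightarrow>
     E (Suc b) i j (R a (Suc b) u k j f) = R a (Suc 0) (u * s powi (- int b)) k i (R a b (u * s) k j (E (Suc b) i j f)))"

lemma fuses_firstD: "fuses_first a b \<Longrightarrow> i \<noteq> j \<Longrightarrow> i \<noteq> k \<Longrightarrow> j \<noteq> k \<Longrightarrow> u \<noteq> 0 \<Longrightarrow>
   E (Suc a) i j (R (Suc a) b u j k f) = R (Suc 0) b (u * s powi (- int a)) i k (R a b (u * s) j k (E (Suc a) i j f))"
  by (simp add: fuses_first_def)

lemma fuses_secondD: "fuses_second a b \<Longrightarrow> i \<noteq> j \<Longrightarrow> i \<noteq> k \<Longrightarrow> j \<noteq> k \<Longrightarrow> u \<noteq> 0 \<Longrightarrow>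
   E (Suc b) i j (R a (Suc b) u k j f) = R a (Suc 0) (u * s powi (- int b)) k i (R a b (u * s) k j (E (Suc b) i j f))"
  by (simp add: fuses_second_def)

lemma shift_nonzero: "u \<noteq> 0 \<Longrightarrow> u * s \<noteq> 0" "u \<noteq> 0 \<Longrightarrow> u * s powi e \<noteq> 0"
  using s0 by auto

text \<open>To see that the unfused product on i, j, k preserves the range of E on i and j, the spin
  on k is split over a fresh leg l. Fusion in the second space rewrites everything with spins 1/2
  and b/2, where fusion in the first space is known; then the splitting is cancelled.\<close>

lemma fuses_first_step:
  assumes "1 \<le> a" "1 \<le> b" "fuses_first a (Suc 0)" "fuses_first a b" "fuses_second (Suc 0) b" "fuses_second a b"
  shows "fuses_first a (Suc b)"
  unfolding fuses_first_def
proof (intro allI impI)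
  fix i j k :: nat and u :: complex and f :: state
  assume d: "i \<noteq> j" "i \<noteq> k" "j \<noteq> k" and u: "u \<noteq> 0"
  define l where "l = Suc (i + j + k)"
  have l: "l \<noteq> i" "l \<noteq> j" "l \<noteq> k" "i \<noteq> l" "j \<noteq> l" "k \<noteq> l" by (auto simp: l_def)
  note d' = d(1)[symmetric] d(2)[symmetric] d(3)[symmetric]
  note u' = shift_nonzero[OF u]
  define X where "X = (\<lambda>f. R (Suc 0) (Suc b) (u * s powi (- int a)) i k (R a (Suc b) (u * s) j k (E (Suc a) i j f)))"
  \<comment> \<open>Y is E F X, so Y = X is the hypothesis of \<open>R_fusion_leftI\<close>.\<close>
  define Y where "Y = (\<lambda>f. E (Suc a) i j (Fop s (Suc a) i j (X f)))"
  have args: "u * s * s powi - int b = u * s powi - int b * s" "u * s powi - int a * s = u * s * s powi - int a"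
     "u * s powi - int a * s powi - int b = u * s powi - int b * s powi - int a"
    by (simp_all only: mult_ac)
  have EX: "E (Suc b) l k (X f) = E (Suc a) i j (R (Suc a) (Suc 0) (u * s powi - int b) j l (R (Suc a) b (u * s) j k (E (Suc b) l k f)))" for f
  proof -
    have "E (Suc b) l k (X f) = R (Suc 0) (Suc 0) (u * s powi - int a * s powi - int b) i l (R (Suc 0) b (u * s powi - int a * s) i k
        (R a (Suc 0) (u * s * s powi - int b) j l (R a b (u * s * s) j k (E (Suc b) l k (E (Suc a) i j f)))))"
      unfolding X_def
      by (simp only: fuses_secondD[OF assms(5) l(3,1) d'(2) u'(2)] fuses_secondD[OF assms(6) l(3,2) d'(3) u'(1)])
    also have "\<dots> = R (Suc 0) (Suc 0) (u * s powi - int b * s powi - int a) i l (R a (Suc 0) (u * s powi - int b * s) j l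
        (R (Suc 0) b (u * s * s powi - int a) i k (R a b (u * s * s) j k (E (Suc a) i j (E (Suc b) l k f)))))"
      by (simp only: args leg_op_commute[OF d(1) l(4) d'(3) l(6), of "Suc (Suc 0)"] leg_op_commute[OF l(1) l(2) d'(2) d'(3), of "Suc 0" _ _ "Suc 0"])
    also have "\<dots> = E (Suc a) i j (R (Suc a) (Suc 0) (u * s powi - int b) j l (R (Suc a) b (u * s) j k (E (Suc b) l k f)))"
      by (simp only: fuses_firstD[OF assms(3) d(1) l(4,5) u'(2)] fuses_firstD[OF assms(4) d u'(1)])
    finally show ?thesis .
  qed
  have "Y f = X f"
  proof (rule Eop_cancel[OF l(3), where a = "Suc b" and X = Y and Y = X])
    show "indep l Y" "indep l X" unfolding X_def Y_def by (intro indep_leg_op_comp indep_id l)+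
    fix g
    \<comment> \<open>E and F on i and j commute with the splitting of k, and after the splitting X
      g is visibly in the range of E by \<open>EX\<close>.\<close>
    have "E (Suc b) l k (Y g) = E (Suc a) i j (Fop s (Suc a) i j (E (Suc b) l k (X g)))"
      unfolding Y_def using leg_op_commute[OF l(1,2) d'(2,3)] by simp
    also have "\<dots> = E (Suc b) l k (X g)"
      unfolding EX by (rule EFE[OF d(1)]) simp
    finally show "E (Suc b) l k (Y g) = E (Suc b) l k (X g)" .
    show X0: "X g c = 0" if "Suc b < c k" for c g
      unfolding X_def by (simp add: R_range2 d that)
    show "Y g c = 0" if "Suc b < c k" for c
      unfolding Y_def by (rule leg_op_zero[OF d'(2,3), where n = "Suc b"], rule leg_op_zero[OF d'(2,3), where n = "Suc b"]) (simp_all add: X0 that)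
  qed simp
  then show "E (Suc a) i j (R (Suc a) (Suc b) u j k f)
     = R (Suc 0) (Suc b) (u * s powi - int a) i k (R a (Suc b) (u * s) j k (E (Suc a) i j f))"
    unfolding X_def Y_def by (intro R_fusion_leftI[OF d assms(1)])
qed

text \<open>Now the first space, on leg k, is split. Both sides agree after the splitting, but
  reassembling the left one requires fusion in the first space already at second spin b + 1.\<close>

lemma fuses_second_step:
  assumes "fuses_first a (Suc 0)" "fuses_first a b" "fuses_first a (Suc b)" "fuses_second (Suc 0) b" "fuses_second a b"
  shows "fuses_second (Suc a) b"
  unfolding fuses_second_def
proof (intro allI impI)
  fix i j k :: nat and u :: complex and f :: state
  assume d: "i \<noteq> j" "i \<noteq> k" "j \<noteq> k" and u: "u \<noteq> 0"
  define l where "l = Suc (i + j + k)"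
  have l: "l \<noteq> i" "l \<noteq> j" "l \<noteq> k" "i \<noteq> l" "j \<noteq> l" "k \<noteq> l" by (auto simp: l_def)
  note d' = d(1)[symmetric] d(2)[symmetric] d(3)[symmetric]
  note u' = shift_nonzero[OF u]
  define X where "X = (\<lambda>f. E (Suc b) i j (R (Suc a) (Suc b) u k j f))"
  define Y where "Y = (\<lambda>f. R (Suc a) (Suc 0) (u * s powi (- int b)) k i (R (Suc a) b (u * s) k j (E (Suc b) i j f)))"
  have args: "u * s powi - int b * s = u * s * s powi - int b" "u * s * s powi - int a = u * s powi - int a * s"
     "u * s powi - int b * s powi - int a = u * s powi - int a * s powi - int b"
    by (simp_all only: mult_ac)
  have "X f = Y f"
  proof (rule Eop_cancel[OF l(3), where a = "Suc a" and X = X and Y = Y])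
    show "indep l X" "indep l Y" unfolding X_def Y_def by (intro indep_leg_op_comp indep_id l)+
    fix g
    have "E (Suc a) l k (Y g) = R (Suc 0) (Suc 0) (u * s powi - int b * s powi - int a) l i (R a (Suc 0) (u * s powi - int b * s) k i
       (R (Suc 0) b (u * s * s powi - int a) l j (R a b (u * s * s) k j (E (Suc a) l k (E (Suc b) i j g)))))"
      unfolding Y_def
      by (simp only: fuses_firstD[OF assms(1) l(3,1) d'(2) u'(2)] fuses_firstD[OF assms(2) l(3,2) d'(3) u'(1)])
    also have "\<dots> = R (Suc 0) (Suc 0) (u * s powi - int a * s powi - int b) l i (R (Suc 0) b (u * s powi - int a * s) l j
       (R a (Suc 0) (u * s * s powi - int b) k i (R a b (u * s * s) k j (E (Suc b) i j (E (Suc a) l k g)))))"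
      by (simp only: args leg_op_commute[OF l(6) d'(3) l(4) d(1), of "Suc a" _ _ "Suc (Suc 0)"] leg_op_commute[OF l(1) l(2) d'(2) d'(3), of "Suc 0" _ _ "Suc 0"])
    also have "\<dots> = E (Suc b) i j (R (Suc 0) (Suc b) (u * s powi - int a) l j (R a (Suc b) (u * s) k j (E (Suc a) l k g)))"
      by (simp only: fuses_secondD[OF assms(4) d(1) l(4,5) u'(2)] fuses_secondD[OF assms(5) d u'(1)])
    also have "\<dots> = E (Suc b) i j (E (Suc a) l k (R (Suc a) (Suc b) u k j g))"
      by (simp only: fuses_firstD[OF assms(3) l(3,2) d'(3) u])
    also have "\<dots> = E (Suc a) l k (X g)"
      unfolding X_def by (rule leg_op_commute[OF l(4) d(2) l(5) d(3)])
    finally show "E (Suc a) l k (X g) = E (Suc a) l k (Y g)" by simp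
    show "Y g c = 0" if "Suc a < c k" for c
      unfolding Y_def by (simp add: R_range1 d' that)
    show "X g c = 0" if "Suc a < c k" for c
      unfolding X_def by (rule leg_op_zero[OF d'(2,3), where n = "Suc a"]) (simp_all add: R_range1 d' that)
  qed simp
  then show "E (Suc b) i j (R (Suc a) (Suc b) u k j f)
     = R (Suc a) (Suc 0) (u * s powi - int b) k i (R (Suc a) b (u * s) k j (E (Suc b) i j f))"
    unfolding X_def Y_def .
qed

lemma fuses_first_half: "1 \<le> a \<Longrightarrow> fuses_first a (Suc 0)"
  unfolding fuses_first_def by (intro allI impI R_fusion_left_half)

lemma fuses_second_half: "1 \<le> b \<Longrightarrow> fuses_second (Suc 0) b"
  unfolding fuses_second_def by (intro allI impI R_half_fusion[symmetric])

text \<open>This fixes the order of the double induction: for given a, the second fusion for all b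
  yields the first fusion for all b by induction on b, and only then does a increase.\<close>

lemma fuses_first_of_second:
  assumes "1 \<le> a" "\<And>b. 1 \<le> b \<Longrightarrow> fuses_second a b" "1 \<le> b"
  shows "fuses_first a b"
  using assms(3)
proof (induction b rule: nat_induct_at_least)
  case base
  then show ?case using fuses_first_half[OF assms(1)] by simp
next
  case (Suc b)
  then show ?case
    using fuses_first_step[OF assms(1) Suc.hyps fuses_first_half[OF assms(1)] Suc.IH fuses_second_half[OF Suc.hyps] assms(2)[OF Suc.hyps]] by simp
qed

lemma fuses_second_all:
  assumes "1 \<le> a" "1 \<le> b"
  shows "fuses_second a b"
  using assms
proof (induction a arbitrary: b rule: nat_induct_at_least)
  case base
  then show ?case using fuses_second_half by simp
next
  case (Suc a)
  have S1a: "fuses_first a b" if "1 \<le> b" for b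
    by (rule fuses_first_of_second[OF Suc.hyps Suc.IH that])
  show ?case
    by (rule fuses_second_step[OF S1a S1a S1a fuses_second_half Suc.IH]) (use Suc.prems in simp_all)
qed

lemma R_fusion_right: "1 \<le> a \<Longrightarrow> 1 \<le> b \<Longrightarrow> i \<noteq> j \<Longrightarrow> i \<noteq> k \<Longrightarrow> j \<noteq> k \<Longrightarrow> u \<noteq> 0 \<Longrightarrow>
   E (Suc b) i j (R a (Suc b) u k j f) = R a (Suc 0) (u * s powi (- int b)) k i (R a b (u * s) k j (E (Suc b) i j f))"
  by (rule fuses_secondD[OF fuses_second_all])

section \<open>The Yang-Baxter equation with one spin-1/2 space\<close>

lemma yang_baxter_half:
  assumes "1 \<le> a" "i \<noteq> j" "i \<noteq> k" "j \<noteq> k" "x \<noteq> 0" "y \<noteq> 0"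
  shows "R (Suc 0) a x i j (R (Suc 0) (Suc 0) (x * y) i k (R a (Suc 0) y j k f))
    = R a (Suc 0) y j k (R (Suc 0) (Suc 0) (x * y) i k (R (Suc 0) a x i j f))"
  unfolding R_swap[OF assms(1,4,6)] Rop_half[OF assms(1)] Rop_half_half leg_op_scale rll[OF assms(2-6)]
  by (rule ext) (rule mult.left_commute)

text \<open>Splitting leg k over a fresh leg l turns the equation at b + 1 into the spin-1/2
  equation on i, j, l followed by the equation at b on i, j, k. Between the two, only operators on
  disjoint legs are reordered.\<close>

lemma yang_baxter:
  assumes "1 \<le> a" "1 \<le> b"
  shows "i \<noteq> j \<Longrightarrow> i \<noteq> k \<Longrightarrow> j \<noteq> k \<Longrightarrow> x \<noteq> 0 \<Longrightarrow> y \<noteq> 0 \<Longrightarrow>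
    R (Suc 0) a x i j (R (Suc 0) b (x * y) i k (R a b y j k f)) = R a b y j k (R (Suc 0) b (x * y) i k (R (Suc 0) a x i j f))"
  using assms(2)
proof (induction b arbitrary: i j k x y f rule: nat_induct_at_least)
  case base
  then show ?case
    unfolding One_nat_def by (intro yang_baxter_half[OF assms(1)])
next
  case (Suc b)
  note d = Suc.prems(1-3) and xy = Suc.prems(4,5)
  define l where "l = Suc (i + j + k)"
  have l: "l \<noteq> i" "l \<noteq> j" "l \<noteq> k" "i \<noteq> l" "j \<noteq> l" "k \<noteq> l" by (auto simp: l_def)
  note d' = d(1)[symmetric] d(2)[symmetric] d(3)[symmetric]
  have xy0: "x * y \<noteq> 0" using xy by simp
  define X where "X = (\<lambda>f. R (Suc 0) a x i j (R (Suc 0) (Suc b) (x * y) i k (R a (Suc b) y j k f)))"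
  define Y where "Y = (\<lambda>f. R a (Suc b) y j k (R (Suc 0) (Suc b) (x * y) i k (R (Suc 0) a x i j f)))"
  have one: "1 \<le> Suc 0" by simp
  have bse: "R (Suc 0) a x i j (R (Suc 0) (Suc 0) (x * (y * s powi - int b)) i l (R a (Suc 0) (y * s powi - int b) j l g))
     = R a (Suc 0) (y * s powi - int b) j l (R (Suc 0) (Suc 0) (x * (y * s powi - int b)) i l (R (Suc 0) a x i j g))" for g
    by (rule yang_baxter_half[OF assms(1) d(1) l(4,5) xy(1) shift_nonzero(2)[OF xy(2)]])
  have "X f = Y f"
  proof (rule Eop_cancel[OF l(3), where a = "Suc b" and X = X and Y = Y])
    show "indep l X" "indep l Y" unfolding X_def Y_def by (intro indep_leg_op_comp indep_id l)+
    fix g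
    note fus = R_fusion_right[OF one Suc.hyps l(3,1) d'(2) xy0] R_fusion_right[OF assms(1) Suc.hyps l(3,2) d'(3) xy(2)]
    have c1: "E (Suc b) l k (R (Suc 0) a x i j h) = R (Suc 0) a x i j (E (Suc b) l k h)" for h
      by (rule leg_op_commute[OF l(1,2) d'(2,3)])
    have "E (Suc b) l k (X g) = R (Suc 0) a x i j (R (Suc 0) (Suc 0) (x * (y * s powi - int b)) i l (R a (Suc 0) (y * s powi - int b) j l
       (R (Suc 0) b (x * (y * s)) i k (R a b (y * s) j k (E (Suc b) l k g)))))"
      unfolding X_def by (simp only: c1 fus leg_op_commute[OF d(1) l(4) d'(3) l(6), of "Suc (Suc 0)"] mult.assoc)
    also have "\<dots> = R a (Suc 0) (y * s powi - int b) j l (R (Suc 0) (Suc 0) (x * (y * s powi - int b)) i l (R a b (y * s) j k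
       (R (Suc 0) b (x * (y * s)) i k (R (Suc 0) a x i j (E (Suc b) l k g)))))"
      by (simp only: bse Suc.IH[OF d xy(1) shift_nonzero(1)[OF xy(2)]])
    also have "\<dots> = R a (Suc 0) (y * s powi - int b) j l (R a b (y * s) j k (R (Suc 0) (Suc 0) (x * (y * s powi - int b)) i l
       (R (Suc 0) b (x * (y * s)) i k (R (Suc 0) a x i j (E (Suc b) l k g)))))"
      by (simp only: leg_op_commute[OF d(1,2) l(2,3), of "Suc (Suc 0)"])
    also have "\<dots> = E (Suc b) l k (Y g)"
      unfolding Y_def by (simp only: c1 fus mult.assoc)
    finally show "E (Suc b) l k (X g) = E (Suc b) l k (Y g)" .
    show "Y g c = 0" if "Suc b < c k" for c
      unfolding Y_def by (simp add: R_range2 d that)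
    show "X g c = 0" if "Suc b < c k" for c
      unfolding X_def by (rule leg_op_zero[OF d'(2,3), where n = "Suc b"]) (simp_all add: R_range2 d that)
  qed simp
  then show ?case unfolding X_def Y_def .
qed

end

section \<open>Matrices over a represented algebra\<close>

lemma sum4_swap:
  "(\<Sum>j\<in>J. \<Sum>r\<in>R. \<Sum>l\<in>L. \<Sum>t\<in>T. g j r l t) = (\<Sum>l\<in>L. \<Sum>t\<in>T. \<Sum>j\<in>J. \<Sum>r\<in>R. g j r l t :: complex)"
proof -
  have "(\<Sum>j\<in>J. \<Sum>r\<in>R. \<Sum>l\<in>L. \<Sum>t\<in>T. g j r l t) = (\<Sum>j\<in>J. \<Sum>l\<in>L. \<Sum>t\<in>T. \<Sum>r\<in>R. g j r l t)"
    by (intro sum.cong refl, subst sum.swap, intro sum.cong refl, rule sum.swap)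
  also have "\<dots> = (\<Sum>l\<in>L. \<Sum>t\<in>T. \<Sum>j\<in>J. \<Sum>r\<in>R. g j r l t)"
    by (subst sum.swap, intro sum.cong refl, rule sum.swap)
  finally show ?thesis .
qed

lemma sum_single_mult: "(\<Sum>r<(C::nat). (if p = r then a else 0) * g r) = (if p < C then a * g p else (0 :: complex))"
  using sum_single[of p "\<lambda>r. a * g r" C] by (simp add: if_distrib[of "\<lambda>x. x * _"] cong: if_cong)

text \<open>\<open>kap x p r\<close> is the entry \<open>(p, r)\<close> of \<open>x\<close> in a representation of dimension \<open>qd\<close>. The
  operators \<open>Op\<close> below act on the representation space through leg 0.\<close>

locale alg_rep =
  fixes A :: "(complex, 'a) module" (structure) and kap :: "'a \<Rightarrow> nat \<Rightarrow> nat \<Rightarrow> complex" and qd :: nat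
  assumes am: "abelian_monoid A"
    and mult_closed: "x \<in> carrier A \<Longrightarrow> y \<in> carrier A \<Longrightarrow> x \<otimes> y \<in> carrier A"
    and one_closed: "\<one> \<in> carrier A"
    and scalar_closed: "c \<odot> \<one> \<in> carrier A"
    and kap_mult: "x \<in> carrier A \<Longrightarrow> y \<in> carrier A \<Longrightarrow> kap (x \<otimes> y) p r = (\<Sum>t<qd. kap x p t * kap y t r)"
    and kap_add: "x \<in> carrier A \<Longrightarrow> y \<in> carrier A \<Longrightarrow> kap (x \<oplus> y) p r = kap x p r + kap y p r"
    and kap_zero: "kap \<zero> p r = 0"
    and kap_one: "kap \<one> p r = (if p = r \<and> p < qd then 1 else 0)"
    and kap_scalar: "kap (c \<odot> \<one>) p r = (if p = r \<and> p < qd then c else 0)"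
    and kap_out: "qd \<le> p \<Longrightarrow> kap x p r = 0"
begin

definition cmat :: "nat \<Rightarrow> nat \<Rightarrow> 'a mat \<Rightarrow> bool" where
  "cmat m n X \<longleftrightarrow> dim_row X = m \<and> dim_col X = n \<and> (\<forall>i<m. \<forall>j<n. X $$ (i, j) \<in> carrier A)"

text \<open>The action of an algebra-valued matrix on auxiliary space tensor representation space.
  It turns \<open>mat_mul\<close> into composition, so matrix algebra over a noncommutative ring
  reduces to composing operators.\<close>

definition avec :: "'a mat \<Rightarrow> (nat \<Rightarrow> nat \<Rightarrow> complex) \<Rightarrow> nat \<Rightarrow> nat \<Rightarrow> complex" where
  "avec X v m p = (\<Sum>k<dim_col X. \<Sum>r<qd. kap (X $$ (m, k)) p r * v k r)"

lemma zero_closed: "\<zero> \<in> carrier A"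
  by (rule abelian_monoid.zero_closed[OF am])

lemma finsum_closed: "(\<And>i. i \<in> S \<Longrightarrow> g i \<in> carrier A) \<Longrightarrow> finsum A g S \<in> carrier A"
  by (rule abelian_monoid.finsum_closed[OF am]) auto

lemma kap_finsum:
  assumes "finite S" "\<And>i. i \<in> S \<Longrightarrow> g i \<in> carrier A"
  shows "kap (finsum A g S) p r = (\<Sum>i\<in>S. kap (g i) p r)"
  using assms
proof (induction S rule: finite_induct)
  case empty
  then show ?case by (simp add: abelian_monoid.finsum_empty[OF am] kap_zero)
next
  case (insert x F)
  then show ?case
    by (subst abelian_monoid.finsum_insert[OF am]) (auto simp: kap_add finsum_closed)
qed

lemma cmat_mult:
  assumes "cmat m n X" "cmat n k Y"
  shows "cmat m k (X \<star> Y)"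
  using assms by (auto simp: cmat_def mat_mul_def intro!: finsum_closed mult_closed)

lemma kap_mat_mult:
  assumes "cmat m n X" "cmat n k Y" "i < m" "j < k"
  shows "kap ((X \<star> Y) $$ (i, j)) p r = (\<Sum>l<n. \<Sum>t<qd. kap (X $$ (i, l)) p t * kap (Y $$ (l, j)) t r)"
proof -
  have "kap ((X \<star> Y) $$ (i, j)) p r = (\<Sum>l<n. kap (X $$ (i, l) \<otimes> Y $$ (l, j)) p r)"
  proof -
    have "(X \<star> Y) $$ (i, j) = finsum A (\<lambda>l. X $$ (i, l) \<otimes> Y $$ (l, j)) {..<n}"
      using assms by (simp add: mat_mul_def cmat_def atLeast0LessThan)
    then show ?thesis
      using assms kap_finsum[of "{..<n}" "\<lambda>l. X $$ (i, l) \<otimes> Y $$ (l, j)"] by (simp add: cmat_def mult_closed)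
  qed
  also have "\<dots> = (\<Sum>l<n. \<Sum>t<qd. kap (X $$ (i, l)) p t * kap (Y $$ (l, j)) t r)"
    using assms by (intro sum.cong refl kap_mult) (auto simp: cmat_def)
  finally show ?thesis .
qed

lemma avec_mult:
  assumes "cmat m n X" "cmat n k Y" "i < m"
  shows "avec (X \<star> Y) v i p = avec X (avec Y v) i p"
proof -
  have d: "dim_col (X \<star> Y) = k" "dim_col X = n" "dim_col Y = k" using assms by (auto simp: cmat_def mat_mul_def)
  have "avec (X \<star> Y) v i p = (\<Sum>j<k. \<Sum>r<qd. (\<Sum>l<n. \<Sum>t<qd. kap (X $$ (i, l)) p t * kap (Y $$ (l, j)) t r) * v j r)"
    unfolding avec_def d using assms by (intro sum.cong refl) (subst kap_mat_mult, auto)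
  also have "\<dots> = (\<Sum>j<k. \<Sum>r<qd. \<Sum>l<n. \<Sum>t<qd. kap (X $$ (i, l)) p t * (kap (Y $$ (l, j)) t r * v j r))"
    by (simp add: sum_distrib_right mult.assoc)
  also have "\<dots> = (\<Sum>l<n. \<Sum>t<qd. \<Sum>j<k. \<Sum>r<qd. kap (X $$ (i, l)) p t * (kap (Y $$ (l, j)) t r * v j r))"
    by (rule sum4_swap)
  also have "\<dots> = avec X (avec Y v) i p"
    unfolding avec_def d by (simp add: sum_distrib_left)
  finally show ?thesis .
qed

lemma avec_cong: "(\<And>k r. k < dim_col X \<Longrightarrow> r < qd \<Longrightarrow> v k r = w k r) \<Longrightarrow> avec X v m p = avec X w m p"
  by (simp add: avec_def)

lemma cmat_scal: "cmat (dim_row M) (dim_col M) (scal_mat A M)"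
  by (auto simp: cmat_def scal_mat_def scalar_closed)

lemma avec_scal:
  assumes "m < dim_row M" "p < qd"
  shows "avec (scal_mat A M) v m p = (\<Sum>k<dim_col M. M $$ (m, k) * v k p)"
  using assms by (simp add: avec_def scal_mat_def kap_scalar sum_single_mult)

lemma cmat_one: "cmat n n (mat_one A n)"
  by (auto simp: cmat_def mat_one_def one_closed zero_closed)

lemma cmat_kron:
  assumes "cmat m n X" "cmat k l Y"
  shows "cmat (m * k) (n * l) (kron_by (\<otimes>) X Y)"
proof -
  have "i div k < m" "i mod k < k" if "i < m * k" for i
    using that by (cases "k = 0"; simp add: less_mult_imp_div_less)+
  moreover have "i div l < n" "i mod l < l" if "i < n * l" for i
    using that by (cases "l = 0"; simp add: less_mult_imp_div_less)+
  ultimately show ?thesis using assms by (auto simp: cmat_def kron_by_def intro!: mult_closed)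
qed

lemma kron_entry:
  assumes "cmat m n X" "cmat k l Y" "x < m" "y < k" "x' < n" "y' < l"
  shows "kron_by (\<otimes>) X Y $$ (x * k + y, x' * l + y') = X $$ (x, x') \<otimes> Y $$ (y, y')"
  using assms pair_less[of x m y k] pair_less[of x' n y' l] by (simp add: cmat_def kron_by_def)

lemma avec_kron_one_right:
  assumes "cmat m n X" "x < m" "y < C"
  shows "avec (kron_by (\<otimes>) X (mat_one A C)) v (x * C + y) p
    = (\<Sum>k<n. \<Sum>r<qd. kap (X $$ (x, k)) p r * v (k * C + y) r)"
proof -
  have d: "dim_col (kron_by (\<otimes>) X (mat_one A C)) = n * C"
    using cmat_kron[OF assms(1) cmat_one] by (simp add: cmat_def)
  have e: "kap (kron_by (\<otimes>) X (mat_one A C) $$ (x * C + y, k * C + y')) p r = (if y = y' then kap (X $$ (x, k)) p r else 0)"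
    if "k < n" "y' < C" "r < qd" for k y' r
  proof -
    have X: "X $$ (x, k) \<in> carrier A" using assms that by (auto simp: cmat_def)
    have "kap (kron_by (\<otimes>) X (mat_one A C) $$ (x * C + y, k * C + y')) p r
       = (\<Sum>t<qd. kap (X $$ (x, k)) p t * kap (mat_one A C $$ (y, y')) t r)"
      using kron_entry[OF assms(1) cmat_one assms(2,3) that(1,2)] X assms that
      by (simp add: mat_one_def kap_mult one_closed zero_closed)
    also have "\<dots> = (\<Sum>t<qd. if r = t then (if y = y' then kap (X $$ (x, k)) p t else 0) else 0)"
      using assms that by (intro sum.cong refl) (auto simp: mat_one_def kap_one kap_zero)
    finally show ?thesis using that by (simp add: sum_single)
  qed
  have "avec (kron_by (\<otimes>) X (mat_one A C)) v (x * C + y) p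
    = (\<Sum>k<n. \<Sum>y'<C. if y = y' then \<Sum>r<qd. kap (X $$ (x, k)) p r * v (k * C + y') r else 0)"
    unfolding avec_def d sum_pair by (intro sum.cong refl) (simp add: e)
  then show ?thesis using assms by (simp add: sum_single)
qed

lemma avec_kron_one_left:
  assumes "cmat m n X" "x < C" "y < m"
  shows "avec (kron_by (\<otimes>) (mat_one A C) X) v (x * m + y) p
    = (\<Sum>k<n. \<Sum>r<qd. kap (X $$ (y, k)) p r * v (x * n + k) r)"
proof -
  have d: "dim_col (kron_by (\<otimes>) (mat_one A C) X) = C * n"
    using cmat_kron[OF cmat_one assms(1)] by (simp add: cmat_def)
  have e: "kap (kron_by (\<otimes>) (mat_one A C) X $$ (x * m + y, x' * n + k)) p r = (if x = x' then kap (X $$ (y, k)) p r else 0)"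
    if "k < n" "x' < C" "r < qd" for k x' r
  proof -
    have X: "X $$ (y, k) \<in> carrier A" using assms that by (auto simp: cmat_def)
    have "kap (kron_by (\<otimes>) (mat_one A C) X $$ (x * m + y, x' * n + k)) p r
       = (\<Sum>t<qd. kap (mat_one A C $$ (x, x')) p t * kap (X $$ (y, k)) t r)"
      using kron_entry[OF cmat_one assms(1) assms(2,3) that(2,1)] X assms that
      by (simp add: mat_one_def kap_mult one_closed zero_closed)
    also have "\<dots> = (\<Sum>t<qd. if p = t then (if x = x' then kap (X $$ (y, k)) t r else 0) else 0)"
      using assms that by (intro sum.cong refl) (auto simp: mat_one_def kap_one kap_zero)
    finally show ?thesis using kap_out[of p] by (simp add: sum_single)
  qed
  have "avec (kron_by (\<otimes>) (mat_one A C) X) v (x * m + y) p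
    = (\<Sum>x'<C. if x = x' then \<Sum>k<n. \<Sum>r<qd. kap (X $$ (y, k)) p r * v (x' * n + k) r else 0)"
    unfolding avec_def d sum_pair by (intro sum.cong refl) (simp add: e)
  then show ?thesis using assms by (simp add: sum_single)
qed

definition Op :: "nat \<Rightarrow> nat \<Rightarrow> 'a mat \<Rightarrow> state \<Rightarrow> state" where
  "Op d i X = leg_op d qd i 0 (\<lambda>m p k r. if m < d then kap (X $$ (m, k)) p r else 0)"

lemma Op_avec:
  assumes "cmat d d X" "i \<noteq> 0" "c i < d"
  shows "Op d i X f c = avec X (\<lambda>k r. f (c(i := k, 0 := r))) (c i) (c 0)"
  using assms by (simp add: Op_def leg_op_def avec_def cmat_def)

lemma Op_out: "\<not> c i < d \<Longrightarrow> Op d i X f c = 0"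
  by (simp add: Op_def leg_op_def)

lemma Op_mult:
  assumes "cmat d d X" "cmat d d Y" "i \<noteq> 0"
  shows "Op d i (X \<star> Y) f = Op d i X (Op d i Y f)"
proof
  fix c
  show "Op d i (X \<star> Y) f c = Op d i X (Op d i Y f) c"
  proof (cases "c i < d")
    case True
    have "c(i := k, 0 := r, i := k', 0 := r') = c(i := k', 0 := r')" for k r k' r'
      using assms(3) by (auto simp: fun_eq_iff)
    then have "avec X (\<lambda>k r. Op d i Y f (c(i := k, 0 := r))) (c i) (c 0)
       = avec X (avec Y (\<lambda>k r. f (c(i := k, 0 := r)))) (c i) (c 0)"
      using assms by (intro avec_cong) (simp add: Op_avec cmat_def)
    then show ?thesis using True assms
      by (simp add: Op_avec cmat_mult avec_mult)
  qed (simp add: Op_out)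
qed

lemma fused_K_cmat:
  assumes "\<And>u. u \<noteq> 0 \<Longrightarrow> cmat 2 2 (Kh u)" "s \<noteq> 0" "u \<noteq> 0"
  shows "cmat (Suc a) (Suc a) (fused_K A s Kh a u)"
  using assms(3)
proof (induction a arbitrary: u rule: less_induct)
  case (less a)
  consider "a = 0" | "a = Suc 0" | n where "a = Suc (Suc n)" by (metis not0_implies_Suc)
  then show ?case
  proof cases
    case 1
    then show ?thesis using cmat_one[of 1] by simp
  next
    case 2
    then show ?thesis using assms(1)[OF less.prems] by (simp add: numeral_2_eq_2)
  next
    case 3
    have u: "u * s \<noteq> 0" "u * s powi (1 - int (n + 2)) \<noteq> 0" using less.prems assms(2) by auto
    have "cmat (n + 2) (n + 2) (fused_K A s Kh (Suc n) (u * s))"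
      using less.IH[of "Suc n"] 3 u by simp
    then have k2: "cmat (2 * (n + 2)) (2 * (n + 2)) (kron_by (\<otimes>) (mat_one A 2) (fused_K A s Kh (Suc n) (u * s)))"
      by (rule cmat_kron[OF cmat_one])
    have k1: "cmat (2 * (n + 2)) (2 * (n + 2)) (kron_by (\<otimes>) (Kh (u * s powi (1 - int (n + 2)))) (mat_one A (n + 2)))"
      by (rule cmat_kron[OF assms(1)[OF u(2)] cmat_one])
    have r: "cmat (2 * (n + 2)) (2 * (n + 2)) (scal_mat A (R_half s (n + 1) (u\<^sup>2 * s powi (2 - int (n + 2)))))"
      using cmat_scal[of "R_half s (n + 1) (u\<^sup>2 * s powi (2 - int (n + 2)))"] by (simp only: R_half_dims) simp
    have e: "cmat (2 * (n + 2)) (Suc (n + 2)) (scal_mat A (E_mat s (n + 2)))"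
      using cmat_scal[of "E_mat s (n + 2)"] by (simp only: E_mat_dims)
    have f: "cmat (Suc (n + 2)) (2 * (n + 2)) (scal_mat A (F_mat s (n + 2)))"
      using cmat_scal[of "F_mat s (n + 2)"] by (simp only: F_mat_dims)
    have "cmat (Suc (n + 2)) (Suc (n + 2)) (fused_K A s Kh (Suc (Suc n)) u)"
      unfolding fused_K.simps by (intro cmat_mult[OF cmat_mult[OF cmat_mult[OF cmat_mult[OF f k1] r] k2] e])
    then show ?thesis using 3 by simp
  qed
qed

text \<open>The analogue of \<open>R_rec\<close> for K-operators: the facts \<open>s1\<close> to
  \<open>s5\<close> translate one factor of the recursion each. The auxiliary legs must be nonzero
  because leg 0 carries the representation.\<close>

lemma fused_K_rec:
  assumes "\<And>u. u \<noteq> 0 \<Longrightarrow> cmat 2 2 (Kh u)" "generic_root s" "u \<noteq> 0" "1 \<le> a" "i \<noteq> j" "i \<noteq> 0" "j \<noteq> 0"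
  shows "Fop s (Suc a) i j (Op 2 i (Kh (u * s powi (- int a))) (Rop s (Suc 0) a (u\<^sup>2 * s powi (1 - int a)) i j
           (Op (Suc a) j (fused_K A s Kh a (u * s)) (Eop s (Suc a) i j f)))) c
     = Op (Suc (Suc a)) j (fused_K A s Kh (Suc a) u) f (c(i := 0))"
proof -
  interpret generic_root s by fact
  define B where "B = Suc a"
  obtain n where n: "a = Suc n" "n + 2 = B" using assms(4) by (cases a) (auto simp: B_def)
  define K1 where "K1 = Kh (u * s powi (- int a))"
  define K2 where "K2 = fused_K A s Kh a (u * s)"
  define M where "M = R_half s a (u\<^sup>2 * s powi (1 - int a))"
  define X where "X = fused_K A s Kh (Suc a) u"
  have e: "1 - int B = - int a" "2 - int B = 1 - int a" "n + 1 = a" "Suc n = a" by (simp_all add: n(1) B_def)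
  have X: "X = scal_mat A (F_mat s B) \<star> kron_by (\<otimes>) K1 (mat_one A B) \<star> scal_mat A M
      \<star> kron_by (\<otimes>) (mat_one A 2) K2 \<star> scal_mat A (E_mat s B)"
    unfolding X_def K1_def K2_def M_def by (rule fused_K.simps(3)[of A s Kh n u, unfolded n(2) e])
  have c1: "cmat 2 2 K1" unfolding K1_def using assms s0 by auto
  have c2: "cmat B B K2" unfolding K2_def B_def using assms s0 by (intro fused_K_cmat) auto
  have cX: "cmat (Suc B) (Suc B) X" unfolding X_def B_def using assms s0 by (intro fused_K_cmat) auto
  have k2: "cmat (2 * B) (2 * B) (kron_by (\<otimes>) (mat_one A 2) K2)" by (rule cmat_kron[OF cmat_one c2])
  have k1: "cmat (2 * B) (2 * B) (kron_by (\<otimes>) K1 (mat_one A B))" by (rule cmat_kron[OF c1 cmat_one])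
  have dM: "dim_row M = 2 * B" "dim_col M = 2 * B" unfolding M_def R_half_dims B_def by simp_all
  have r: "cmat (2 * B) (2 * B) (scal_mat A M)" using cmat_scal[of M] by (simp only: dM)
  have e: "cmat (2 * B) (Suc B) (scal_mat A (E_mat s B))" using cmat_scal[of "E_mat s B"] by (simp only: E_mat_dims)
  have f: "cmat (Suc B) (2 * B) (scal_mat A (F_mat s B))" using cmat_scal[of "F_mat s B"] by (simp only: F_mat_dims)
  note fk = cmat_mult[OF f k1] and fkr = cmat_mult[OF cmat_mult[OF f k1] r] and fkrk = cmat_mult[OF cmat_mult[OF cmat_mult[OF f k1] r] k2]
  note dims = f[unfolded cmat_def, THEN conjunct2, THEN conjunct1] k1[unfolded cmat_def, THEN conjunct2, THEN conjunct1]
     k2[unfolded cmat_def, THEN conjunct2, THEN conjunct1] r[unfolded cmat_def, THEN conjunct2, THEN conjunct1]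
     e[unfolded cmat_def, THEN conjunct2, THEN conjunct1]
  \<comment> \<open>Coordinates along i and j in Kronecker order, with the representation index p on
    leg 0.\<close>
  define vec where "vec = (\<lambda>g m p. g (c(i := m div B, j := m mod B, 0 := p)) :: complex)"
  define f1 where "f1 = Eop s B i j f"
  define f2 where "f2 = Op B j K2 f1"
  define f3 where "f3 = Rop s (Suc 0) a (u\<^sup>2 * s powi (1 - int a)) i j f2"
  define f4 where "f4 = Op 2 i K1 f3"
  define v where "v = (\<lambda>m p. f (c(i := 0, j := m, 0 := p)))"
  have B0: "B > 0" by (simp add: B_def)
  have split: "\<exists>x y. m = x * B + y \<and> x < 2 \<and> y < B" if "m < 2 * B" for m
    using that B0 by (intro exI[of _ "m div B"] exI[of _ "m mod B"]) (simp add: less_mult_imp_div_less)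
  have s1: "avec (scal_mat A (E_mat s B)) v m p = vec f1 m p" if mp: "m < 2 * B" "p < qd" for m p
  proof -
    obtain x y where xy: "m = x * B + y" "x < 2" "y < B" using split[OF mp(1)] by blast
    have upd: "c(0 := p, i := 0, j := k) = c(i := 0, j := k, 0 := p)" for k
      using assms by (auto simp: fun_eq_iff)
    have "avec (scal_mat A (E_mat s B)) v m p = (\<Sum>k<Suc B. E_ker s B x y 0 k * v k p)"
      unfolding xy(1) using mp xy by (subst avec_scal) (simp_all add: E_mat_ker del: sum.lessThan_Suc)
    also have "\<dots> = vec f1 m p"
      unfolding vec_def f1_def v_def using xy assms by (simp add: leg_op_def upd)
    finally show ?thesis .
  qed
  have s2: "avec (kron_by (\<otimes>) (mat_one A 2) K2) (vec f1) m p = vec f2 m p" if mp: "m < 2 * B" for m p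
  proof -
    obtain x y where xy: "m = x * B + y" "x < 2" "y < B" using split[OF mp(1)] by blast
    have upd: "c(i := x, j := y, 0 := p, j := k, 0 := r) = c(i := x, j := k, 0 := r)" for k r
      using assms by (auto simp: fun_eq_iff)
    have "avec (kron_by (\<otimes>) (mat_one A 2) K2) (vec f1) m p
       = (\<Sum>k<B. \<Sum>r<qd. kap (K2 $$ (y, k)) p r * vec f1 (x * B + k) r)"
      unfolding xy(1) by (rule avec_kron_one_left[OF c2 xy(2,3)])
    also have "\<dots> = vec f2 m p"
      unfolding vec_def f2_def Op_def leg_op_def xy(1) using xy assms by (simp add: upd)
    finally show ?thesis .
  qed
  have s3: "avec (scal_mat A M) (vec f2) m p = vec f3 m p" if mp: "m < 2 * B" "p < qd" for m p
  proof -
    obtain x y where xy: "m = x * B + y" "x < 2" "y < B" using split[OF mp(1)] by blast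
    have upd: "c(0 := p, i := k, j := l) = c(i := k, j := l, 0 := p)" for k l
      using assms by (auto simp: fun_eq_iff)
    have "avec (scal_mat A M) (vec f2) m p = (\<Sum>k<2. \<Sum>l<B. M $$ (x * B + y, k * B + l) * vec f2 (k * B + l) p)"
      unfolding xy(1) using mp xy by (subst avec_scal) (simp_all add: dM sum_pair[of _ 2 B])
    also have "\<dots> = vec f3 m p"
      unfolding vec_def f3_def leg_op_def xy(1) numeral_2_eq_2[symmetric] B_def[symmetric] R_ker_def
      using xy assms by (simp add: upd M_def[symmetric] B_def[symmetric] less_Suc_eq_le[symmetric])
    finally show ?thesis .
  qed
  have s4: "avec (kron_by (\<otimes>) K1 (mat_one A B)) (vec f3) m p = vec f4 m p" if mp: "m < 2 * B" for m p
  proof -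
    obtain x y where xy: "m = x * B + y" "x < 2" "y < B" using split[OF mp(1)] by blast
    have upd: "c(j := y, i := k, 0 := r) = c(i := k, j := y, 0 := r)" for k r
      using assms by (auto simp: fun_eq_iff)
    have "avec (kron_by (\<otimes>) K1 (mat_one A B)) (vec f3) m p
       = (\<Sum>k<2. \<Sum>r<qd. kap (K1 $$ (x, k)) p r * vec f3 (k * B + y) r)"
      unfolding xy(1) by (rule avec_kron_one_right[OF c1 xy(2,3)])
    also have "\<dots> = vec f4 m p"
      unfolding vec_def f4_def Op_def leg_op_def xy(1) using xy assms by (simp add: upd)
    finally show ?thesis .
  qed
  have s5: "avec (scal_mat A (F_mat s B)) (vec f4) (c j) (c 0) = Fop s B i j f4 c" if mp: "c j \<le> B" "c 0 < qd"
  proof -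
    have "c(i := k, j := l, 0 := c 0) = c(i := k, j := l)" for k l
      using assms by (auto simp: fun_eq_iff)
    then show ?thesis using mp by (subst avec_scal) (simp_all add: sum_pair[of _ 2 B] vec_def leg_op_def F_ker_def)
  qed
  have "Fop s B i j f4 c = Op (Suc B) j X f (c(i := 0))"
  proof (cases "c j \<le> B \<and> c 0 < qd")
    case True
    have "Op (Suc B) j X f (c(i := 0)) = avec X v (c j) (c 0)"
      using assms True by (subst Op_avec[OF cX]) (simp_all add: v_def)
    also have "\<dots> = avec (scal_mat A (F_mat s B)) (avec (kron_by (\<otimes>) K1 (mat_one A B)) (avec (scal_mat A M)
       (avec (kron_by (\<otimes>) (mat_one A 2) K2) (avec (scal_mat A (E_mat s B)) v)))) (c j) (c 0)"
    proof -
      have cj: "c j < Suc B" using True by simp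
      show ?thesis
        unfolding X avec_mult[OF fkrk e cj] avec_mult[OF fkr k2 cj] avec_mult[OF fk r cj] avec_mult[OF f k1 cj] ..
    qed
    also have "\<dots> = avec (scal_mat A (F_mat s B)) (vec f4) (c j) (c 0)"
    proof (rule avec_cong)
      fix m p assume "m < dim_col (scal_mat A (F_mat s B))" "p < qd"
      then have mp: "m < 2 * B" by (simp only: dims)
      have "avec (kron_by (\<otimes>) K1 (mat_one A B)) (avec (scal_mat A M) (avec (kron_by (\<otimes>) (mat_one A 2) K2) (avec (scal_mat A (E_mat s B)) v))) m p
         = avec (kron_by (\<otimes>) K1 (mat_one A B)) (vec f3) m p"
      proof (rule avec_cong)
        fix m p assume "m < dim_col (kron_by (\<otimes>) K1 (mat_one A B))" "p < qd"
        then have mp: "m < 2 * B" "p < qd" by (simp_all only: dims)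
        have "avec (scal_mat A M) (avec (kron_by (\<otimes>) (mat_one A 2) K2) (avec (scal_mat A (E_mat s B)) v)) m p
          = avec (scal_mat A M) (vec f2) m p"
        proof (rule avec_cong)
          fix m p assume "m < dim_col (scal_mat A M)" "p < qd"
          then have mp: "m < 2 * B" by (simp only: dims)
          have "avec (kron_by (\<otimes>) (mat_one A 2) K2) (avec (scal_mat A (E_mat s B)) v) m p
            = avec (kron_by (\<otimes>) (mat_one A 2) K2) (vec f1) m p"
            by (rule avec_cong) (simp add: s1 dims)
          then show "avec (kron_by (\<otimes>) (mat_one A 2) K2) (avec (scal_mat A (E_mat s B)) v) m p = vec f2 m p"
            by (simp only: s2[OF mp])
        qed
        then show "avec (scal_mat A M) (avec (kron_by (\<otimes>) (mat_one A 2) K2) (avec (scal_mat A (E_mat s B)) v)) m p = vec f3 m p"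
          by (simp only: s3[OF mp])
      qed
      then show "avec (kron_by (\<otimes>) K1 (mat_one A B)) (avec (scal_mat A M) (avec (kron_by (\<otimes>) (mat_one A 2) K2) (avec (scal_mat A (E_mat s B)) v))) m p = vec f4 m p"
        by (simp only: s4[OF mp])
    qed
    finally show ?thesis using True s5 by simp
  next
    case False
    then consider "\<not> c j \<le> B" | "\<not> c 0 < qd" by auto
    then show ?thesis
    proof cases
      case 1
      then show ?thesis using assms by (simp add: Op_out leg_op_def F_ker_def)
    next
      case 2
      then show ?thesis using assms(5) assms(6)[symmetric] assms(7)[symmetric] by (simp add: f4_def Op_def leg_op_def kap_out del: sum.lessThan_Suc cong: if_cong)
    qed
  qed
  then show ?thesis
    unfolding f4_def f3_def f2_def f1_def K1_def K2_def X_def B_def .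
qed

text \<open>Applying the operator to a delta state recovers a single matrix entry; this is the way
  back from operator identities to identities of entries.\<close>

lemma Op_kernel:
  assumes "cmat d d X" "i \<noteq> 0" "c i = m" "c 0 = p" "m < d" "k < d" "r < qd"
  shows "Op d i X (\<lambda>e. if e i = k \<and> e 0 = r then 1 else 0) c = kap (X $$ (m, k)) p r"
proof -
  have "Op d i X (\<lambda>e. if e i = k \<and> e 0 = r then 1 else 0) c
    = (\<Sum>l<d. \<Sum>t<qd. if k = l then if r = t then kap (X $$ (m, k)) p r else 0 else 0)"
    unfolding Op_def leg_op_def using assms by (intro sum.cong refl) auto
  also have "\<dots> = (\<Sum>l<d. if k = l then \<Sum>t<qd. if r = t then kap (X $$ (m, k)) p r else 0 else 0)"
    by (intro sum.cong refl) auto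
  finally have "Op d i X (\<lambda>e. if e i = k \<and> e 0 = r then 1 else 0) c
    = (\<Sum>l<d. if k = l then \<Sum>t<qd. if r = t then kap (X $$ (m, k)) p r else 0 else 0)" .
  then show ?thesis using assms by (simp add: sum_single)
qed

text \<open>Both bracketings act as the same composite operator, and delta states read off its
  entries. Associativity of \<open>mat_mul\<close> thus comes from that of composition.\<close>

lemma kap_mat_assoc:
  assumes "cmat d d V" "cmat d d X" "cmat d d Y" "cmat d d Z" "m < d" "k < d" "r < qd"
  shows "kap ((V \<star> X \<star> Y \<star> Z) $$ (m, k)) p r = kap ((V \<star> (X \<star> Y \<star> Z)) $$ (m, k)) p r"
proof -
  define c :: "nat \<Rightarrow> nat" where "c = (\<lambda>_. m)(0 := p)"
  have c: "c (Suc 0) = m" "c 0 = p" by (simp_all add: c_def)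
  have one: "Suc 0 \<noteq> 0" by simp
  note VX = cmat_mult[OF assms(1,2)] and XY = cmat_mult[OF assms(2,3)]
  note VXY = cmat_mult[OF VX assms(3)] and XYZ = cmat_mult[OF XY assms(4)]
  show ?thesis
    unfolding Op_kernel[OF cmat_mult[OF VXY assms(4)] one c assms(5-7), symmetric]
      Op_kernel[OF cmat_mult[OF assms(1) XYZ] one c assms(5-7), symmetric]
    by (simp only: Op_mult[OF VXY assms(4) one] Op_mult[OF VX assms(3) one] Op_mult[OF assms(1,2) one]
      Op_mult[OF assms(1) XYZ one] Op_mult[OF XY assms(4) one] Op_mult[OF assms(2,3) one])
qed

lemma kap_trace_scal:
  assumes "dim_row M = d" "dim_col M = d" "cmat d d Y" "p < qd"
  shows "kap (mat_trace A (scal_mat A M \<star> Y)) p r = (\<Sum>i<d. \<Sum>l<d. M $$ (i, l) * kap (Y $$ (l, i)) p r)"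
    and "mat_trace A (scal_mat A M \<star> Y) \<in> carrier A"
proof -
  have cM: "cmat d d (scal_mat A M)" using cmat_scal[of M] assms(1,2) by simp
  note cX = cmat_mult[OF cM assms(3)]
  have c: "(scal_mat A M \<star> Y) $$ (i, i) \<in> carrier A" if "i < d" for i
    using cX that by (simp add: cmat_def)
  have dr: "{0..<dim_row (scal_mat A M \<star> Y)} = {..<d}" using cX by (auto simp: cmat_def)
  show "mat_trace A (scal_mat A M \<star> Y) \<in> carrier A"
    unfolding mat_trace_def dr by (rule abelian_monoid.finsum_closed[OF am]) (use c in auto)
  have "kap (mat_trace A (scal_mat A M \<star> Y)) p r = (\<Sum>i<d. kap ((scal_mat A M \<star> Y) $$ (i, i)) p r)"
    unfolding mat_trace_def dr by (rule kap_finsum) (use c in auto)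
  also have "\<dots> = (\<Sum>i<d. \<Sum>l<d. \<Sum>t<qd. kap (scal_mat A M $$ (i, l)) p t * kap (Y $$ (l, i)) t r)"
    by (intro sum.cong refl kap_mat_mult[OF cM assms(3)]) auto
  also have "\<dots> = (\<Sum>i<d. \<Sum>l<d. \<Sum>t<qd. if p = t then M $$ (i, l) * kap (Y $$ (l, i)) t r else 0)"
    using assms(1,2,4) by (intro sum.cong refl) (simp add: scal_mat_def kap_scalar)
  also have "\<dots> = (\<Sum>i<d. \<Sum>l<d. M $$ (i, l) * kap (Y $$ (l, i)) p r)"
    using assms(4) by (simp add: sum_single)
  finally show "kap (mat_trace A (scal_mat A M \<star> Y)) p r = (\<Sum>i<d. \<Sum>l<d. M $$ (i, l) * kap (Y $$ (l, i)) p r)" .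
qed

end

section \<open>The reflection equation\<close>

text \<open>The one-dimensional representation of the complex numbers. Through it the scalar
  K-matrices become an instance of the general recursion \<open>fused_K_rec\<close>.\<close>

definition ckap :: "complex \<Rightarrow> nat \<Rightarrow> nat \<Rightarrow> complex" where
  "ckap x p r = (if p = 0 \<and> r = 0 then x else 0)"

lemma complex_alg_carrier: "carrier complex_alg = UNIV"
  by (simp add: complex_alg_def)

interpretation cplx: alg_rep complex_alg ckap "Suc 0"
proof
  show "x \<otimes>\<^bsub>complex_alg\<^esub> y \<in> carrier complex_alg" for x y
    by (simp add: complex_alg_def)
qed (auto simp: complex_alg_def ckap_def algebra_simps)

text \<open>A one-leg operator is a two-leg operator whose legs coincide and whose first sum is
  trivial, so that all lemmas on \<open>leg_op\<close> without distinct legs apply.\<close>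

abbreviation Kop :: "nat \<Rightarrow> complex mat \<Rightarrow> nat \<Rightarrow> state \<Rightarrow> state" where
  "Kop d M j \<equiv> leg_op (Suc 0) d j j (\<lambda>m _ _ k. if m < d then M $$ (m, k) else 0)"

lemma leg_op_zero_state: "leg_op a b i j M (\<lambda>c. 0) = (\<lambda>c. 0)"
  by (simp add: leg_op_def)

lemma leg_op_agree:
  assumes "i \<noteq> 0" "j \<noteq> 0" "\<And>c. c 0 = 0 \<Longrightarrow> f c = g c" "c 0 = 0"
  shows "leg_op a b i j M f c = leg_op a b i j M g c"
  unfolding leg_op_def using assms by (intro sum.cong refl) simp

lemma cplx_Op:
  assumes "i \<noteq> 0" "c 0 = 0"
  shows "cplx.Op d i M f c = Kop d M i f c"
proof -
  have "c(i := k, 0 := 0) = c(i := k)" for k using assms by (auto simp: fun_eq_iff)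
  then show ?thesis using assms by (simp add: cplx.Op_def leg_op_def ckap_def cong: if_cong)
qed

lemma inverse_cancel_inner: "Z \<noteq> 0 \<Longrightarrow> x * inverse Z * (Z * w) = x * (w :: complex)" "Z \<noteq> 0 \<Longrightarrow> x * inverse Z * (w * Z) = x * w"
  by (simp_all add: field_simps)

locale reflection = generic_root +
  fixes ep em kp km :: complex
begin

abbreviation K1 where "K1 u i \<equiv> Kop 2 (K_half s ep em kp km u) i"
abbreviation KK where "KK b u j \<equiv> Kop (Suc b) (K_mat s ep em kp km b u) j"

lemma cmat_K_half: "cplx.cmat 2 2 (K_half s ep em kp km u)"
  by (auto simp: cplx.cmat_def K_half_def mat22_def complex_alg_carrier)

text \<open>The general recursion sees leg 0 as a representation space of dimension 1, so it is
  first transferred at configurations with \<open>c 0 = 0\<close>. None of the scalar operators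
  touches leg 0, which removes that restriction.\<close>

lemma K_rec:
  assumes "u \<noteq> 0" "1 \<le> a" "i \<noteq> j" "i \<noteq> 0" "j \<noteq> 0"
  shows "Fop s (Suc a) i j (K1 (u * s powi (- int a)) i (R (Suc 0) a (u\<^sup>2 * s powi (1 - int a)) i j
           (KK a (u * s) j (E (Suc a) i j f))))
     = (\<lambda>c. KK (Suc a) u j f (c(i := 0)))"
proof
  fix c :: "nat \<Rightarrow> nat"
  define X where "X = (\<lambda>f. Fop s (Suc a) i j (K1 (u * s powi (- int a)) i (R (Suc 0) a (u\<^sup>2 * s powi (1 - int a)) i j
           (KK a (u * s) j (E (Suc a) i j f)))))"
  have X0: "X f c = KK (Suc a) u j f (c(i := 0))" if "c 0 = 0" for f c
  proof -
    have "X f c = Fop s (Suc a) i j (cplx.Op 2 i (K_half s ep em kp km (u * s powi (- int a))) (R (Suc 0) a (u\<^sup>2 * s powi (1 - int a)) i j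
           (cplx.Op (Suc a) j (K_mat s ep em kp km a (u * s)) (E (Suc a) i j f)))) c"
      unfolding X_def
    proof (rule leg_op_agree)
      show "i \<noteq> 0" "j \<noteq> 0" "c 0 = 0" by fact+
      fix c :: "nat \<Rightarrow> nat" assume c: "c 0 = 0"
      show "K1 (u * s powi (- int a)) i (R (Suc 0) a (u\<^sup>2 * s powi (1 - int a)) i j (KK a (u * s) j (E (Suc a) i j f))) c
        = cplx.Op 2 i (K_half s ep em kp km (u * s powi (- int a))) (R (Suc 0) a (u\<^sup>2 * s powi (1 - int a)) i j
           (cplx.Op (Suc a) j (K_mat s ep em kp km a (u * s)) (E (Suc a) i j f))) c"
        unfolding cplx_Op[where c = c, OF assms(4) c]
      proof (rule leg_op_agree)
        show "i \<noteq> 0" "i \<noteq> 0" "c 0 = 0" by fact+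
        fix c :: "nat \<Rightarrow> nat" assume c: "c 0 = 0"
        show "R (Suc 0) a (u\<^sup>2 * s powi (1 - int a)) i j (KK a (u * s) j (E (Suc a) i j f)) c
          = R (Suc 0) a (u\<^sup>2 * s powi (1 - int a)) i j (cplx.Op (Suc a) j (K_mat s ep em kp km a (u * s)) (E (Suc a) i j f)) c"
        proof (rule leg_op_agree)
          show "i \<noteq> 0" "j \<noteq> 0" "c 0 = 0" by fact+
        qed (simp only: cplx_Op[OF assms(5)])
      qed
    qed
    also have "\<dots> = cplx.Op (Suc (Suc a)) j (K_mat s ep em kp km (Suc a) u) f (c(i := 0))"
      unfolding K_mat_def by (rule cplx.fused_K_rec[OF cmat_K_half generic_root_axioms assms])
    also have "\<dots> = KK (Suc a) u j f (c(i := 0))"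
      using assms that by (intro cplx_Op) auto
    finally show ?thesis .
  qed
  \<comment> \<open>Leg 0 is frozen at its actual value inside f, and the configuration is then
    moved to index 0.\<close>
  have ind: "indep 0 X" "indep 0 (KK (Suc a) u j)"
    unfolding X_def by (intro indep_leg_op_comp indep_id indep_leg_op assms(4)[symmetric] assms(5)[symmetric])+
  let ?f = "\<lambda>d. f (d(0 := c 0))"
  have "X f c = X ?f (c(0 := 0))" using ind(1) by (simp add: indepD)
  also have "\<dots> = KK (Suc a) u j ?f (c(0 := 0, i := 0))" by (rule X0) simp
  also have "\<dots> = KK (Suc a) u j f (c(i := 0))"
  proof -
    have "c(0 := 0, i := 0, 0 := c 0) = c(i := 0)" using assms by (auto simp: fun_eq_iff)
    then show ?thesis by (simp only: indepD[OF ind(2)])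
  qed
  finally show "Fop s (Suc a) i j (K1 (u * s powi (- int a)) i (R (Suc 0) a (u\<^sup>2 * s powi (1 - int a)) i j
           (KK a (u * s) j (E (Suc a) i j f)))) c = KK (Suc a) u j f (c(i := 0))"
    unfolding X_def .
qed

definition K_fuses :: "nat \<Rightarrow> bool" where
  "K_fuses b \<longleftrightarrow> (\<forall>i j u f. i \<noteq> j \<longrightarrow> i \<noteq> 0 \<longrightarrow> j \<noteq> 0 \<longrightarrow> u \<noteq> 0 \<longrightarrow>
     E (Suc b) i j (KK (Suc b) u j f) = K1 (u * s powi (- int b)) i (R (Suc 0) b (u\<^sup>2 * s powi (1 - int b)) i j
        (KK b (u * s) j (E (Suc b) i j f))))"

text \<open>The reflection equation with a spin-1/2 leg i at parameter x and a spin b/2 leg j at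
  parameter y.\<close>

definition reflects :: "nat \<Rightarrow> bool" where
  "reflects b \<longleftrightarrow> (\<forall>i j x y f. i \<noteq> j \<longrightarrow> i \<noteq> 0 \<longrightarrow> j \<noteq> 0 \<longrightarrow> x \<noteq> 0 \<longrightarrow> y \<noteq> 0 \<longrightarrow>
     R (Suc 0) b (x * inverse y) i j (K1 x i (R (Suc 0) b (x * y) i j (KK b y j f)))
     = KK b y j (R (Suc 0) b (x * y) i j (K1 x i (R (Suc 0) b (x * inverse y) i j f))))"

lemma K_fusesD: "K_fuses b \<Longrightarrow> i \<noteq> j \<Longrightarrow> i \<noteq> 0 \<Longrightarrow> j \<noteq> 0 \<Longrightarrow> u \<noteq> 0 \<Longrightarrow>
     E (Suc b) i j (KK (Suc b) u j f) = K1 (u * s powi (- int b)) i (R (Suc 0) b (u\<^sup>2 * s powi (1 - int b)) i j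
        (KK b (u * s) j (E (Suc b) i j f)))"
  by (simp add: K_fuses_def)

lemma reflectsD: "reflects b \<Longrightarrow> i \<noteq> j \<Longrightarrow> i \<noteq> 0 \<Longrightarrow> j \<noteq> 0 \<Longrightarrow> x \<noteq> 0 \<Longrightarrow> y \<noteq> 0 \<Longrightarrow>
     R (Suc 0) b (x * inverse y) i j (K1 x i (R (Suc 0) b (x * y) i j (KK b y j f)))
     = KK b y j (R (Suc 0) b (x * y) i j (K1 x i (R (Suc 0) b (x * inverse y) i j f)))"
  by (simp add: reflects_def)

text \<open>The point s^(-b-1) is the ratio x/y for x = u s^(-b) and y = u s, the two parameters of
  the fusion recursion. There the diagonal entries of L become negative q-integers up to a common
  factor and can cancel the ladder terms.\<close>

lemma degenerate_shift:
  assumes "m \<le> b"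
  shows "L_diag0 s b (s powi (- int (Suc b))) m = - (cfun (s\<^sup>2) * qint s m)"
    "L_diag1 s b (s powi (- int (Suc b))) m = - (cfun (s\<^sup>2) * qint s (b - m))"
proof -
  have e: "s ^ (b - m) = s ^ b / s ^ m"
    using s0 assms by (simp add: power_diff)
  have nz: "s ^ b \<noteq> 0" "s ^ m \<noteq> 0" using s0 by auto
  show "L_diag0 s b (s powi (- int (Suc b))) m = - (cfun (s\<^sup>2) * qint s m)"
    "L_diag1 s b (s powi (- int (Suc b))) m = - (cfun (s\<^sup>2) * qint s (b - m))"
    unfolding cfun_qint e L_diag0_def L_diag1_def using nz s0
    by (simp_all add: cfun_def powi_split) (simp_all add: field_simps power2_eq_square)
qed

text \<open>At this spectral parameter the R-operator is singular and its kernel is the range of the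
  fusion map. The reflection equation then forces the unfused product of K-operators to preserve that
  range, where \<open>E F\<close> is the identity.\<close>

lemma R_degenerate_E:
  assumes "i \<noteq> j" "1 \<le> b"
  shows "R (Suc 0) b (s powi (- int (Suc b))) i j (E (Suc b) i j f) = (\<lambda>c. 0)"
proof -
  have "Lop s b (s powi (- int (Suc b))) i j (E (Suc b) i j f) c = 0" for c
  proof -
    have upd: "c(i := x, j := y, i := z) = c(i := z, j := y)" "c(i := x, j := y, i := z, j := w) = c(i := z, j := w)" for x y z w
      using assms(1) by (auto simp: fun_eq_iff)
    define m where "m = c j"
    define v where "v = s powi (- int (Suc b))"
    consider "\<not> m \<le> b" | "m \<le> b" "c i = 0" | "m \<le> b" "c i = 1" | "c i \<noteq> 0" "c i \<noteq> 1" by blast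
    then show ?thesis
    proof cases
      case 2
      have "ladder s b m * E_low s (Suc b) m = qint s m * E_diag s (Suc b) m"
        using 2 E_low_ladder[of m b] by (cases m) (auto simp: mult_ac qint_def)
      then have z: "L_diag0 s b v m * E_diag s (Suc b) m + cfun (s\<^sup>2) * (ladder s b m * E_low s (Suc b) m) = 0"
        using 2 degenerate_shift(1) by (simp add: v_def)
      have "Lop s b v i j (E (Suc b) i j f) c
         = (L_diag0 s b v m * E_diag s (Suc b) m + cfun (s\<^sup>2) * (ladder s b m * E_low s (Suc b) m)) * f (c(i := 0, j := m))"
        using 2 assms(1) by (cases m) (auto simp: Lop_ev Eop_eval m_def[symmetric] upd algebra_simps)
      then show ?thesis unfolding z mult_zero_left unfolding v_def .
    next
      case 3
      have "(if m < b then ladder s b (Suc m) * E_diag s (Suc b) (Suc m) else 0) = qint s (b - m) * E_low s (Suc b) (Suc m)"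
        using 3 E_diag_ladder[of "Suc m" b] by (auto simp: mult_ac qint_def)
      then have z: "L_diag1 s b v m * E_low s (Suc b) (Suc m) + cfun (s\<^sup>2) * (if m < b then ladder s b (Suc m) * E_diag s (Suc b) (Suc m) else 0) = 0"
        using 3 degenerate_shift(2) by (simp add: v_def)
      have "Lop s b v i j (E (Suc b) i j f) c
         = (L_diag1 s b v m * E_low s (Suc b) (Suc m) + cfun (s\<^sup>2) * (if m < b then ladder s b (Suc m) * E_diag s (Suc b) (Suc m) else 0)) * f (c(i := 0, j := Suc m))"
        using 3 assms(1) by (auto simp: Lop_ev Eop_eval m_def[symmetric] upd algebra_simps)
      then show ?thesis unfolding z mult_zero_left unfolding v_def .
    qed (auto simp: Lop_ev assms(1) m_def)
  qed
  then show ?thesis by (simp add: Rop_half[OF assms(2)])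
qed

text \<open>All exponents of s are negative and even, so no factor vanishes: the singularity of R at
  this point is that of L, and its kernel can be computed from L.\<close>

lemma R_pref_degenerate: "R_pref s b (s powi (- int (Suc b))) \<noteq> 0"
proof -
  have "cfun (s powi (- int (Suc b)) * s powi (int b - 1 - 2 * int k)) \<noteq> 0" for k
  proof -
    have "s powi (- int (Suc b)) * s powi (int b - 1 - 2 * int k) = s powi (- int (Suc b) + (int b - 1 - 2 * int k))"
      by (simp only: power_int_add s0 not_False_eq_True simp_thms)
    also have "- int (Suc b) + (int b - 1 - 2 * int k) = - (2 + 2 * int k)" by simp
    finally show ?thesis using cfun_powi_nonzero[of "2 + 2 * int k"] by simp
  qed
  then show ?thesis by (simp add: R_pref_def)
qed

text \<open>States annihilated by R form one line for each value m of the sum of the two indices,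
  spanned by column m of E. On such a line E F is the identity by \<open>F_left_inverse\<close>; for
  the extreme values of m only one component exists.\<close>

lemma EF_on_kernel:
  assumes "i \<noteq> j" "1 \<le> b" "R (Suc 0) b (s powi (- int (Suc b))) i j w = (\<lambda>c. 0)"
    and "\<And>c. c i \<ge> 2 \<Longrightarrow> w c = 0" "\<And>c. c j > b \<Longrightarrow> w c = 0"
  shows "E (Suc b) i j (Fop s (Suc b) i j w) = w"
proof
  fix c
  have L: "Lop s b (s powi (- int (Suc b))) i j w c = 0" for c
    using fun_cong[OF assms(3), of c] R_pref_degenerate by (simp add: Rop_half[OF assms(2)])
  \<comment> \<open>One component of the kernel equation, at index 0 of leg i, already fixes the
    ratio of the two components, and it is the ratio of the entries of E.\<close>
  have key: "w (c(i := 1, j := m)) * E_diag s (Suc b) (Suc m) = E_low s (Suc b) (Suc m) * w (c(i := 0, j := Suc m))"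
    if "Suc m \<le> b" for m
  proof -
    have u: "(c(i := 0, j := Suc m)) i = 0" "(c(i := 0, j := Suc m)) j = Suc m"
       "c(i := 0, j := Suc m, i := x, j := y) = c(i := x, j := y)" for x y
      using assms(1) by (auto simp: fun_eq_iff)
    have "- (cfun (s\<^sup>2) * qint s (Suc m)) * w (c(i := 0, j := Suc m)) + cfun (s\<^sup>2) * ladder s b (Suc m) * w (c(i := 1, j := m)) = 0"
      using L[of "c(i := 0, j := Suc m)"] that unfolding Lop_ev[OF assms(1)] u degenerate_shift(1)[OF that] by simp
    then have "cfun (s\<^sup>2) * (ladder s b (Suc m) * w (c(i := 1, j := m))) = cfun (s\<^sup>2) * (qint s (Suc m) * w (c(i := 0, j := Suc m)))"
      by (simp add: algebra_simps)
    then have 1: "ladder s b (Suc m) * w (c(i := 1, j := m)) = qint s (Suc m) * w (c(i := 0, j := Suc m))"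
      using cfun_sq_nonzero by simp
    have 2: "E_low s (Suc b) (Suc m) * ladder s b (Suc m) = qint s (Suc m) * E_diag s (Suc b) (Suc m)"
      using E_low_ladder[of "Suc m" b] that by (simp add: qint_def)
    have "ladder s b (Suc m) * (w (c(i := 1, j := m)) * E_diag s (Suc b) (Suc m))
       = (qint s (Suc m) * E_diag s (Suc b) (Suc m)) * w (c(i := 0, j := Suc m))"
      using 1 by (simp add: mult_ac)
    also have "\<dots> = ladder s b (Suc m) * (E_low s (Suc b) (Suc m) * w (c(i := 0, j := Suc m)))"
      unfolding 2[symmetric] by (simp add: mult_ac)
    finally show ?thesis using ladder_nonzero[of "Suc m" b] that by simp
  qed
  have F: "Fop s (Suc b) i j w (c(i := 0, j := m)) =
       (if m < Suc b then F_left (Suc b) m * w (c(i := 0, j := m)) else 0) + (if 1 \<le> m then F_right (Suc b) m * w (c(i := 1, j := m - 1)) else 0)"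
    if "m \<le> Suc b" for m
  proof -
    have "c(i := 0, j := m, i := x, j := y) = c(i := x, j := y)" for x y
      using assms(1) by (auto simp: fun_eq_iff)
    then show ?thesis using that by (simp add: Fop_eval[OF assms(1)])
  qed
  define m where "m = c j"
  consider "\<not> m \<le> b" | "m \<le> b" "c i = 0" | "m \<le> b" "c i = 1" | "c i \<ge> 2" by linarith
  then show "E (Suc b) i j (Fop s (Suc b) i j w) c = w c"
  proof cases
    case 1
    then show ?thesis using assms(5)[of c] by (simp add: Eop_eval m_def)
  next
    case 2
    have c: "c(i := 0, j := m) = c" using 2 by (simp add: m_def fun_upd_idem)
    have "E (Suc b) i j (Fop s (Suc b) i j w) c = E_diag s (Suc b) m * Fop s (Suc b) i j w (c(i := 0, j := m))"
      using 2 by (simp add: Eop_eval m_def)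
    also have "\<dots> = (F_left (Suc b) m * E_diag s (Suc b) m + (if 1 \<le> m then F_right (Suc b) m * E_low s (Suc b) m else 0)) * w (c(i := 0, j := m))"
      using 2 key[of "m - 1"] by (cases m) (simp_all add: F algebra_simps)
    also have "\<dots> = w c" unfolding c using 2 F_left_inverse[of m "Suc b"] by simp
    finally show ?thesis .
  next
    case 3
    have c: "c(i := 1, j := m) = c" using 3 by (simp add: m_def fun_upd_idem)
    have *: "E (Suc b) i j (Fop s (Suc b) i j w) c = E_low s (Suc b) (Suc m) * Fop s (Suc b) i j w (c(i := 0, j := Suc m))"
      using 3 by (simp add: Eop_eval m_def)
    show ?thesis
    proof (cases "m = b")
      case True
      then show ?thesis using F_right_inverse[of "Suc b"] c unfolding * by (simp add: F mult.commute mult.left_commute)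
    next
      case False
      then have mb: "Suc m \<le> b" using 3 by simp
      have "E (Suc b) i j (Fop s (Suc b) i j w) c
        = F_left (Suc b) (Suc m) * (E_low s (Suc b) (Suc m) * w (c(i := 0, j := Suc m))) + F_right (Suc b) (Suc m) * E_low s (Suc b) (Suc m) * w (c(i := 1, j := m))"
        unfolding * using mb by (simp add: F algebra_simps)
      also have "\<dots> = (F_left (Suc b) (Suc m) * E_diag s (Suc b) (Suc m) + F_right (Suc b) (Suc m) * E_low s (Suc b) (Suc m)) * w (c(i := 1, j := m))"
        unfolding key[OF mb, symmetric] by (simp add: algebra_simps)
      also have "\<dots> = w c" unfolding c using mb F_left_inverse[of "Suc m" "Suc b"] by simp
      finally show ?thesis .
    qed
  next
    case 4
    then show ?thesis using assms(4)[of c] by (simp add: Eop_eval)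
  qed
qed

text \<open>With x = u s^(-b) and y = u s the reflection equation contains R at the degenerate point
  on both sides. On the right it meets E and gives 0, so the unfused product w lies in the kernel
  and E F fixes it.\<close>

lemma K_fuses_of_reflects:
  assumes "reflects b" "1 \<le> b"
  shows "K_fuses b"
  unfolding K_fuses_def
proof (intro allI impI)
  fix i j :: nat and u :: complex and f assume ij: "i \<noteq> j" and z: "i \<noteq> 0" "j \<noteq> 0" and u: "u \<noteq> 0"
  define w where "w = K1 (u * s powi (- int b)) i (R (Suc 0) b (u\<^sup>2 * s powi (1 - int b)) i j (KK b (u * s) j (E (Suc b) i j f)))"
  have uu: "u * s powi (- int b) \<noteq> 0" "u * s \<noteq> 0" using u s0 by auto
  define S where "S = s powi (- int b)"
  have S: "s powi (1 - int b) = s * S" "s powi (- int (Suc b)) = inverse s * S"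
    using s0 by (simp_all add: S_def power_int_diff power_int_minus divide_inverse)
  have a1: "u * s powi (- int b) * (u * s) = u\<^sup>2 * s powi (1 - int b)"
    unfolding S S_def[symmetric] by (simp only: power2_eq_square mult_ac)
  have a2: "u * s powi (- int b) * inverse (u * s) = s powi (- int (Suc b))"
    unfolding S S_def[symmetric] using u s0 by (simp add: field_simps)
  have "E (Suc b) i j (Fop s (Suc b) i j w) = w"
  proof (rule EF_on_kernel[OF ij assms(2)])
    show "R (Suc 0) b (s powi (- int (Suc b))) i j w = (\<lambda>c. 0)"
      unfolding w_def reflectsD[OF assms(1) ij z uu, unfolded a1 a2] R_degenerate_E[OF ij assms(2)] leg_op_zero_state ..
    show "w c = 0" if "2 \<le> c i" for c
      unfolding w_def by (subst leg_op_def) (use that in simp)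
    show "w c = 0" if "b < c j" for c
      unfolding w_def by (rule leg_op_zero[OF ij[symmetric] ij[symmetric], where n = b]) (simp_all add: R_range2 ij that)
  qed
  then show "E (Suc b) i j (KK (Suc b) u j f) = w"
    unfolding w_def K_rec[OF u assms(2) ij z] Eop_reset[OF ij, where f = "KK (Suc b) u j f"] .
qed

text \<open>Splitting k over l turns K into K at y' = y s^(-b) on l and K at y s on k, joined by an
  R on l and k. The equation then follows from reflection on i and l at y', two uses of Yang-Baxter
  that carry the joining R across, and reflection on i and k at y s.\<close>

lemma reflects_step:
  assumes "reflects (Suc 0)" "reflects b" "K_fuses b" "1 \<le> b"
  shows "reflects (Suc b)"
  unfolding reflects_def
proof (intro allI impI)
  fix i k :: nat and x y :: complex and f assume ik: "i \<noteq> k" and z: "i \<noteq> 0" "k \<noteq> 0" and x: "x \<noteq> 0" and y: "y \<noteq> 0"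
  define l where "l = Suc (i + k)"
  have l: "l \<noteq> i" "l \<noteq> k" "i \<noteq> l" "k \<noteq> l" "l \<noteq> 0" by (auto simp: l_def)
  note ki = ik[symmetric]
  define y' where "y' = y * s powi (- int b)"
  have y': "y' \<noteq> 0" "y * s \<noteq> 0" using y s0 by (auto simp: y'_def)
  have nz: "x * inverse y \<noteq> 0" "x * y \<noteq> 0" "x * inverse y' \<noteq> 0" "y' * (y * s) \<noteq> 0" "x * inverse (y * s) \<noteq> 0"
    using x y y' by auto
  define S where "S = s powi (- int b)"
  have S: "S \<noteq> 0" "s powi int b = inverse S" "s powi (1 - int b) = s * S" "s powi (- 1) = inverse s" "y' = y * S"
    using s0 by (simp_all add: S_def y'_def power_int_diff power_int_minus divide_inverse)
  have a: "x * inverse y * s powi (- 1) = x * inverse (y * s)" "x * inverse y * s powi int b = x * inverse y'"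
    "x * y * s powi (- int b) = x * y'" "y\<^sup>2 * s powi (1 - int b) = y' * (y * s)" "x * y * s = x * (y * s)"
    unfolding S(2-5) S_def[symmetric] using S(1) y s0 by (simp_all add: power2_eq_square)
  have a': "x * inverse y' * (y' * (y * s)) = x * (y * s)" "x * inverse (y * s) * (y' * (y * s)) = x * y'"
    using y' inverse_cancel_inner by blast+
  \<comment> \<open>Since y enters inverted, x/y is shifted the other way and the opposite fusion is
    required.\<close>
  have fus': "E (Suc b) l k (R (Suc 0) (Suc b) (x * inverse y) i k g) = R (Suc 0) b (x * inverse (y * s)) i k (R (Suc 0) (Suc 0) (x * inverse y') i l (E (Suc b) l k g))" for g
    using R_half_fusion_opposite[OF l(2,1) ki nz(1) assms(4), of g] unfolding a by simp
  have fus: "E (Suc b) l k (R (Suc 0) (Suc b) (x * y) i k g) = R (Suc 0) (Suc 0) (x * y') i l (R (Suc 0) b (x * (y * s)) i k (E (Suc b) l k g))" for g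
    using R_half_fusion[OF l(2,1) ki nz(2) assms(4), of g] unfolding a by simp
  have fK: "E (Suc b) l k (KK (Suc b) y k g) = K1 y' l (R (Suc 0) b (y' * (y * s)) l k (KK b (y * s) k (E (Suc b) l k g)))" for g
    using K_fusesD[OF assms(3) l(2,5) z(2) y, of g] unfolding a y'_def[symmetric] .
  have cE: "E (Suc b) l k (K1 x i g) = K1 x i (E (Suc b) l k g)" for g
    by (rule leg_op_commute[OF l(1,1) ki ki])
  have c1: "R (Suc 0) b v i k (K1 y' l g) = K1 y' l (R (Suc 0) b v i k g)" for v g
    by (rule leg_op_commute[OF l(3,3,4,4)])
  have c2: "K1 x i (R (Suc 0) b v l k g) = R (Suc 0) b v l k (K1 x i g)" for v g
    by (rule leg_op_commute[OF l(3) ik l(3) ik])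
  have c3: "R (Suc 0) (Suc 0) v i l (KK b (y * s) k g) = KK b (y * s) k (R (Suc 0) (Suc 0) v i l g)" for v g
    by (rule leg_op_commute[OF ik ik l(2,2)])
  have one: "1 \<le> Suc 0" by simp
  have re1: "R (Suc 0) (Suc 0) (x * inverse y') i l (K1 x i (R (Suc 0) (Suc 0) (x * y') i l (K1 y' l g)))
     = K1 y' l (R (Suc 0) (Suc 0) (x * y') i l (K1 x i (R (Suc 0) (Suc 0) (x * inverse y') i l g)))" for g
    using reflectsD[OF assms(1) l(3) z(1) l(5) x y'(1), of g] unfolding K_mat_def fused_K.simps numeral_2_eq_2[symmetric] .
  have yb1: "R (Suc 0) (Suc 0) (x * inverse y') i l (R (Suc 0) b (x * (y * s)) i k (R (Suc 0) b (y' * (y * s)) l k g))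
     = R (Suc 0) b (y' * (y * s)) l k (R (Suc 0) b (x * (y * s)) i k (R (Suc 0) (Suc 0) (x * inverse y') i l g))" for g
    using yang_baxter[OF one assms(4) l(3) ik l(2) nz(3,4), of g] unfolding a' .
  have yb2: "R (Suc 0) b (x * inverse (y * s)) i k (R (Suc 0) (Suc 0) (x * y') i l (R (Suc 0) b (y' * (y * s)) l k g))
     = R (Suc 0) b (y' * (y * s)) l k (R (Suc 0) (Suc 0) (x * y') i l (R (Suc 0) b (x * inverse (y * s)) i k g))" for g
    using yang_baxter[OF assms(4) one ik l(3,4) nz(5,4), of g] unfolding a' R_swap[OF assms(4) l(4) nz(4)] .
  define X where "X = (\<lambda>f. R (Suc 0) (Suc b) (x * inverse y) i k (K1 x i (R (Suc 0) (Suc b) (x * y) i k (KK (Suc b) y k f))))"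
  define Y where "Y = (\<lambda>f. KK (Suc b) y k (R (Suc 0) (Suc b) (x * y) i k (K1 x i (R (Suc 0) (Suc b) (x * inverse y) i k f))))"
  have "X f = Y f"
  proof (rule Eop_cancel[OF l(2), where a = "Suc b" and X = X and Y = Y])
    show "indep l X" "indep l Y" unfolding X_def Y_def by (intro indep_leg_op_comp indep_id l)+
    show "X g c = 0" if "Suc b < c k" for g c
      unfolding X_def by (simp add: R_range2 ik that)
    show "Y g c = 0" if "Suc b < c k" for g c
      unfolding Y_def by (subst leg_op_def) (use that in simp)
    fix g
    have "E (Suc b) l k (X g) = R (Suc 0) b (x * inverse (y * s)) i k (R (Suc 0) (Suc 0) (x * inverse y') i l (K1 x i
        (R (Suc 0) (Suc 0) (x * y') i l (K1 y' l (R (Suc 0) b (x * (y * s)) i k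
        (R (Suc 0) b (y' * (y * s)) l k (KK b (y * s) k (E (Suc b) l k g))))))))"
      unfolding X_def by (simp only: fus' cE fus fK c1)
    also have "\<dots> = K1 y' l (R (Suc 0) b (x * inverse (y * s)) i k (R (Suc 0) (Suc 0) (x * y') i l
        (R (Suc 0) b (y' * (y * s)) l k (K1 x i (R (Suc 0) b (x * (y * s)) i k (KK b (y * s) k
        (R (Suc 0) (Suc 0) (x * inverse y') i l (E (Suc b) l k g))))))))"
      by (simp only: re1 c1 yb1 c2 c3)
    also have "\<dots> = K1 y' l (R (Suc 0) b (y' * (y * s)) l k (R (Suc 0) (Suc 0) (x * y') i l
        (KK b (y * s) k (R (Suc 0) b (x * (y * s)) i k (K1 x i (R (Suc 0) b (x * inverse (y * s)) i k
        (R (Suc 0) (Suc 0) (x * inverse y') i l (E (Suc b) l k g))))))))"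
      by (simp only: yb2 reflectsD[OF assms(2) ik z x y'(2)])
    also have "\<dots> = E (Suc b) l k (Y g)"
      unfolding Y_def by (simp only: fus' cE fus fK c3)
    finally show "E (Suc b) l k (X g) = E (Suc b) l k (Y g)" .
  qed simp
  then show "R (Suc 0) (Suc b) (x * inverse y) i k (K1 x i (R (Suc 0) (Suc b) (x * y) i k (KK (Suc b) y k f)))
     = KK (Suc b) y k (R (Suc 0) (Suc b) (x * y) i k (K1 x i (R (Suc 0) (Suc b) (x * inverse y) i k f)))"
    unfolding X_def Y_def .
qed

text \<open>The matrix elements of the spin-1/2 reflection equation that do not agree term by term.
  The others arise by exchanging e1 and e2, which swaps A with D and A' with D'.\<close>

lemma reflection_coef:
  fixes x y e1 e2 :: complex
  assumes "x \<noteq> 0" "y \<noteq> 0"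
  defines "a \<equiv> cfun (x * inverse y * s\<^sup>2)" and "b \<equiv> cfun (x * inverse y)"
    and "p \<equiv> cfun (x * y * s\<^sup>2)" and "r \<equiv> cfun (x * y)" and "e \<equiv> cfun (s\<^sup>2)"
    and "X \<equiv> cfun (x\<^sup>2)" and "Y \<equiv> cfun (y\<^sup>2)"
    and "A \<equiv> x * e1 + inverse x * e2" and "D \<equiv> x * e2 + inverse x * e1"
    and "A' \<equiv> y * e1 + inverse y * e2" and "D' \<equiv> y * e2 + inverse y * e1"
  shows "a * A * p * Y + a * X * e * D' = A' * p * X * e + Y * r * A * b + e * e * Y * D"
    "a * X * r * A' = A' * p * X * b + Y * r * A * e + Y * e * D * b"
    "b * A * A' + r * D * A' = r * A * D' + b * D * D'"
  unfolding a_def b_def p_def r_def e_def X_def Y_def A_def D_def A'_def D'_def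
  using assms(1,2) s0 by (simp_all add: cfun_def field_simps power2_eq_square)

lemma reflects_half: "reflects (Suc 0)"
  unfolding reflects_def
proof (intro allI impI)
  fix i j :: nat and x y :: complex and f
  assume ij: "i \<noteq> j" and x: "x \<noteq> 0" and y: "y \<noteq> 0"
  \<comment> \<open>A spectator leg, introduced so that \<open>cfg3\<close> can be used for the two
    legs i and j.\<close>
  define l where "l = Suc (i + j)"
  have l: "i \<noteq> l" "j \<noteq> l" by (auto simp: l_def)
  define a b p r e X Y where "a = cfun (x * inverse y * s\<^sup>2)" and "b = cfun (x * inverse y)"
    and "p = cfun (x * y * s\<^sup>2)" and "r = cfun (x * y)" and "e = cfun (s\<^sup>2)"
    and "X = cfun (x\<^sup>2)" and "Y = cfun (y\<^sup>2)"
  define A D A' D' where "A = x * ep + inverse x * em" and "D = x * em + inverse x * ep"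
    and "A' = y * ep + inverse y * em" and "D' = y * em + inverse y * ep"
  define k k' where "k = kp / e" and "k' = km / e"
  note defs = a_def b_def p_def r_def e_def X_def Y_def A_def D_def A'_def D'_def
  note J = reflection_coef[OF x y, of ep em, folded defs]
  note J' = reflection_coef[OF x y, of em ep, folded defs]
  have Rm: "R (Suc 0) (Suc 0) (x * inverse y) i j g (cfg3 c i j l 0 0 z) = a * g (cfg3 c i j l 0 0 z)"
      "R (Suc 0) (Suc 0) (x * inverse y) i j g (cfg3 c i j l 0 1 z) = b * g (cfg3 c i j l 0 1 z) + e * g (cfg3 c i j l 1 0 z)"
      "R (Suc 0) (Suc 0) (x * inverse y) i j g (cfg3 c i j l 1 0 z) = b * g (cfg3 c i j l 1 0 z) + e * g (cfg3 c i j l 0 1 z)"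
      "R (Suc 0) (Suc 0) (x * inverse y) i j g (cfg3 c i j l 1 1 z) = a * g (cfg3 c i j l 1 1 z)" for g c z
    unfolding Rop_half_half Lop_eval[OF ij] a_def b_def e_def
    by (simp_all add: cfg3_simps[OF ij l])
  have Rp: "R (Suc 0) (Suc 0) (x * y) i j g (cfg3 c i j l 0 0 z) = p * g (cfg3 c i j l 0 0 z)"
      "R (Suc 0) (Suc 0) (x * y) i j g (cfg3 c i j l 0 1 z) = r * g (cfg3 c i j l 0 1 z) + e * g (cfg3 c i j l 1 0 z)"
      "R (Suc 0) (Suc 0) (x * y) i j g (cfg3 c i j l 1 0 z) = r * g (cfg3 c i j l 1 0 z) + e * g (cfg3 c i j l 0 1 z)"
      "R (Suc 0) (Suc 0) (x * y) i j g (cfg3 c i j l 1 1 z) = p * g (cfg3 c i j l 1 1 z)" for g c z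
    unfolding Rop_half_half Lop_eval[OF ij] p_def r_def e_def
    by (simp_all add: cfg3_simps[OF ij l])
  have Rz: "R (Suc 0) (Suc 0) v i j g (cfg3 c i j l m n z) = 0" if "m \<ge> 2 \<or> n \<ge> 2" for v g c m n z
    unfolding Rop_half_half Lop_eval[OF ij] using that by (auto simp: cfg3_simps[OF ij l])
  have Ki: "K1 x i g (cfg3 c i j l 0 n z) = A * g (cfg3 c i j l 0 n z) + k * X * g (cfg3 c i j l 1 n z)"
      "K1 x i g (cfg3 c i j l 1 n z) = k' * X * g (cfg3 c i j l 0 n z) + D * g (cfg3 c i j l 1 n z)" for g c n z
    by (simp_all add: leg_op_def cfg3_simps[OF ij l] K_half_def mat22_def numeral_2_eq_2 A_def D_def k_def k'_def X_def e_def)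
  have Kj: "KK (Suc 0) y j g (cfg3 c i j l n 0 z) = A' * g (cfg3 c i j l n 0 z) + k * Y * g (cfg3 c i j l n 1 z)"
      "KK (Suc 0) y j g (cfg3 c i j l n 1 z) = k' * Y * g (cfg3 c i j l n 0 z) + D' * g (cfg3 c i j l n 1 z)" for g c n z
    by (simp_all add: leg_op_def cfg3_simps[OF ij l] K_mat_def K_half_def mat22_def numeral_2_eq_2 A'_def D'_def k_def k'_def Y_def e_def)
  show "R (Suc 0) (Suc 0) (x * inverse y) i j (K1 x i (R (Suc 0) (Suc 0) (x * y) i j (KK (Suc 0) y j f)))
     = KK (Suc 0) y j (R (Suc 0) (Suc 0) (x * y) i j (K1 x i (R (Suc 0) (Suc 0) (x * inverse y) i j f)))"
    (is "?lhs = ?rhs")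
  proof (rule cfg3_eqI[OF ij l])
    fix c and m n z :: nat
    let ?w = "\<lambda>m n. f (cfg3 c i j l m n z)"
    consider "m \<ge> 2 \<or> n \<ge> 2" | "m = 0" "n = 0" | "m = 0" "n = 1" | "m = 1" "n = 0" | "m = 1" "n = 1" by linarith
    then show "?lhs (cfg3 c i j l m n z) = ?rhs (cfg3 c i j l m n z)"
    proof cases
      case 1
      have "?rhs (cfg3 c i j l m n z) = 0"
      proof (cases "n \<ge> 2")
        case True
        then show ?thesis by (subst leg_op_def) (simp add: cfg3_simps[OF ij l])
      next
        case False
        then have "m \<ge> 2" using 1 by simp
        then have "R (Suc 0) (Suc 0) (x * y) i j g (cfg3 c i j l m n' z) = 0" for g n' by (simp add: Rz)
        then show ?thesis by (subst leg_op_def) (simp only: cfg3_simps[OF ij l] mult_zero_right sum.neutral_const)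
      qed
      then show ?thesis using 1 by (simp only: Rz)
    next
      case 2
      have "?lhs (cfg3 c i j l 0 0 z) = a * A * p * A' * ?w 0 0 + k * (a * A * p * Y + a * X * e * D') * ?w 0 1
          + k * (a * X * r * A') * ?w 1 0 + a * k * X * r * k * Y * ?w 1 1 + a * k * X * e * k' * Y * ?w 0 0"
        by (simp only: Rm Rp Ki Kj) (simp only: algebra_simps)
      also have "\<dots> = ?rhs (cfg3 c i j l 0 0 z)"
        unfolding J by (simp only: Rm Rp Ki Kj) (simp only: algebra_simps)
      finally show ?thesis using 2 by simp
    next
      case 3
      have "?lhs (cfg3 c i j l 0 1 z) = k' * (e * X * p * A' + b * A * r * Y + e * D * e * Y) * ?w 0 0
          + (b * A * r * D' + e * k' * X * p * k * Y + e * D * e * D') * ?w 0 1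
          + (b * A * A' + r * D * A') * e * ?w 1 0 + b * k * X * p * k' * Y * ?w 1 0
          + k * (b * A * e * Y + b * X * p * D' + e * D * r * Y) * ?w 1 1"
        by (simp only: Rm Rp Ki Kj) (simp only: algebra_simps)
      also have "\<dots> = k' * (a * A * p * Y + a * X * e * D') * ?w 0 0
          + (b * A * r * D' + e * k' * X * p * k * Y + e * D * e * D') * ?w 0 1
          + (b * A * A' + r * D * A') * e * ?w 1 0 + b * k * X * p * k' * Y * ?w 1 0
          + k * (a * X * r * D') * ?w 1 1"
        unfolding J J' by (simp only: algebra_simps)
      also have "\<dots> = ?rhs (cfg3 c i j l 0 1 z)"
        unfolding J(3) by (simp only: Rm Rp Ki Kj) (simp only: algebra_simps)
      finally show ?thesis using 3 by simp
    next
      case 4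
      have "?lhs (cfg3 c i j l 1 0 z) = k * (e * X * p * D' + b * D * r * Y + e * A * e * Y) * ?w 1 1
          + (b * D * r * A' + e * k * X * p * k' * Y + e * A * e * A') * ?w 1 0
          + (b * D * D' + r * A * D') * e * ?w 0 1 + b * k' * X * p * k * Y * ?w 0 1
          + k' * (b * D * e * Y + b * X * p * A' + e * A * r * Y) * ?w 0 0"
        by (simp only: Rm Rp Ki Kj) (simp only: algebra_simps)
      also have "\<dots> = k * (a * D * p * Y + a * X * e * A') * ?w 1 1
          + (b * D * r * A' + e * k * X * p * k' * Y + e * A * e * A') * ?w 1 0
          + (b * D * D' + r * A * D') * e * ?w 0 1 + b * k' * X * p * k * Y * ?w 0 1
          + k' * (a * X * r * A') * ?w 0 0"
        unfolding J J' by (simp only: algebra_simps)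
      also have "\<dots> = ?rhs (cfg3 c i j l 1 0 z)"
        unfolding J'(3) by (simp only: Rm Rp Ki Kj) (simp only: algebra_simps)
      finally show ?thesis using 4 by simp
    next
      case 5
      have "?lhs (cfg3 c i j l 1 1 z) = a * D * p * D' * ?w 1 1 + k' * (a * D * p * Y + a * X * e * A') * ?w 1 0
          + k' * (a * X * r * D') * ?w 0 1 + a * k' * X * r * k' * Y * ?w 0 0 + a * k' * X * e * k * Y * ?w 1 1"
        by (simp only: Rm Rp Ki Kj) (simp only: algebra_simps)
      also have "\<dots> = ?rhs (cfg3 c i j l 1 1 z)"
        unfolding J' by (simp only: Rm Rp Ki Kj) (simp only: algebra_simps)
      finally show ?thesis using 5 by simp
    qed
  qed
qed

text \<open>The induction alternates: reflection at b gives fusion of K from b to b + 1, and this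
  gives reflection at b + 1.\<close>

lemma reflects_all: "1 \<le> b \<Longrightarrow> reflects b"
proof (induction b rule: nat_induct_at_least)
  case base
  show ?case using reflects_half by simp
next
  case (Suc b)
  show ?case
    by (rule reflects_step[OF reflects_half Suc.IH K_fuses_of_reflects[OF Suc.IH Suc.hyps] Suc.hyps])
qed

lemma K_fusion:
  assumes "1 \<le> b" "i \<noteq> j" "i \<noteq> 0" "j \<noteq> 0" "u \<noteq> 0"
  shows "E (Suc b) i j (KK (Suc b) u j f) = K1 (u * s powi (- int b)) i (R (Suc 0) b (u\<^sup>2 * s powi (1 - int b)) i j
        (KK b (u * s) j (E (Suc b) i j f)))"
  by (rule K_fusesD[OF K_fuses_of_reflects[OF reflects_all[OF assms(1)] assms(1)] assms(2-5)])

end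

section \<open>Dressed K-operators\<close>

lemma Kop_range: "c j \<ge> d \<Longrightarrow> Kop d M j f c = 0"
  by (subst leg_op_def) simp

text \<open>Legs 1 to N are the sites, auxiliary legs have larger numbers, and leg 0 is reserved for
  represented algebras.\<close>

locale dressing = reflection +
  fixes spin :: "nat \<Rightarrow> nat" and v :: "nat \<Rightarrow> complex" and N :: nat
  assumes spin_pos: "\<And>n. n \<in> {1..N} \<Longrightarrow> 1 \<le> spin n" and v0: "\<And>n. n \<in> {1..N} \<Longrightarrow> v n \<noteq> 0"
begin

fun Tdesc :: "nat \<Rightarrow> nat \<Rightarrow> complex \<Rightarrow> nat \<Rightarrow> state \<Rightarrow> state" where
  "Tdesc b 0 u j f = f"
| "Tdesc b (Suc n) u j f = R (spin (Suc n)) b (u * v (Suc n)) (Suc n) j (Tdesc b n u j f)"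

fun Tasc :: "nat \<Rightarrow> nat \<Rightarrow> complex \<Rightarrow> nat \<Rightarrow> state \<Rightarrow> state" where
  "Tasc b 0 u j f = f"
| "Tasc b (Suc n) u j f = Tasc b n u j (R (spin (Suc n)) b (u * inverse (v (Suc n))) (Suc n) j f)"

definition Dressed :: "nat \<Rightarrow> complex \<Rightarrow> nat \<Rightarrow> state \<Rightarrow> state" where
  "Dressed b u j f = Tdesc b N u j (KK b u j (Tasc b N u j f))"

lemma Tdesc_commute:
  assumes "k > n" "l > n" "k \<noteq> i" "l \<noteq> i"
  shows "leg_op a b k l M (Tdesc c n u i f) = Tdesc c n u i (leg_op a b k l M f)"
  using assms
proof (induction n arbitrary: f)
  case (Suc n)
  have "leg_op a b k l M (R (spin (Suc n)) c w (Suc n) i g) = R (spin (Suc n)) c w (Suc n) i (leg_op a b k l M g)" for w g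
    using Suc.prems by (intro leg_op_commute) auto
  then show ?case using Suc by simp
qed simp

lemma Tasc_commute:
  assumes "k > n" "l > n" "k \<noteq> i" "l \<noteq> i"
  shows "leg_op a b k l M (Tasc c n u i f) = Tasc c n u i (leg_op a b k l M f)"
  using assms
proof (induction n arbitrary: f)
  case (Suc n)
  have "leg_op a b k l M (R (spin (Suc n)) c w (Suc n) i g) = R (spin (Suc n)) c w (Suc n) i (leg_op a b k l M g)" for w g
    using Suc.prems by (intro leg_op_commute) auto
  then show ?case using Suc by simp
qed simp

lemma Tdesc_fusion:
  assumes "1 \<le> b" "i \<noteq> j" "u \<noteq> 0" "i > n" "j > n" "n \<le> N"
  shows "E (Suc b) i j (Tdesc (Suc b) n u j f) = Tdesc (Suc 0) n (u * s powi (- int b)) i (Tdesc b n (u * s) j (E (Suc b) i j f))"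
  using assms(4-6)
proof (induction n)
  case (Suc n)
  have n: "Suc n \<in> {1..N}" "i \<noteq> Suc n" "j \<noteq> Suc n" using Suc.prems by auto
  have uv: "u * v (Suc n) \<noteq> 0" using assms(3) v0[OF n(1)] by simp
  have a: "u * v (Suc n) * s powi (- int b) = u * s powi (- int b) * v (Suc n)" "u * v (Suc n) * s = u * s * v (Suc n)"
    by (simp_all only: mult_ac)
  have c: "R (spin (Suc n)) b w (Suc n) j (Tdesc (Suc 0) n z i g) = Tdesc (Suc 0) n z i (R (spin (Suc n)) b w (Suc n) j g)" for w z g
    using Suc.prems assms(2) by (intro Tdesc_commute) auto
  have IH: "E (Suc b) i j (Tdesc (Suc b) n u j f) = Tdesc (Suc 0) n (u * s powi (- int b)) i (Tdesc b n (u * s) j (E (Suc b) i j f))"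
    using Suc by simp
  show ?case
    by (simp only: Tdesc.simps R_fusion_right[OF spin_pos[OF n(1)] assms(1,2) n(2,3) uv] a IH c)
qed simp

lemma Tasc_fusion:
  assumes "1 \<le> b" "i \<noteq> j" "u \<noteq> 0" "i > n" "j > n" "n \<le> N"
  shows "E (Suc b) i j (Tasc (Suc b) n u j f) = Tasc (Suc 0) n (u * s powi (- int b)) i (Tasc b n (u * s) j (E (Suc b) i j f))"
  using assms(4-6)
proof (induction n arbitrary: f)
  case (Suc n)
  have n: "Suc n \<in> {1..N}" "i \<noteq> Suc n" "j \<noteq> Suc n" using Suc.prems by auto
  have uv: "u * inverse (v (Suc n)) \<noteq> 0" using assms(3) v0[OF n(1)] by simp
  have a: "u * inverse (v (Suc n)) * s powi (- int b) = u * s powi (- int b) * inverse (v (Suc n))"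
    "u * inverse (v (Suc n)) * s = u * s * inverse (v (Suc n))"
    by (simp_all only: mult_ac)
  have c: "Tasc b n z j (R (spin (Suc n)) (Suc 0) w (Suc n) i g) = R (spin (Suc n)) (Suc 0) w (Suc n) i (Tasc b n z j g)" for w z g
    using Suc.prems assms(2) by (intro Tasc_commute[symmetric]) auto
  have IH: "E (Suc b) i j (Tasc (Suc b) n u j g) = Tasc (Suc 0) n (u * s powi (- int b)) i (Tasc b n (u * s) j (E (Suc b) i j g))" for g
    using Suc by simp
  show ?case
    by (simp only: Tasc.simps IH R_fusion_right[OF spin_pos[OF n(1)] assms(1,2) n(2,3) uv] a c)
qed simp

text \<open>Site by site this is Yang-Baxter: the arguments x/v and y v at a site multiply to x y,
  which is independent of the site. Hence the same R on i and j passes through the whole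
  chain.\<close>

lemma exchange:
  assumes "1 \<le> b" "i \<noteq> j" "x \<noteq> 0" "y \<noteq> 0" "i > n" "j > n" "n \<le> N"
  shows "Tasc (Suc 0) n x i (R (Suc 0) b (x * y) i j (Tdesc b n y j f))
    = Tdesc b n y j (R (Suc 0) b (x * y) i j (Tasc (Suc 0) n x i f))"
  using assms(5-7)
proof (induction n arbitrary: f)
  case (Suc n)
  define m where "m = Suc n"
  have n: "m \<in> {1..N}" "i \<noteq> m" "j \<noteq> m" "m \<noteq> i" "m \<noteq> j" using Suc.prems by (auto simp: m_def)
  have xv: "x * inverse (v m) \<noteq> 0" "y * v m \<noteq> 0" using assms v0[OF n(1)] by auto
  have xy: "x * inverse (v m) * (y * v m) = x * y" by (rule inverse_cancel_inner(2)[OF v0[OF n(1)]])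
  have yb: "R (spin m) (Suc 0) (x * inverse (v m)) m i (R (Suc 0) b (x * y) i j (R (spin m) b (y * v m) m j g))
     = R (spin m) b (y * v m) m j (R (Suc 0) b (x * y) i j (R (spin m) (Suc 0) (x * inverse (v m)) m i g))" for g
    using yang_baxter[OF spin_pos[OF n(1)] assms(1) n(2) assms(2) n(5) xv, of g]
    unfolding xy R_swap[OF spin_pos[OF n(1)] n(4) xv(1)] .
  have c1: "Tasc (Suc 0) n x i (R (spin m) b w m j g) = R (spin m) b w m j (Tasc (Suc 0) n x i g)" for w g
    using Suc.prems assms(2) by (intro Tasc_commute[symmetric]) (auto simp: m_def)
  have c2: "R (spin m) (Suc 0) w m i (Tdesc b n y j g) = Tdesc b n y j (R (spin m) (Suc 0) w m i g)" for w g
    using Suc.prems assms(2) by (intro Tdesc_commute) (auto simp: m_def)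
  have IH: "Tasc (Suc 0) n x i (R (Suc 0) b (x * y) i j (Tdesc b n y j g))
    = Tdesc b n y j (R (Suc 0) b (x * y) i j (Tasc (Suc 0) n x i g))" for g
    using Suc by simp
  show ?case
    by (simp only: Tasc.simps Tdesc.simps, simp only: m_def[symmetric] yb c1 c2 IH)
qed simp

lemma KK_one: "KK (Suc 0) u j = K1 u j"
  unfolding K_mat_def fused_K.simps numeral_2_eq_2 ..

text \<open>The three factors are fused separately. The R produced by fusing the scalar K sits
  between the right half of the chain for i and the left half for j, exactly where
  \<open>exchange\<close> needs it to regroup the factors into two dressed operators.\<close>

lemma Dressed_fusion:
  assumes "1 \<le> b" "i \<noteq> j" "u \<noteq> 0" "i > N" "j > N"
  shows "E (Suc b) i j (Dressed (Suc b) u j f)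
    = Dressed (Suc 0) (u * s powi (- int b)) i (R (Suc 0) b (u\<^sup>2 * s powi (1 - int b)) i j (Dressed b (u * s) j (E (Suc b) i j f)))"
proof -
  define S where "S = s powi (- int b)"
  have S: "S \<noteq> 0" "s powi (1 - int b) = s * S"
    using s0 by (simp_all add: S_def power_int_diff power_int_minus divide_inverse)
  have us: "u * S \<noteq> 0" "u * s \<noteq> 0" using S assms s0 by auto
  have a: "u\<^sup>2 * s powi (1 - int b) = u * S * (u * s)"
    unfolding S by (simp only: power2_eq_square mult_ac)
  have z: "i \<noteq> 0" "j \<noteq> 0" using assms by auto
  have ex: "Tasc (Suc 0) N (u * S) i (R (Suc 0) b (u * S * (u * s)) i j (Tdesc b N (u * s) j g))
     = Tdesc b N (u * s) j (R (Suc 0) b (u * S * (u * s)) i j (Tasc (Suc 0) N (u * S) i g))" for g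
    by (rule exchange[OF assms(1,2) us assms(4,5) order_refl])
  have c1: "K1 w i (Tdesc b N (u * s) j g) = Tdesc b N (u * s) j (K1 w i g)" for w g
    using assms by (intro Tdesc_commute) auto
  have c2: "Tasc (Suc 0) N (u * S) i (KK b w j g) = KK b w j (Tasc (Suc 0) N (u * S) i g)" for w g
    using assms by (intro Tasc_commute[symmetric]) auto
  have "E (Suc b) i j (Dressed (Suc b) u j f)
     = Tdesc (Suc 0) N (u * S) i (Tdesc b N (u * s) j (K1 (u * S) i (R (Suc 0) b (u * S * (u * s)) i j (KK b (u * s) j
        (Tasc (Suc 0) N (u * S) i (Tasc b N (u * s) j (E (Suc b) i j f)))))))"
    unfolding Dressed_def
    by (simp only: Tdesc_fusion[OF assms(1-5) order_refl] K_fusion[OF assms(1,2) z assms(3)] Tasc_fusion[OF assms(1-5) order_refl]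
      a S_def[symmetric])
  also have "\<dots> = Dressed (Suc 0) (u * S) i (R (Suc 0) b (u * S * (u * s)) i j (Dressed b (u * s) j (E (Suc b) i j f)))"
    unfolding Dressed_def KK_one by (simp only: ex c1 c2)
  finally show ?thesis unfolding a S_def .
qed

end

section \<open>The spin chain\<close>

text \<open>The quantum space index is encoded by its mixed-radix digits, site \<open>1\<close> being the least
  significant one.\<close>

definition radix :: "(nat \<Rightarrow> nat) \<Rightarrow> nat \<Rightarrow> nat" where
  "radix sp n = (\<Prod>m\<in>{1..<n}. sp m + 1)"

definition enc :: "(nat \<Rightarrow> nat) \<Rightarrow> nat \<Rightarrow> (nat \<Rightarrow> nat) \<Rightarrow> nat" where
  "enc sp n c = (\<Sum>m\<in>{1..n}. c m * radix sp m)"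

lemma radix_Suc: "1 \<le> n \<Longrightarrow> radix sp (Suc n) = radix sp n * (sp n + 1)"
  by (simp add: radix_def)

lemma radix_pos: "radix sp n > 0"
  by (simp add: radix_def)

lemma enc_less:
  assumes "\<And>m. m \<in> {1..n} \<Longrightarrow> c m \<le> sp m"
  shows "enc sp n c < radix sp (Suc n)"
  using assms
proof (induction n)
  case (Suc n)
  have "enc sp (Suc n) c = c (Suc n) * radix sp (Suc n) + enc sp n c"
    by (simp add: enc_def)
  also have "\<dots> < (sp (Suc n) + 1) * radix sp (Suc n)"
    using Suc by (intro pair_less) (auto simp: less_Suc_eq_le)
  finally show ?case by (simp add: radix_Suc mult.commute)
qed (simp add: enc_def radix_def)

lemma enc_surj:
  "enc sp n (\<lambda>m. p div radix sp m mod (sp m + 1)) = p mod radix sp (Suc n)"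
proof (induction n)
  case (Suc n)
  have "enc sp (Suc n) (\<lambda>m. p div radix sp m mod (sp m + 1))
    = p div radix sp (Suc n) mod (sp (Suc n) + 1) * radix sp (Suc n) + p mod radix sp (Suc n)"
    using Suc by (simp add: enc_def)
  also have "\<dots> = p mod (radix sp (Suc n) * (sp (Suc n) + 1))"
    unfolding mod_mult2_eq by (simp only: mult.commute)
  finally show ?case by (simp add: radix_Suc)
qed (simp add: enc_def radix_def)

lemma radix_dvd: "n \<le> m \<Longrightarrow> 1 \<le> n \<Longrightarrow> radix sp n dvd radix sp m"
  unfolding radix_def by (rule prod_dvd_prod_subset) auto

text \<open>Digits above n contribute a multiple h of the next radix and digits below n a remainder
  l, neither depending on digit n. This matches the two nested Kronecker products in
  \<open>at_site\<close>.\<close>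

lemma enc_split:
  assumes "n \<in> {1..N}" "\<And>m. m \<in> {1..N} \<Longrightarrow> c m \<le> sp m"
  shows "\<exists>h l. h < (\<Prod>m=n+1..N. sp m + 1) \<and> l < radix sp n \<and>
    (\<forall>k. enc sp N (c(n := k)) = h * ((sp n + 1) * radix sp n) + (k * radix sp n + l))"
proof -
  define l where "l = enc sp (n - 1) c"
  define T where "T = (\<Sum>m\<in>{n+1..N}. c m * radix sp m)"
  have r: "(sp n + 1) * radix sp n = radix sp (Suc n)" using assms by (simp add: radix_Suc mult.commute)
  have "radix sp (Suc n) dvd T"
    unfolding T_def by (intro dvd_sum dvd_mult radix_dvd) auto
  then obtain h where h: "T = h * radix sp (Suc n)" by (metis dvd_def mult.commute)
  have enc: "enc sp N (c(n := k)) = T + (k * radix sp n + l)" for k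
  proof -
    have "{1..N} = {1..n-1} \<union> ({n} \<union> {n+1..N})" using assms by auto
    then have "enc sp N (c(n := k)) = (\<Sum>m\<in>{1..n-1} \<union> ({n} \<union> {n+1..N}). (c(n := k)) m * radix sp m)"
      by (simp add: enc_def)
    also have "\<dots> = (\<Sum>m\<in>{1..n-1}. (c(n := k)) m * radix sp m) + ((c(n := k)) n * radix sp n + (\<Sum>m\<in>{n+1..N}. (c(n := k)) m * radix sp m))"
      using assms by (subst sum.union_disjoint; (subst sum.union_disjoint)?) auto
    also have "\<dots> = l + (k * radix sp n + T)"
      unfolding l_def T_def enc_def by (intro arg_cong2[where f = "(+)"] sum.cong) (use assms in auto)
    finally show ?thesis by simp
  qed
  have l: "l < radix sp n"
  proof -
    have "c m \<le> sp m" if "m \<in> {1..n - 1}" for m using assms that by auto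
    then have "enc sp (n - 1) c < radix sp (Suc (n - 1))" by (rule enc_less)
    then show ?thesis using assms(1) by (simp add: l_def)
  qed
  have "radix sp (Suc n) * (\<Prod>m=n+1..N. sp m + 1) = radix sp (Suc N)"
  proof -
    have "{1..<Suc N} = {1..<Suc n} \<union> {n+1..N}" using assms by auto
    then have "radix sp (Suc N) = (\<Prod>m\<in>{1..<Suc n} \<union> {n+1..N}. sp m + 1)" by (simp only: radix_def)
    also have "\<dots> = (\<Prod>m\<in>{1..<Suc n}. sp m + 1) * (\<Prod>m\<in>{n+1..N}. sp m + 1)"
      by (rule prod.union_disjoint) auto
    finally show ?thesis by (simp only: radix_def)
  qed
  moreover have "enc sp N (c(n := 0)) < radix sp (Suc N)"
    using assms by (intro enc_less) auto
  ultimately have "h * radix sp (Suc n) < (\<Prod>m=n+1..N. sp m + 1) * radix sp (Suc n)"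
    unfolding enc h by (simp add: mult.commute)
  then have "h < (\<Prod>m=n+1..N. sp m + 1)" using radix_pos[of sp "Suc n"] by simp
  then show ?thesis using l enc unfolding h r by blast
qed

section \<open>From a single quantum index to site legs\<close>

definition qkap :: "nat \<Rightarrow> complex mat \<Rightarrow> nat \<Rightarrow> nat \<Rightarrow> complex" where
  "qkap d X p r = (if p < d \<and> r < d then X $$ (p, r) else 0)"

definition inrange :: "(nat \<Rightarrow> nat) \<Rightarrow> nat \<Rightarrow> (nat \<Rightarrow> nat) \<Rightarrow> bool" where
  "inrange sp N c \<longleftrightarrow> (\<forall>m\<in>{1..N}. c m \<le> sp m)"

definition base :: "(nat \<Rightarrow> nat) \<Rightarrow> nat \<Rightarrow> (nat \<Rightarrow> nat) \<Rightarrow> nat \<Rightarrow> nat" where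
  "base sp N c x = (if x = 0 then enc sp N c else if x \<le> N then 0 else c x)"

text \<open>The dictionary between two pictures of the quantum space: f sees one index on leg 0,
  \<open>Phi\<close> of f sees the digits on legs 1 to N. Configurations with an illegal digit are
  sent to 0, in agreement with the kernels.\<close>

definition Phi :: "(nat \<Rightarrow> nat) \<Rightarrow> nat \<Rightarrow> state \<Rightarrow> state" where
  "Phi sp N f c = (if inrange sp N c then f (base sp N c) else 0)"

lemma qdim_radix: "qdim P = radix (spin2 P) (Suc (chain_len P))"
  by (simp add: qdim_def radix_def atLeastLessThanSuc_atLeastAtMost)

lemma enc_upd: "j > N \<Longrightarrow> enc sp N (c(j := k)) = enc sp N c"
  unfolding enc_def by (intro sum.cong) auto

lemma base_upd: "j > N \<Longrightarrow> base sp N (c(j := k)) = (base sp N c)(j := k)"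
  by (auto simp: base_def enc_upd fun_eq_iff)

lemma base_upd_site: "n \<in> {1..N} \<Longrightarrow> base sp N (c(n := k)) = (base sp N c)(0 := enc sp N (c(n := k)))"
  by (auto simp: base_def fun_eq_iff)

lemma at_site_sum:
  assumes "n \<in> {1..chain_len P}" "inrange (spin2 P) (chain_len P) c"
    "dim_row X = spin2 P n + 1" "dim_col X = spin2 P n + 1"
  shows "(\<Sum>r<qdim P. at_site P n X $$ (enc (spin2 P) (chain_len P) c, r) * g r)
    = (\<Sum>k<spin2 P n + 1. X $$ (c n, k) * g (enc (spin2 P) (chain_len P) (c(n := k))))"
proof -
  define H where "H = (\<Prod>m=n+1..chain_len P. spin2 P m + 1)"
  define L where "L = radix (spin2 P) n"
  define d where "d = spin2 P n + 1"
  have c: "c m \<le> spin2 P m" if "m \<in> {1..chain_len P}" for m using assms(2) that by (simp add: inrange_def)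
  obtain h l where hl: "h < H" "l < L" "\<And>k. enc (spin2 P) (chain_len P) (c(n := k)) = h * (d * L) + (k * L + l)"
    using enc_split[where c = c and sp = "spin2 P" and N = "chain_len P", OF assms(1) c] unfolding H_def L_def d_def by blast
  have cn: "c n < d" using c[OF assms(1)] by (simp add: d_def)
  have e: "enc (spin2 P) (chain_len P) c = h * (d * L) + (c n * L + l)" using hl(3)[of "c n"] by simp
  have as: "at_site P n X = kron (1\<^sub>m H) (kron X (1\<^sub>m L))"
    by (simp add: at_site_def H_def L_def radix_def)
  have dk: "dim_row (kron X (1\<^sub>m L)) = d * L" "dim_col (kron X (1\<^sub>m L)) = d * L"
    using assms(3,4) by (simp_all add: d_def)
  have dims: "dim_col (at_site P n X) = qdim P"
  proof -
    have "{1..chain_len P} = {1..<n} \<union> ({n} \<union> {n+1..chain_len P})" using assms(1) by auto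
    then have "qdim P = (\<Prod>m\<in>{1..<n} \<union> ({n} \<union> {n+1..chain_len P}). spin2 P m + 1)" by (simp only: qdim_def)
    also have "\<dots> = L * (d * H)"
      unfolding L_def H_def d_def radix_def by (subst prod.union_disjoint; (subst prod.union_disjoint)?) auto
    finally have "qdim P = L * (d * H)" .
    moreover have "dim_col (at_site P n X) = H * dim_col (kron X (1\<^sub>m L))"
      unfolding as by simp
    ultimately show ?thesis by (simp only: dk mult_ac)
  qed
  have lt: "c n * L + l < d * L" by (rule pair_less[OF cn hl(2)])
  have "(\<Sum>r<qdim P. at_site P n X $$ (enc (spin2 P) (chain_len P) c, r) * g r)
     = matvec (at_site P n X) g (h * dim_row (kron X (1\<^sub>m L)) + (c n * L + l))"
    unfolding matvec_def dims e dk ..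
  also have "\<dots> = (\<Sum>r<d * L. kron X (1\<^sub>m L) $$ (c n * L + l, r) * g (h * (d * L) + r))"
    unfolding as by (subst matvec_kron_one_left) (simp_all only: dk lt hl(1))
  also have "\<dots> = matvec (kron X (1\<^sub>m L)) (\<lambda>r. g (h * (d * L) + r)) (c n * L + l)"
    by (simp only: matvec_def dk)
  also have "\<dots> = (\<Sum>k<d. X $$ (c n, k) * g (h * (d * L) + (k * L + l)))"
    using cn hl(2) assms(3,4) by (subst matvec_kron_one_right) (simp_all add: d_def)
  finally show ?thesis unfolding hl(3) d_def .
qed

lemma qend_alg_rep: "alg_rep (qend P) (qkap (qdim P)) (qdim P)"
proof (rule alg_rep.intro)
  define d where "d = qdim P"
  have c: "carrier (qend P) = carrier_mat d d" "monoid.mult (qend P) = (*)" "one (qend P) = 1\<^sub>m d"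
     "zero (qend P) = 0\<^sub>m d d" "add (qend P) = (+)" "smult (qend P) = (\<cdot>\<^sub>m)"
    by (simp_all add: qend_def module_mat_simps d_def)
  show "abelian_monoid (qend P)"
    unfolding qend_def by (rule abelian_group.axioms(1)[OF abelian_group_mat])
  show "qkap (qdim P) (x \<otimes>\<^bsub>qend P\<^esub> y) p r = (\<Sum>t<qdim P. qkap (qdim P) x p t * qkap (qdim P) y t r)"
    if "x \<in> carrier (qend P)" "y \<in> carrier (qend P)" for x y p r
    using that unfolding c d_def[symmetric]
    by (auto simp: qkap_def scalar_prod_def atLeast0LessThan intro!: sum.cong)
qed (auto simp: qend_def module_mat_simps qkap_def)

text \<open>In the product over l the terms l < b form the factor at spin b/2 and argument u s, and
  the term l = b is the spin-1/2 factor at u s^(-b). These are the shifts of the fusion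
  recursion.\<close>

lemma c_factor_Suc:
  assumes "root_q P \<noteq> 0"
  shows "c_factor P (Suc b) u = c_factor P 1 (u * root_q P powi (- int b)) * c_factor P b (u * root_q P)"
proof -
  define s where "s = root_q P"
  have s0: "s \<noteq> 0" using assms by (simp add: s_def)
  define g where "g = (\<lambda>n x. cfun (x * inhom P n) * cfun (x * inverse (inhom P n)))"
  have l1: "u * s powi (int (Suc b) + int (spin2 P n) - 2 * int k - 2 * int l - 2)
      = u * s * s powi (int b + int (spin2 P n) - 2 * int k - 2 * int l - 2)" for n k l
    using power_int_add[of s 1 "int b + int (spin2 P n) - 2 * int k - 2 * int l - 2"] s0
    by (simp add: algebra_simps)
  have l2: "u * s powi (int (Suc b) + int (spin2 P n) - 2 * int k - 2 * int b - 2)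
      = u * s powi (- int b) * s powi (int 1 + int (spin2 P n) - 2 * int k - 2 * int 0 - 2)" for n k
  proof -
    have "s powi (- int b) * s powi (int 1 + int (spin2 P n) - 2 * int k - 2 * int 0 - 2)
      = s powi (- int b + (int 1 + int (spin2 P n) - 2 * int k - 2 * int 0 - 2))"
      by (simp only: power_int_add s0 not_False_eq_True simp_thms)
    also have "- int b + (int 1 + int (spin2 P n) - 2 * int k - 2 * int 0 - 2)
      = int (Suc b) + int (spin2 P n) - 2 * int k - 2 * int b - 2" by simp
    finally show ?thesis by (simp only: mult.assoc)
  qed
  have cf: "c_factor P b u = (\<Prod>n=1..chain_len P. \<Prod>k<spin2 P n - 1. \<Prod>l<b. g n (u * s powi (int b + int (spin2 P n) - 2 * int k - 2 * int l - 2)))" for b u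
    by (simp add: c_factor_def g_def Let_def s_def)
  have one: "(\<Prod>l<(1::nat). h l) = h 0" for h :: "nat \<Rightarrow> complex" by simp
  show ?thesis
    unfolding cf s_def[symmetric] one prod.distrib[symmetric]
    by (intro prod.cong refl, subst prod.lessThan_Suc, subst l2, simp only: l1, rule mult.commute)
qed

locale generic_chain =
  fixes P :: chain
  assumes generic: "generic_root (root_q P)"
    and spin_pos': "\<And>n. n \<in> {1..chain_len P} \<Longrightarrow> 1 \<le> spin2 P n"
    and inhom0: "\<And>n. n \<in> {1..chain_len P} \<Longrightarrow> inhom P n \<noteq> 0"

sublocale generic_chain \<subseteq> dressing "root_q P" "eps_plus P" "eps_minus P" "k_plus P" "k_minus P" "spin2 P" "inhom P" "chain_len P"
  by (intro dressing.intro reflection.intro dressing_axioms.intro generic spin_pos' inhom0)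

sublocale generic_chain \<subseteq> Q: alg_rep "qend P" "qkap (qdim P)" "qdim P"
  by (rule qend_alg_rep)

context generic_chain
begin

abbreviation "NN \<equiv> chain_len P"
abbreviation "ss \<equiv> root_q P"
abbreviation "Ph \<equiv> Phi (spin2 P) (chain_len P)"

lemma Ph_leg_op:
  assumes "i > NN" "j > NN"
  shows "Ph (leg_op a b i j M f) = leg_op a b i j M (Ph f)"
proof
  fix c
  have r: "inrange (spin2 P) NN (c(i := k, j := l)) = inrange (spin2 P) NN c" for k l
    using assms by (simp add: inrange_def)
  have b: "base (spin2 P) NN c i = c i" "base (spin2 P) NN c j = c j"
    using assms by (auto simp: base_def)
  show "Ph (leg_op a b i j M f) c = leg_op a b i j M (Ph f) c"
    using assms by (auto simp: Phi_def leg_op_def r b base_upd)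
qed

lemma Ph_upd: "i > NN \<Longrightarrow> Ph (\<lambda>c. f (c(i := k))) = (\<lambda>c. Ph f (c(i := k)))"
  by (auto simp: Phi_def inrange_def base_upd fun_eq_iff)

lemma indep_Ph: "i > NN \<Longrightarrow> indep i Ph"
  by (simp add: indep_def Ph_upd)

lemma enc_qdim: "inrange (spin2 P) NN c \<Longrightarrow> enc (spin2 P) NN c < qdim P"
  unfolding qdim_radix by (rule enc_less) (simp add: inrange_def)

text \<open>Under \<open>Phi\<close> a matrix placed at a Kronecker factor becomes an operator on
  the corresponding site leg; every other translation of chain operators rests on this.\<close>

lemma rep_site:
  assumes n: "n \<in> {1..NN}" and j: "j > NN"
    and Y: "\<And>\<alpha> \<beta>. \<alpha> < d \<Longrightarrow> \<beta> < d \<Longrightarrow> dim_row (Y \<alpha> \<beta>) = Suc (spin2 P n) \<and> dim_col (Y \<alpha> \<beta>) = Suc (spin2 P n)"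
  shows "Ph (Q.Op d j (mat d d (\<lambda>(\<alpha>, \<beta>). at_site P n (Y \<alpha> \<beta>))) f)
    = leg_op (Suc (spin2 P n)) d n j (\<lambda>m \<alpha> m' \<beta>. if m \<le> spin2 P n \<and> \<alpha> < d then Y \<alpha> \<beta> $$ (m, m') else 0) (Ph f)"
    (is "Ph ?L = ?R")
proof
  fix c
  have nj: "n \<noteq> j" "n \<noteq> 0" "j \<noteq> 0" using n j by auto
  show "Ph ?L c = ?R c"
  proof (cases "inrange (spin2 P) NN c")
    case False
    have "?R c = 0"
    proof (cases "c n \<le> spin2 P n")
      case True
      obtain m where m: "m \<in> {1..NN}" "\<not> c m \<le> spin2 P m" using False unfolding inrange_def by blast
      then have "m \<noteq> n" using True by auto
      then have "\<not> inrange (spin2 P) NN (c(n := k, j := l))" for k l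
        using j m by (auto simp: inrange_def intro!: bexI[of _ m])
      then show ?thesis by (simp add: leg_op_def Phi_def del: sum.lessThan_Suc)
    next
      case False
      then show ?thesis by (simp add: leg_op_def del: sum.lessThan_Suc)
    qed
    then show ?thesis using False by (simp add: Phi_def)
  next
    case True
    have bj: "base (spin2 P) NN c j = c j" "base (spin2 P) NN c 0 = enc (spin2 P) NN c" using j by (auto simp: base_def)
    have cn: "c n \<le> spin2 P n" using True n by (simp add: inrange_def)
    show ?thesis
    proof (cases "c j < d")
      case False
      then show ?thesis using True by (simp add: Phi_def Q.Op_out bj leg_op_def del: sum.lessThan_Suc)
    next
      case cj: True
      have "Ph ?L c = (\<Sum>k<d. \<Sum>r<qdim P. at_site P n (Y (c j) k) $$ (enc (spin2 P) NN c, r) * f ((base (spin2 P) NN c)(j := k, 0 := r)))"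
        using True cj enc_qdim[OF True] by (simp add: Phi_def Q.Op_def leg_op_def bj qkap_def)
      also have "\<dots> = (\<Sum>k<d. \<Sum>m'<spin2 P n + 1. Y (c j) k $$ (c n, m') * f ((base (spin2 P) NN c)(j := k, 0 := enc (spin2 P) NN (c(n := m')))))"
        using cj Y by (intro sum.cong refl at_site_sum[OF n True]) auto
      also have "\<dots> = (\<Sum>m'<Suc (spin2 P n). \<Sum>k<d. Y (c j) k $$ (c n, m') * f ((base (spin2 P) NN c)(j := k, 0 := enc (spin2 P) NN (c(n := m')))))"
        by (subst sum.swap) simp
      also have "\<dots> = ?R c"
      proof -
        have "Ph f (c(n := m', j := k)) = f ((base (spin2 P) NN c)(j := k, 0 := enc (spin2 P) NN (c(n := m'))))"
          if "m' \<le> spin2 P n" for m' k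
        proof -
          have "inrange (spin2 P) NN (c(n := m', j := k))" using True that j by (auto simp: inrange_def)
          moreover have "base (spin2 P) NN (c(n := m', j := k)) = (base (spin2 P) NN c)(j := k, 0 := enc (spin2 P) NN (c(n := m')))"
            by (simp only: base_upd[OF j] base_upd_site[OF n] fun_upd_twist[OF nj(3)[symmetric]])
          ultimately show ?thesis by (simp add: Phi_def)
        qed
        then show ?thesis using cj cn by (simp add: leg_op_def less_Suc_eq_le del: sum.lessThan_Suc)
      qed
      finally show ?thesis .
    qed
  qed
qed

lemma rep_R_site:
  assumes n: "n \<in> {1..NN}" and j: "j > NN"
  shows "Ph (Q.Op (Suc b) j (R_site P b n u) f) = R (spin2 P n) b u n j (Ph f)"
proof -
  define Y where "Y = (\<lambda>\<alpha> \<beta>. mat (spin2 P n + 1) (spin2 P n + 1)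
        (\<lambda>(m, m'). R_mat ss (spin2 P n) b u $$ (m * (b + 1) + \<alpha>, m' * (b + 1) + \<beta>)))"
  have "R_site P b n u = mat (Suc b) (Suc b) (\<lambda>(\<alpha>, \<beta>). at_site P n (Y \<alpha> \<beta>))"
    by (simp add: R_site_def Y_def)
  then have "Ph (Q.Op (Suc b) j (R_site P b n u) f)
    = leg_op (Suc (spin2 P n)) (Suc b) n j (\<lambda>m \<alpha> m' \<beta>. if m \<le> spin2 P n \<and> \<alpha> < Suc b then Y \<alpha> \<beta> $$ (m, m') else 0) (Ph f)"
    using rep_site[OF n j, of "Suc b" Y] by (simp add: Y_def)
  also have "leg_op (Suc (spin2 P n)) (Suc b) n j (\<lambda>m \<alpha> m' \<beta>. if m \<le> spin2 P n \<and> \<alpha> < Suc b then Y \<alpha> \<beta> $$ (m, m') else 0)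
     = R (spin2 P n) b u n j"
    by (rule leg_op_cong) (simp add: R_ker_def Y_def)
  finally show ?thesis .
qed

lemma rep_L_op:
  assumes n: "n \<in> {1..NN}" and j: "j > NN"
  shows "Ph (Q.Op 2 j (L_op P n u) f) = Lop ss (spin2 P n) u j n (Ph f)"
proof -
  define a where "a = spin2 P n"
  define Y where "Y = (\<lambda>\<alpha> \<beta>. if \<alpha> = (0::nat) then
      (if \<beta> = (0::nat) then (u * ss) \<cdot>\<^sub>m qexp ss (spin_3 a) - (inverse u * inverse ss) \<cdot>\<^sub>m qexp ss (- spin_3 a)
       else cfun (q_of P) \<cdot>\<^sub>m spin_minus ss a)
     else (if \<beta> = 0 then cfun (q_of P) \<cdot>\<^sub>m spin_plus ss a
       else (u * ss) \<cdot>\<^sub>m qexp ss (- spin_3 a) - (inverse u * inverse ss) \<cdot>\<^sub>m qexp ss (spin_3 a)))"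
  have L: "L_op P n u = mat 2 2 (\<lambda>(\<alpha>, \<beta>). at_site P n (Y \<alpha> \<beta>))"
    by (rule eq_matI) (auto simp: L_op_def Let_def mat22_def Y_def a_def)
  have dims: "dim_row (spin_minus ss a) = Suc a" "dim_col (spin_minus ss a) = Suc a"
     "dim_row (spin_plus ss a) = Suc a" "dim_col (spin_plus ss a) = Suc a"
     "dim_row (spin_3 a) = Suc a" "dim_col (spin_3 a) = Suc a"
    by (simp_all add: spin_minus_def spin_plus_def spin_3_def mat1_def)
  have qd: "dim_row (qexp s' M) = dim_row M" "dim_col (qexp s' M) = dim_row M" for s' M
    by (simp_all add: qexp_def)
  have Y: "Y \<alpha> \<beta> $$ (m, m') = L_ker ss a u \<alpha> m \<beta> m'" if "\<alpha> < 2" "\<beta> < 2" "m \<le> a" "m' \<le> a" for \<alpha> \<beta> m m'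
  proof -
    have e: "ss powi (1 + int a - 2 * int m) = ss * ss powi (int a - 2 * int m)"
      "ss powi (1 - int a + 2 * int m) = ss * ss powi (2 * int m - int a)"
      using power_int_add[of ss 1 "int a - 2 * int m"] power_int_add[of ss 1 "2 * int m - int a"] s0
      by (simp_all add: algebra_simps)
    have i: "inverse (ss powi (int a - 2 * int m)) = ss powi (2 * int m - int a)"
      "inverse (ss powi (2 * int m - int a)) = ss powi (int a - 2 * int m)"
      by (simp_all add: power_int_minus[symmetric])
    have s3: "spin_3 a $$ (m, m) = int a - 2 * int m" using that by (simp add: spin_3_def mat1_def)
    have sm: "spin_minus ss a $$ (x, y) = (if x = Suc y then ladder ss a x else 0)"
      "spin_plus ss a $$ (x, y) = (if y = Suc x then ladder ss a y else 0)" if "x \<le> a" "y \<le> a" for x y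
      using that by (auto simp: spin_minus_def spin_plus_def mat1_def ladder_def algebra_simps)
    show ?thesis
      using that less_2_cases[OF that(1)] less_2_cases[OF that(2)]
      by (auto simp: Y_def L_ker_def dims qd qexp_def s3 sm q_of_def cfun_def e i inverse_mult_distrib)
  qed
  have "Ph (Q.Op 2 j (L_op P n u) f)
    = leg_op (Suc a) 2 n j (\<lambda>m \<alpha> m' \<beta>. if m \<le> a \<and> \<alpha> < 2 then Y \<alpha> \<beta> $$ (m, m') else 0) (Ph f)"
    unfolding L a_def by (rule rep_site[OF n j]) (auto simp: Y_def dims qd a_def[symmetric])
  also have "leg_op (Suc a) 2 n j (\<lambda>m \<alpha> m' \<beta>. if m \<le> a \<and> \<alpha> < 2 then Y \<alpha> \<beta> $$ (m, m') else 0)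
     = leg_op (Suc a) 2 n j (\<lambda>m \<alpha> m' \<beta>. L_ker ss a u \<alpha> m \<beta> m')"
    by (rule leg_op_cong) (auto simp: Y L_ker_def)
  also have "\<dots> = Lop ss a u j n"
    using n j leg_op_swap[of n j "Suc a" 2 "\<lambda>m \<alpha> m' \<beta>. L_ker ss a u \<alpha> m \<beta> m'"] by auto
  finally show ?thesis unfolding a_def .
qed

lemma rep_scal:
  assumes j: "j > NN" and M: "dim_row M = d" "dim_col M = d"
  shows "Ph (Q.Op d j (scal_mat (qend P) M) f) = Kop d M j (Ph f)"
proof
  fix c
  have bj: "base (spin2 P) NN c j = c j" "base (spin2 P) NN c 0 = enc (spin2 P) NN c" using j by (auto simp: base_def)
  have b: "(base (spin2 P) NN c)(j := k, 0 := enc (spin2 P) NN c) = base (spin2 P) NN (c(j := k))" for k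
    unfolding base_upd[OF j] using j by (auto simp: base_def fun_eq_iff)
  have r: "inrange (spin2 P) NN (c(j := k)) = inrange (spin2 P) NN c" for k
    using j by (simp add: inrange_def)
  have cm: "Q.cmat d d (scal_mat (qend P) M)" using Q.cmat_scal[of M] M by simp
  show "Ph (Q.Op d j (scal_mat (qend P) M) f) c = Kop d M j (Ph f) c"
  proof (cases "inrange (spin2 P) NN c \<and> c j < d")
    case True
    have "Ph (Q.Op d j (scal_mat (qend P) M) f) c = Q.avec (scal_mat (qend P) M) (\<lambda>k r. f ((base (spin2 P) NN c)(j := k, 0 := r))) (c j) (enc (spin2 P) NN c)"
      using True Q.Op_avec[OF cm, of j "base (spin2 P) NN c"] j by (simp add: Phi_def bj)
    also have "\<dots> = (\<Sum>k<d. M $$ (c j, k) * f (base (spin2 P) NN (c(j := k))))"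
      using True M enc_qdim by (subst Q.avec_scal) (simp_all add: b)
    finally show ?thesis using True by (simp add: leg_op_def Phi_def r)
  next
    case False
    then show ?thesis by (auto simp: leg_op_def Phi_def r Q.Op_out bj)
  qed
qed

lemma Op_one: "Q.Op d j (mat_one (qend P) d) = Q.Op d j (scal_mat (qend P) (1\<^sub>m d))"
  unfolding Q.Op_def by (rule leg_op_cong) (simp add: mat_one_def scal_mat_def Q.kap_one Q.kap_zero Q.kap_scalar)

lemma rep_one:
  assumes "j > NN"
  shows "Ph (Q.Op d j (mat_one (qend P) d) f) = Kop d (1\<^sub>m d) j (Ph f)"
  unfolding Op_one using assms by (intro rep_scal) auto

text \<open>The unit matrix acts as the projection onto legal indices, not as the identity on
  states. These projections occur at the ends of the monodromy products and are absorbed by K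
  through the next two lemmas.\<close>

lemma Kop_one: "Kop d (1\<^sub>m d) j f c = (if c j < d then f c else 0)"
  by (simp add: leg_op_def sum_single_mult)

lemma Kop_one_left: "Kop d (1\<^sub>m d) j (Kop d M j f) = Kop d M j f"
  by (rule ext) (auto simp: Kop_one Kop_range)

lemma Kop_one_right: "Kop d M j (Kop d (1\<^sub>m d) j f) = Kop d M j f"
  unfolding leg_op_def[of _ _ _ _ "\<lambda>m _ _ k. if m < d then M $$ (m, k) else 0"] Kop_one
  by (intro ext sum.cong refl) simp

lemma at_site_dims:
  assumes "n \<in> {1..NN}" "dim_row X = spin2 P n + 1" "dim_col X = spin2 P n + 1"
  shows "at_site P n X \<in> carrier (qend P)"
proof -
  have "{1..NN} = {1..<n} \<union> ({n} \<union> {n+1..NN})" using assms(1) by auto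
  then have "qdim P = (\<Prod>m\<in>{1..<n} \<union> ({n} \<union> {n+1..NN}). spin2 P m + 1)" by (simp only: qdim_def)
  also have "\<dots> = (\<Prod>m\<in>{1..<n}. spin2 P m + 1) * ((spin2 P n + 1) * (\<Prod>m=n+1..NN. spin2 P m + 1))"
    by (subst prod.union_disjoint; (subst prod.union_disjoint)?) auto
  finally show ?thesis
    unfolding qend_def module_mat_simps at_site_def using assms(2,3)
    by (intro carrier_matI) (simp_all only: kron_dims index_one_mat mult_ac)
qed

lemma cmat_R_site: "n \<in> {1..NN} \<Longrightarrow> Q.cmat (Suc b) (Suc b) (R_site P b n u)"
  by (auto simp: Q.cmat_def R_site_def intro!: at_site_dims)

lemma cmat_L_op: "n \<in> {1..NN} \<Longrightarrow> Q.cmat 2 2 (L_op P n u)"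
  by (auto simp: Q.cmat_def L_op_def Let_def mat22_def spin_minus_def spin_plus_def spin_3_def mat1_def qexp_def intro!: at_site_dims)

lemma cmat_prod_desc: "(\<And>m. m \<in> {1..n} \<Longrightarrow> Q.cmat d d (g m)) \<Longrightarrow> Q.cmat d d (prod_desc (qend P) d g n)"
  by (induction n) (auto intro!: Q.cmat_one Q.cmat_mult[of d d])

lemma cmat_prod_asc: "(\<And>m. m \<in> {1..n} \<Longrightarrow> Q.cmat d d (g m)) \<Longrightarrow> Q.cmat d d (prod_asc (qend P) d g n)"
  by (induction n) (auto intro!: Q.cmat_one Q.cmat_mult[of d d])

lemma rep_T_desc:
  assumes "n \<le> NN" "j > NN"
  shows "Ph (Q.Op (Suc b) j (prod_desc (qend P) (Suc b) (\<lambda>n. R_site P b n (u * inhom P n)) n) f)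
    = Tdesc b n u j (Kop (Suc b) (1\<^sub>m (Suc b)) j (Ph f))"
  using assms(1)
proof (induction n)
  case (Suc n)
  have "Q.cmat (Suc b) (Suc b) (prod_desc (qend P) (Suc b) (\<lambda>n. R_site P b n (u * inhom P n)) n)"
    using Suc by (intro cmat_prod_desc cmat_R_site) auto
  then have "Q.Op (Suc b) j (prod_desc (qend P) (Suc b) (\<lambda>n. R_site P b n (u * inhom P n)) (Suc n)) f
     = Q.Op (Suc b) j (R_site P b (Suc n) (u * inhom P (Suc n))) (Q.Op (Suc b) j (prod_desc (qend P) (Suc b) (\<lambda>n. R_site P b n (u * inhom P n)) n) f)"
    unfolding prod_desc.simps using Suc assms by (intro Q.Op_mult cmat_R_site) auto
  then show ?case using Suc assms by (simp add: rep_R_site)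
qed (use assms rep_one in simp)

lemma rep_T_asc:
  assumes "n \<le> NN" "j > NN"
  shows "Ph (Q.Op (Suc b) j (prod_asc (qend P) (Suc b) (\<lambda>n. R_site P b n (u * inverse (inhom P n))) n) f)
    = Kop (Suc b) (1\<^sub>m (Suc b)) j (Tasc b n u j (Ph f))"
  using assms(1)
proof (induction n arbitrary: f)
  case (Suc n)
  have "Q.cmat (Suc b) (Suc b) (prod_asc (qend P) (Suc b) (\<lambda>n. R_site P b n (u * inverse (inhom P n))) n)"
    using Suc by (intro cmat_prod_asc cmat_R_site) auto
  then have "Q.Op (Suc b) j (prod_asc (qend P) (Suc b) (\<lambda>n. R_site P b n (u * inverse (inhom P n))) (Suc n)) f
     = Q.Op (Suc b) j (prod_asc (qend P) (Suc b) (\<lambda>n. R_site P b n (u * inverse (inhom P n))) n) (Q.Op (Suc b) j (R_site P b (Suc n) (u * inverse (inhom P (Suc n)))) f)"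
    unfolding prod_asc.simps using Suc assms by (intro Q.Op_mult cmat_R_site) auto
  then show ?case using Suc assms by (simp add: rep_R_site)
qed (use assms rep_one in simp)

text \<open>The monodromy is built from R with the site first, the dressed K from L with the
  auxiliary space first. The swap relates them, and the prefactor is the only difference.\<close>

lemma R_as_L:
  assumes "m \<in> {1..NN}" "j > NN" "w \<noteq> 0"
  shows "R (spin2 P m) (Suc 0) w m j f = (\<lambda>c. R_pref ss (spin2 P m) w * Lop ss (spin2 P m) w j m f c)"
proof -
  have mj: "m \<noteq> j" using assms by auto
  show ?thesis
    by (simp only: R_swap[OF spin_pos'[OF assms(1)] mj assms(3)] Rop_half[OF spin_pos'[OF assms(1)]])
qed

lemma Tasc_scale: "Tasc b n u j (\<lambda>c. x * f c) = (\<lambda>c. x * Tasc b n u j f c)"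
  by (induction n arbitrary: f) (simp_all only: Tasc.simps leg_op_scale)

lemma rep_L_desc:
  assumes "n \<le> NN" "j > NN" "u \<noteq> 0"
  shows "(\<lambda>c. (\<Prod>m=1..n. R_pref ss (spin2 P m) (u * inhom P m)) *
      Ph (Q.Op 2 j (prod_desc (qend P) 2 (\<lambda>n. L_op P n (u * inhom P n)) n) f) c)
    = Tdesc (Suc 0) n u j (Kop 2 (1\<^sub>m 2) j (Ph f))"
  using assms(1)
proof (induction n)
  case 0
  show ?case using rep_one[OF assms(2), of 2 f] by simp
next
  case (Suc n)
  have n: "Suc n \<in> {1..NN}" using Suc by simp
  have w: "u * inhom P (Suc n) \<noteq> 0" using inhom0[OF n] assms by simp
  let ?g = "Ph (Q.Op 2 j (prod_desc (qend P) 2 (\<lambda>n. L_op P n (u * inhom P n)) n) f)"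
  have "Q.cmat 2 2 (prod_desc (qend P) 2 (\<lambda>n. L_op P n (u * inhom P n)) n)"
    using Suc by (intro cmat_prod_desc cmat_L_op) auto
  then have "Q.Op 2 j (prod_desc (qend P) 2 (\<lambda>n. L_op P n (u * inhom P n)) (Suc n)) f
     = Q.Op 2 j (L_op P (Suc n) (u * inhom P (Suc n))) (Q.Op 2 j (prod_desc (qend P) 2 (\<lambda>n. L_op P n (u * inhom P n)) n) f)"
    unfolding prod_desc.simps using n assms by (intro Q.Op_mult cmat_L_op) auto
  then have e: "Ph (Q.Op 2 j (prod_desc (qend P) 2 (\<lambda>n. L_op P n (u * inhom P n)) (Suc n)) f)
     = Lop ss (spin2 P (Suc n)) (u * inhom P (Suc n)) j (Suc n) ?g"
    by (simp add: rep_L_op[OF n assms(2)])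
  have IH: "Tdesc (Suc 0) n u j (Kop 2 (1\<^sub>m 2) j (Ph f)) = (\<lambda>c. (\<Prod>m=1..n. R_pref ss (spin2 P m) (u * inhom P m)) * ?g c)"
    using Suc by simp
  show ?case
    unfolding e Tdesc.simps IH R_as_L[OF n assms(2) w] leg_op_scale by (simp add: mult_ac)
qed

lemma rep_L_asc:
  assumes "n \<le> NN" "j > NN" "u \<noteq> 0"
  shows "(\<lambda>c. (\<Prod>m=1..n. R_pref ss (spin2 P m) (u * inverse (inhom P m))) *
      Ph (Q.Op 2 j (prod_asc (qend P) 2 (\<lambda>n. L_op P n (u * inverse (inhom P n))) n) f) c)
    = Kop 2 (1\<^sub>m 2) j (Tasc (Suc 0) n u j (Ph f))"
  using assms(1)
proof (induction n arbitrary: f)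
  case 0
  show ?case using rep_one[OF assms(2), of 2 f] by simp
next
  case (Suc n)
  have n: "Suc n \<in> {1..NN}" using Suc by simp
  have w: "u * inverse (inhom P (Suc n)) \<noteq> 0" using inhom0[OF n] assms by simp
  let ?L = "L_op P (Suc n) (u * inverse (inhom P (Suc n)))"
  have "Q.cmat 2 2 (prod_asc (qend P) 2 (\<lambda>n. L_op P n (u * inverse (inhom P n))) n)"
    using Suc by (intro cmat_prod_asc cmat_L_op) auto
  then have e: "Q.Op 2 j (prod_asc (qend P) 2 (\<lambda>n. L_op P n (u * inverse (inhom P n))) (Suc n)) f
     = Q.Op 2 j (prod_asc (qend P) 2 (\<lambda>n. L_op P n (u * inverse (inhom P n))) n) (Q.Op 2 j ?L f)"
    unfolding prod_asc.simps using n assms by (intro Q.Op_mult cmat_L_op) auto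
  have IH: "(\<lambda>c. (\<Prod>m=1..n. R_pref ss (spin2 P m) (u * inverse (inhom P m))) *
      Ph (Q.Op 2 j (prod_asc (qend P) 2 (\<lambda>n. L_op P n (u * inverse (inhom P n))) n) (Q.Op 2 j ?L f)) c)
    = Kop 2 (1\<^sub>m 2) j (Tasc (Suc 0) n u j (Lop ss (spin2 P (Suc n)) (u * inverse (inhom P (Suc n))) j (Suc n) (Ph f)))"
    using Suc by (simp add: rep_L_op[OF n assms(2)])
  have "Kop 2 (1\<^sub>m 2) j (Tasc (Suc 0) (Suc n) u j (Ph f))
    = (\<lambda>c. R_pref ss (spin2 P (Suc n)) (u * inverse (inhom P (Suc n))) *
        Kop 2 (1\<^sub>m 2) j (Tasc (Suc 0) n u j (Lop ss (spin2 P (Suc n)) (u * inverse (inhom P (Suc n))) j (Suc n) (Ph f))) c)"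
    unfolding Tasc.simps R_as_L[OF n assms(2) w] Tasc_scale leg_op_scale ..
  then show ?case unfolding e IH[symmetric] by (simp add: mult_ac)
qed

text \<open>At auxiliary spin 1/2 the scalar consists exactly of the prefactors that separate the
  site R-operators from the L-operators.\<close>

lemma c_factor_one:
  "c_factor P 1 u = (\<Prod>m=1..NN. R_pref ss (spin2 P m) (u * inhom P m)) * (\<Prod>m=1..NN. R_pref ss (spin2 P m) (u * inverse (inhom P m)))"
proof -
  have "int 1 + int (spin2 P m) - 2 * int k - 2 * int 0 - 2 = int (spin2 P m) - 1 - 2 * int k" for m k by simp
  then show ?thesis
    by (simp add: c_factor_def R_pref_def Let_def prod.distrib algebra_simps)
qed

lemma cmat_K_half_scal: "Q.cmat 2 2 (scal_mat (qend P) (K_half ss (eps_plus P) (eps_minus P) (k_plus P) (k_minus P) u))"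
  using Q.cmat_scal[of "K_half ss (eps_plus P) (eps_minus P) (k_plus P) (k_minus P) u"]
  by (simp add: K_half_def mat22_def)

lemma rep_dressed_K:
  assumes "j > NN" "u \<noteq> 0"
  shows "(\<lambda>c. c_factor P 1 u * Ph (Q.Op 2 j (dressed_K P u) f) c) = Dressed (Suc 0) u j (Ph f)"
proof -
  define K where "K = K_half ss (eps_plus P) (eps_minus P) (k_plus P) (k_minus P) u"
  define D where "D = prod_desc (qend P) 2 (\<lambda>n. L_op P n (u * inhom P n)) NN"
  define A where "A = prod_asc (qend P) 2 (\<lambda>n. L_op P n (u * inverse (inhom P n))) NN"
  have j: "j \<noteq> 0" using assms by simp
  have cK: "Q.cmat 2 2 (scal_mat (qend P) K)" unfolding K_def by (rule cmat_K_half_scal)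
  have cD: "Q.cmat 2 2 D" unfolding D_def by (intro cmat_prod_desc cmat_L_op)
  have cA: "Q.cmat 2 2 A" unfolding A_def by (intro cmat_prod_asc cmat_L_op)
  have dK: "dim_row K = 2" "dim_col K = 2" by (simp_all add: K_def K_half_def mat22_def)
  have op: "Q.Op 2 j (dressed_K P u) f = Q.Op 2 j D (Q.Op 2 j (scal_mat (qend P) K) (Q.Op 2 j A f))"
    unfolding dressed_K_def D_def[symmetric] A_def[symmetric] K_def[symmetric]
    by (simp only: Q.Op_mult[OF Q.cmat_mult[OF cD cK] cA j] Q.Op_mult[OF cD cK j])
  define pd pa where "pd = (\<Prod>m=1..NN. R_pref ss (spin2 P m) (u * inhom P m))"
    and "pa = (\<Prod>m=1..NN. R_pref ss (spin2 P m) (u * inverse (inhom P m)))"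
  have d: "(\<lambda>c. pd * Ph (Q.Op 2 j D g) c) = Tdesc (Suc 0) NN u j (Kop 2 (1\<^sub>m 2) j (Ph g))" for g
    unfolding D_def pd_def by (rule rep_L_desc[OF order_refl assms])
  have a: "(\<lambda>c. pa * Ph (Q.Op 2 j A g) c) = Kop 2 (1\<^sub>m 2) j (Tasc (Suc 0) NN u j (Ph g))" for g
    unfolding A_def pa_def by (rule rep_L_asc[OF order_refl assms])
  have ts: "Tdesc (Suc 0) n u j (\<lambda>c. x * h c) = (\<lambda>c. x * Tdesc (Suc 0) n u j h c)" for n x h
    by (induction n) (simp_all only: Tdesc.simps leg_op_scale)
  have "Dressed (Suc 0) u j (Ph f) = Tdesc (Suc 0) NN u j (Kop 2 (1\<^sub>m 2) j (Kop 2 K j (Kop 2 (1\<^sub>m 2) j (Tasc (Suc 0) NN u j (Ph f)))))"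
    unfolding Dressed_def KK_one Kop_one_left Kop_one_right K_def ..
  also have "\<dots> = (\<lambda>c. pa * Tdesc (Suc 0) NN u j (Kop 2 (1\<^sub>m 2) j (Kop 2 K j (Ph (Q.Op 2 j A f)))) c)"
    unfolding a[symmetric] leg_op_scale ts ..
  also have "\<dots> = (\<lambda>c. pa * (pd * Ph (Q.Op 2 j D (Q.Op 2 j (scal_mat (qend P) K) (Q.Op 2 j A f))) c))"
    unfolding rep_scal[OF assms(1) dK, symmetric] d[symmetric] ..
  finally show ?thesis
    unfolding op c_factor_one pd_def[symmetric] pa_def[symmetric] by (simp only: mult_ac)
qed

lemma cmat_K_mat: "u \<noteq> 0 \<Longrightarrow> cplx.cmat (Suc b) (Suc b) (K_mat ss e1 e2 k1 k2 b u)"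
  unfolding K_mat_def
  by (rule cplx.fused_K_cmat[OF _ s0]) (auto simp: cplx.cmat_def K_half_def mat22_def complex_alg_carrier)

lemma cmat_T_mono: "Q.cmat (Suc b) (Suc b) (T_mono P b u)"
  unfolding T_mono_def Suc_eq_plus1[symmetric] by (intro cmat_prod_desc cmat_R_site)

lemma cmat_T_mono_hat: "Q.cmat (Suc b) (Suc b) (T_mono_hat P b u)"
  unfolding T_mono_hat_def Suc_eq_plus1[symmetric] by (intro cmat_prod_asc cmat_R_site)

lemma cmat_scal_K_mat: "u \<noteq> 0 \<Longrightarrow> Q.cmat (Suc b) (Suc b) (scal_mat (qend P) (K_mat ss e1 e2 k1 k2 b u))"
  using Q.cmat_scal[of "K_mat ss e1 e2 k1 k2 b u"] cmat_K_mat[of u b e1 e2 k1 k2]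
  by (simp add: cplx.cmat_def)

lemma rep_transfer:
  assumes "j > NN" "u \<noteq> 0"
  shows "Ph (Q.Op (Suc b) j (T_mono P b u \<star>\<^bsub>qend P\<^esub> scal_mat (qend P) (K_mat ss (eps_plus P) (eps_minus P) (k_plus P) (k_minus P) b u)
      \<star>\<^bsub>qend P\<^esub> T_mono_hat P b u) f) = Dressed b u j (Ph f)"
proof -
  define K where "K = K_mat ss (eps_plus P) (eps_minus P) (k_plus P) (k_minus P) b u"
  have j: "j \<noteq> 0" using assms by simp
  have cK: "Q.cmat (Suc b) (Suc b) (scal_mat (qend P) K)" unfolding K_def by (rule cmat_scal_K_mat[OF assms(2)])
  have dK: "dim_row K = Suc b" "dim_col K = Suc b"
    unfolding K_def using cmat_K_mat[OF assms(2)] by (simp_all add: cplx.cmat_def)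
  have d: "Ph (Q.Op (Suc b) j (T_mono P b u) f) = Tdesc b NN u j (Kop (Suc b) (1\<^sub>m (Suc b)) j (Ph f))" for f
    unfolding T_mono_def Suc_eq_plus1[symmetric] by (rule rep_T_desc[OF order_refl assms(1)])
  have a: "Ph (Q.Op (Suc b) j (T_mono_hat P b u) f) = Kop (Suc b) (1\<^sub>m (Suc b)) j (Tasc b NN u j (Ph f))" for f
    unfolding T_mono_hat_def Suc_eq_plus1[symmetric] by (rule rep_T_asc[OF order_refl assms(1)])
  show ?thesis
    unfolding K_def[symmetric] Q.Op_mult[OF Q.cmat_mult[OF cmat_T_mono cK] cmat_T_mono_hat j] Q.Op_mult[OF cmat_T_mono cK j]
      d rep_scal[OF assms(1) dK] a Kop_one_left Kop_one_right Dressed_def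
    by (simp only: K_def)
qed

end

section \<open>The truncated algebra and its representation\<close>

lemma ring_transfer:
  fixes R :: "('a, 'b) ring_scheme" and S :: "('a, 'c) ring_scheme"
  assumes "ring R" "carrier S = carrier R" "monoid.mult S = monoid.mult R" "one S = one R" "zero S = zero R" "add S = add R"
  shows "ring S"
proof -
  interpret R: ring R by fact
  show ?thesis
  proof (intro ringI abelian_groupI monoidI)
    fix x assume "x \<in> carrier S"
    then show "\<exists>y\<in>carrier S. y \<oplus>\<^bsub>S\<^esub> x = \<zero>\<^bsub>S\<^esub>"
      using R.l_neg[of x] R.a_inv_closed[of x] by (auto simp: assms)
  qed (auto simp: assms R.a_ac R.m_assoc R.l_distr R.r_distr)
qed

text \<open>A form of the algebra axioms that passes to quotients: scalars act as left
  multiplication by fixed elements, so on cosets they do not depend on the representative.\<close>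

definition scalar_ring :: "(complex, 'a) module \<Rightarrow> bool" where
  "scalar_ring A \<longleftrightarrow> ring A \<and> (\<forall>c. \<exists>e\<in>carrier A. \<forall>x\<in>carrier A. c \<odot>\<^bsub>A\<^esub> x = e \<otimes>\<^bsub>A\<^esub> x)"

lemma scalar_ring_quot:
  assumes "scalar_ring A" "S \<subseteq> carrier A"
  shows "scalar_ring (alg_quot A S)"
    and "x \<in> carrier A \<Longrightarrow> quot_class A S x \<in> carrier (alg_quot A S)"
proof -
  interpret ring A using assms(1) by (simp add: scalar_ring_def)
  define I where "I = Idl\<^bsub>A\<^esub> S"
  interpret I: ideal I A unfolding I_def by (rule genideal_ideal[OF assms(2)])
  define B where "B = alg_quot A S"
  have B: "carrier B = carrier (A Quot I)" "monoid.mult B = monoid.mult (A Quot I)" "one B = one (A Quot I)"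
    "zero B = zero (A Quot I)" "add B = add (A Quot I)"
    "smult B = (\<lambda>c X. \<Union>x\<in>X. I +>\<^bsub>A\<^esub> (c \<odot>\<^bsub>A\<^esub> x))"
    by (simp_all add: B_def alg_quot_def I_def Let_def)
  have cB: "carrier B = a_rcosets\<^bsub>A\<^esub> I" by (simp add: B FactRing_def)
  have mB: "(I +>\<^bsub>A\<^esub> x) \<otimes>\<^bsub>B\<^esub> (I +>\<^bsub>A\<^esub> y) = I +>\<^bsub>A\<^esub> (x \<otimes>\<^bsub>A\<^esub> y)" if "x \<in> carrier A" "y \<in> carrier A" for x y
    using that by (simp add: B FactRing_def I.rcoset_mult_add)
  have cl: "I +>\<^bsub>A\<^esub> x \<in> carrier B" if "x \<in> carrier A" for x
    unfolding cB using that by (intro a_rcosetsI I.a_subset)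
  have "ring B" by (rule ring_transfer[OF I.quotient_is_ring B(1-5)])
  moreover have "\<exists>e\<in>carrier B. \<forall>X\<in>carrier B. c \<odot>\<^bsub>B\<^esub> X = e \<otimes>\<^bsub>B\<^esub> X" for c
  proof -
    obtain e where e: "e \<in> carrier A" "\<And>x. x \<in> carrier A \<Longrightarrow> c \<odot>\<^bsub>A\<^esub> x = e \<otimes>\<^bsub>A\<^esub> x"
      using assms(1) unfolding scalar_ring_def by blast
    show ?thesis
    proof (intro bexI[OF _ cl[OF e(1)]] ballI)
      fix X assume "X \<in> carrier B"
      then obtain a where a: "a \<in> carrier A" "X = I +>\<^bsub>A\<^esub> a" unfolding cB A_RCOSETS_def' by auto
      \<comment> \<open>All sets in the union defining the quotient scalar multiplication coincide,
        because multiplication of cosets is well defined.\<close>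
      have "I +>\<^bsub>A\<^esub> (c \<odot>\<^bsub>A\<^esub> x) = I +>\<^bsub>A\<^esub> (e \<otimes>\<^bsub>A\<^esub> a)" if x: "x \<in> X" for x
      proof -
        have xc: "x \<in> carrier A" using x a a_r_coset_subset_G[OF I.a_subset a(1)] by auto
        have "I +>\<^bsub>A\<^esub> x = I +>\<^bsub>A\<^esub> a"
          using a_repr_independence[of x I a] I.a_subgroup x a by simp
        then have "(I +>\<^bsub>A\<^esub> e) \<otimes>\<^bsub>B\<^esub> (I +>\<^bsub>A\<^esub> x) = (I +>\<^bsub>A\<^esub> e) \<otimes>\<^bsub>B\<^esub> (I +>\<^bsub>A\<^esub> a)" by simp
        then show ?thesis using e a xc by (simp add: mB)
      qed
      moreover have "X \<noteq> {}" using a I.a_rcos_self[OF a(1)] by auto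
      ultimately have "c \<odot>\<^bsub>B\<^esub> X = I +>\<^bsub>A\<^esub> (e \<otimes>\<^bsub>A\<^esub> a)" unfolding B by auto
      then show "c \<odot>\<^bsub>B\<^esub> X = (I +>\<^bsub>A\<^esub> e) \<otimes>\<^bsub>B\<^esub> X" using e a by (simp add: mB)
    qed
  qed
  ultimately show "scalar_ring (alg_quot A S)" unfolding scalar_ring_def B_def by blast
  show "x \<in> carrier A \<Longrightarrow> quot_class A S x \<in> carrier (alg_quot A S)"
    using cl[of x] by (simp add: quot_class_def I_def B_def)
qed

lemma scalar_ring_free: "scalar_ring free_alg"
  unfolding scalar_ring_def
proof
  show "ring free_alg"
  proof (intro ringI abelian_groupI monoidI)
    fix x assume "x \<in> carrier free_alg"
    show "\<exists>y\<in>carrier free_alg. y \<oplus>\<^bsub>free_alg\<^esub> x = \<zero>\<^bsub>free_alg\<^esub>"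
      by (rule bexI[of _ "- x"]) (simp_all add: free_alg_def)
  qed (auto simp: free_alg_def algebra_simps)
  show "\<forall>c. \<exists>e\<in>carrier free_alg. \<forall>x\<in>carrier free_alg. c \<odot>\<^bsub>free_alg\<^esub> x = e \<otimes>\<^bsub>free_alg\<^esub> x"
    by (auto simp: free_alg_def)
qed

lemma scalar_ring_Aq: "scalar_ring (Aq P)" "Aq_class P x \<in> carrier (Aq P)"
proof -
  have "Aq_relators P \<subseteq> carrier free_alg" by (simp add: free_alg_def)
  note q = scalar_ring_quot[OF scalar_ring_free this]
  show "scalar_ring (Aq P)" unfolding Aq_def by (rule q(1))
  show "Aq_class P x \<in> carrier (Aq P)" unfolding Aq_def Aq_class_def by (rule q(2)) (simp add: free_alg_def)
qed

lemma scalar_ring_AqN: "scalar_ring (AqN P)" "genN P g \<in> carrier (AqN P)"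
proof -
  have "Aq_class P ` trunc_relators P \<subseteq> carrier (Aq P)" by (rule image_subsetI) (rule scalar_ring_Aq(2))
  note q = scalar_ring_quot[OF scalar_ring_Aq(1) this]
  show "scalar_ring (AqN P)" unfolding AqN_def by (rule q(1))
  show "genN P g \<in> carrier (AqN P)" unfolding AqN_def genN_def by (rule q(2)) (rule scalar_ring_Aq)
qed

lemma AqN_smult_closed: "x \<in> carrier (AqN P) \<Longrightarrow> c \<odot>\<^bsub>AqN P\<^esub> x \<in> carrier (AqN P)"
proof -
  interpret ring "AqN P" using scalar_ring_AqN(1)[of P] by (simp add: scalar_ring_def)
  assume x: "x \<in> carrier (AqN P)"
  have "\<exists>e\<in>carrier (AqN P). \<forall>x\<in>carrier (AqN P). c \<odot>\<^bsub>AqN P\<^esub> x = e \<otimes>\<^bsub>AqN P\<^esub> x"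
    using scalar_ring_AqN(1)[of P] unfolding scalar_ring_def by (elim conjE allE)
  then obtain e where e: "e \<in> carrier (AqN P)" "\<forall>x\<in>carrier (AqN P). c \<odot>\<^bsub>AqN P\<^esub> x = e \<otimes>\<^bsub>AqN P\<^esub> x" ..
  show "c \<odot>\<^bsub>AqN P\<^esub> x \<in> carrier (AqN P)"
    unfolding bspec[OF e(2) x] by (rule m_closed[OF e(1) x])
qed

lemma KN_half_closed: "i < 2 \<Longrightarrow> j < 2 \<Longrightarrow> KN_half P u $$ (i, j) \<in> carrier (AqN P)"
proof -
  interpret ring "AqN P" using scalar_ring_AqN(1)[of P] by (simp add: scalar_ring_def)
  have cur: "current P X u \<in> carrier (AqN P)" for X
    unfolding current_def by (intro finsum_closed Pi_I AqN_smult_closed scalar_ring_AqN(2))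
  have diag: "KN_diag P e1 e2 X Y u \<in> carrier (AqN P)" for e1 e2 X Y
    unfolding KN_diag_def Let_def by (intro a_closed minus_closed AqN_smult_closed one_closed cur)
  have off: "KN_offdiag P k X u \<in> carrier (AqN P)" for k X
    unfolding KN_offdiag_def Let_def by (intro a_closed AqN_smult_closed one_closed cur)
  show "i < 2 \<Longrightarrow> j < 2 \<Longrightarrow> KN_half P u $$ (i, j) \<in> carrier (AqN P)"
    by (simp add: KN_half_def Let_def mat22_def diag off)
qed

section \<open>Comparison with the represented K-operators\<close>

locale represented_chain = generic_chain +
  fixes \<psi> :: "falg set set \<Rightarrow> complex mat"
  assumes rep: "spin_chain_rep P \<psi>"

sublocale represented_chain \<subseteq> A: alg_rep "AqN P" "\<lambda>x. qkap (qdim P) (\<psi> x)" "qdim P"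
proof (rule alg_rep.intro)
  interpret A: ring "AqN P" using scalar_ring_AqN(1)[of P] by (simp add: scalar_ring_def)
  have hom: "\<psi> \<in> Ring.ring_hom (AqN P) (qend P)" and sm: "\<And>c x. x \<in> carrier (AqN P) \<Longrightarrow> \<psi> (c \<odot>\<^bsub>AqN P\<^esub> x) = c \<odot>\<^bsub>qend P\<^esub> \<psi> x"
    using rep by (auto simp: spin_chain_rep_def alg_hom_def)
  note cl = ring_hom_closed[OF hom]
  show "abelian_monoid (AqN P)" by (rule A.abelian_monoid_axioms)
  show "x \<otimes>\<^bsub>AqN P\<^esub> y \<in> carrier (AqN P)" if "x \<in> carrier (AqN P)" "y \<in> carrier (AqN P)" for x y
    using that by simp
  show "\<one>\<^bsub>AqN P\<^esub> \<in> carrier (AqN P)" by simp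
  show "c \<odot>\<^bsub>AqN P\<^esub> \<one>\<^bsub>AqN P\<^esub> \<in> carrier (AqN P)" for c by (simp add: AqN_smult_closed)
  show "qkap (qdim P) (\<psi> (x \<otimes>\<^bsub>AqN P\<^esub> y)) p r = (\<Sum>t<qdim P. qkap (qdim P) (\<psi> x) p t * qkap (qdim P) (\<psi> y) t r)"
    if "x \<in> carrier (AqN P)" "y \<in> carrier (AqN P)" for x y p r
    using that by (simp add: ring_hom_mult[OF hom] Q.kap_mult cl)
  have add: "qkap (qdim P) (\<psi> (x \<oplus>\<^bsub>AqN P\<^esub> y)) p r = qkap (qdim P) (\<psi> x) p r + qkap (qdim P) (\<psi> y) p r"
    if "x \<in> carrier (AqN P)" "y \<in> carrier (AqN P)" for x y p r
    using that by (simp add: ring_hom_add[OF hom] Q.kap_add cl)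
  then show "qkap (qdim P) (\<psi> (x \<oplus>\<^bsub>AqN P\<^esub> y)) p r = qkap (qdim P) (\<psi> x) p r + qkap (qdim P) (\<psi> y) p r"
    if "x \<in> carrier (AqN P)" "y \<in> carrier (AqN P)" for x y p r using that .
  show "qkap (qdim P) (\<psi> \<zero>\<^bsub>AqN P\<^esub>) p r = 0" for p r
    using add[of "\<zero>\<^bsub>AqN P\<^esub>" "\<zero>\<^bsub>AqN P\<^esub>" p r] by simp
  show "qkap (qdim P) (\<psi> \<one>\<^bsub>AqN P\<^esub>) p r = (if p = r \<and> p < qdim P then 1 else 0)" for p r
    by (simp add: ring_hom_one[OF hom] Q.kap_one)
  show "qkap (qdim P) (\<psi> (c \<odot>\<^bsub>AqN P\<^esub> \<one>\<^bsub>AqN P\<^esub>)) p r = (if p = r \<and> p < qdim P then c else 0)" for c p r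
    by (simp add: sm ring_hom_one[OF hom] Q.kap_scalar)
qed (simp add: qkap_def)

context represented_chain begin

lemma cmat_KN_half: "A.cmat 2 2 (KN_half P u)"
  by (auto simp: A.cmat_def KN_half_closed) (auto simp: KN_half_def Let_def mat22_def)

lemma Op_KN_half:
  assumes "u \<noteq> 0"
  shows "A.Op 2 j (KN_half P u) = Q.Op 2 j (dressed_K P u)"
proof -
  have "\<psi> (KN_half P u $$ (m, k)) = dressed_K P u $$ (m, k)" if "m < 2" "k < 2" for m k
  proof -
    have "map_mat \<psi> (KN_half P u) = dressed_K P u" using rep assms by (simp add: spin_chain_rep_def)
    then have "dressed_K P u $$ (m, k) = map_mat \<psi> (KN_half P u) $$ (m, k)" by simp
    also have "\<dots> = \<psi> (KN_half P u $$ (m, k))" using that cmat_KN_half[of u] by (simp add: A.cmat_def)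
    finally show ?thesis by simp
  qed
  then show ?thesis unfolding A.Op_def Q.Op_def by (intro leg_op_cong) auto
qed

text \<open>The represented operator and the dressed one obey the same fusion recursion with the
  same shifts, and \<open>c_factor\<close> obeys the matching scalar recursion. The base case is the
  defining property of the representation.\<close>

lemma rep_KN:
  assumes "1 \<le> b" "u \<noteq> 0" "j > NN"
  shows "(\<lambda>c. c_factor P b u * Ph (A.Op (Suc b) j (KN P b u) f) c) = Dressed b u j (Ph f)"
  using assms
proof (induction b arbitrary: u j f rule: nat_induct_at_least)
  case base
  show ?case
    using rep_dressed_K[OF base(2,1), of f] Op_KN_half[OF base(1), of j]
    by (simp add: KN_def numeral_2_eq_2)
next
  case (Suc b)
  note u = \<open>u \<noteq> 0\<close> and j = \<open>j > NN\<close>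
  define i where "i = Suc (NN + j)"
  have i: "i > NN" "i \<noteq> j" "i \<noteq> 0" "j \<noteq> 0" using j by (auto simp: i_def)
  have us: "u * ss powi (- int b) \<noteq> 0" "u * ss \<noteq> 0" using u s0 by auto
  define X where "X = (\<lambda>f c. c_factor P (Suc b) u * Ph (A.Op (Suc (Suc b)) j (KN P (Suc b) u) f) c)"
  define Y where "Y = (\<lambda>f. Dressed (Suc b) u j (Ph f))"
  \<comment> \<open>The recursion through F determines a fused operator only at index 0 of the
    auxiliary leg i; independence of that leg, shown below, extends the identity.\<close>
  have key: "X f (c(i := 0)) = Y f (c(i := 0))" for f c
  proof -
    define G where "G = (\<lambda>f. Fop ss (Suc b) i j (A.Op 2 i (KN_half P (u * ss powi (- int b))) (R (Suc 0) b (u\<^sup>2 * ss powi (1 - int b)) i j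
           (A.Op (Suc b) j (KN P b (u * ss)) (E (Suc b) i j f)))))"
    have "G f = (\<lambda>c. A.Op (Suc (Suc b)) j (KN P (Suc b) u) f (c(i := 0)))"
      unfolding G_def KN_def by (rule ext) (rule A.fused_K_rec[OF cmat_KN_half generic u Suc.hyps i(2-4)])
    then have "X f (c(i := 0)) = c_factor P (Suc b) u * Ph (G f) c"
      unfolding X_def using Ph_upd[OF i(1), of "A.Op (Suc (Suc b)) j (KN P (Suc b) u) f" 0] by (simp only:)
    also have "\<dots> = Fop ss (Suc b) i j (\<lambda>c. c_factor P 1 (u * ss powi (- int b)) *
         Ph (Q.Op 2 i (dressed_K P (u * ss powi (- int b))) (\<lambda>c. c_factor P b (u * ss) * R (Suc 0) b (u\<^sup>2 * ss powi (1 - int b)) i j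
           (A.Op (Suc b) j (KN P b (u * ss)) (E (Suc b) i j f)) c)) c) c"
    proof -
      have ps: "Ph (\<lambda>c. x * g c) = (\<lambda>c. x * Ph g c)" for x g by (auto simp: Phi_def)
      show ?thesis
        unfolding G_def Op_KN_half[OF us(1)] Ph_leg_op[OF i(1) j] c_factor_Suc[OF s0] Q.Op_def leg_op_scale ps by (simp only: mult_ac)
    qed
    also have "\<dots> = Fop ss (Suc b) i j (Dressed (Suc 0) (u * ss powi (- int b)) i (R (Suc 0) b (u\<^sup>2 * ss powi (1 - int b)) i j
        (Dressed b (u * ss) j (E (Suc b) i j (Ph f))))) c"
    proof -
      have "Ph (\<lambda>c. c_factor P b (u * ss) * R (Suc 0) b (u\<^sup>2 * ss powi (1 - int b)) i j
           (A.Op (Suc b) j (KN P b (u * ss)) (E (Suc b) i j f)) c)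
         = R (Suc 0) b (u\<^sup>2 * ss powi (1 - int b)) i j (\<lambda>c. c_factor P b (u * ss) * Ph (A.Op (Suc b) j (KN P b (u * ss)) (E (Suc b) i j f)) c)"
      proof -
        have ps: "Ph (\<lambda>c. x * g c) = (\<lambda>c. x * Ph g c)" for x g by (auto simp: Phi_def)
        show ?thesis unfolding ps Ph_leg_op[OF i(1) j] leg_op_scale ..
      qed
      also have "\<dots> = R (Suc 0) b (u\<^sup>2 * ss powi (1 - int b)) i j (Dressed b (u * ss) j (E (Suc b) i j (Ph f)))"
        unfolding Suc.IH[OF us(2) j] Ph_leg_op[OF i(1) j] ..
      finally show ?thesis unfolding rep_dressed_K[OF i(1) us(1)] by (simp only:)
    qed
    also have "\<dots> = Fop ss (Suc b) i j (E (Suc b) i j (Y f)) c"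
      unfolding Y_def Dressed_fusion[OF Suc.hyps i(2) u i(1) j] ..
    also have "\<dots> = Y f (c(i := 0))"
    proof (cases "c j \<le> Suc b")
      case True
      then show ?thesis by (subst FE_id[OF i(2)]) simp_all
    next
      case False
      \<comment> \<open>Beyond the spin of leg j, F E gives 0, so the dressed operator must vanish
        there as well. Its outermost factor sees to that: K for an empty chain, otherwise an
        R.\<close>
      have n: "NN \<ge> n \<Longrightarrow> Tdesc (Suc b) n u j (KK (Suc b) u j g) (c(i := 0)) = 0" for n g
      proof (cases n)
        case 0
        then show ?thesis using False i by (simp only: Tdesc.simps) (rule Kop_range, simp)
      next
        case (Suc m)
        assume "NN \<ge> n"
        then have "Suc m \<noteq> j" using j Suc by simp
        then show ?thesis using False i unfolding Suc Tdesc.simps by (intro R_range2) auto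
      qed
      show ?thesis
        using False i n[OF order_refl] by (subst FE_id[OF i(2)]) (simp_all add: Y_def Dressed_def)
    qed
    finally show ?thesis .
  qed
  have T: "indep i (Tdesc b n u j)" "indep i (Tasc b n u j)" if "n \<le> NN" for b n u
  proof -
    show "indep i (Tdesc b n u j)" using that
    proof (induction n)
      case (Suc n)
      then have "i \<noteq> Suc n" using i by simp
      then show ?case using Suc indep_leg_op_comp[OF _ i(2), of "Suc n" "Tdesc b n u j"] by simp
    qed (simp add: indep_def)
    show "indep i (Tasc b n u j)" using that
    proof (induction n)
      case (Suc n)
      then have "i \<noteq> Suc n" using i by simp
      then show ?case using Suc indep_comp[OF _ indep_leg_op[OF _ i(2), of "Suc n"]] by simp
    qed (simp add: indep_def)
  qed
  have iX: "indep i X"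
  proof -
    have "indep i (\<lambda>f. Ph (A.Op (Suc (Suc b)) j (KN P (Suc b) u) f))"
      unfolding A.Op_def using i by (intro indep_comp[OF indep_Ph[OF i(1)] indep_leg_op])
    then show ?thesis unfolding X_def by (simp add: indep_def)
  qed
  have iY: "indep i Y"
    unfolding Y_def Dressed_def
    by (rule indep_comp[OF T(1)[OF order_refl]], rule indep_leg_op_comp[OF i(2) i(2)], rule indep_comp[OF T(2)[OF order_refl] indep_Ph[OF i(1)]])
  have "X f c = Y f c" for c
  proof -
    have "X f (c(i := 0, i := c i)) = Y f (c(i := 0, i := c i))"
      using key[of "\<lambda>d. f (d(i := c i))" c] unfolding indepD[OF iX] indepD[OF iY] .
    then show ?thesis by simp
  qed
  then show ?case unfolding X_def Y_def by (rule ext)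
qed

lemma KN_kernel:
  assumes "1 \<le> b" "u \<noteq> 0" "m < Suc b" "k < Suc b" "p < qdim P" "r < qdim P"
  shows "c_factor P b u * qkap (qdim P) (\<psi> (KN P b u $$ (m, k))) p r
    = qkap (qdim P) ((T_mono P b u \<star>\<^bsub>qend P\<^esub> scal_mat (qend P) (K_mat ss (eps_plus P) (eps_minus P) (k_plus P) (k_minus P) b u)
      \<star>\<^bsub>qend P\<^esub> T_mono_hat P b u) $$ (m, k)) p r"
proof -
  define W where "W = T_mono P b u \<star>\<^bsub>qend P\<^esub> scal_mat (qend P) (K_mat ss (eps_plus P) (eps_minus P) (k_plus P) (k_minus P) b u)
      \<star>\<^bsub>qend P\<^esub> T_mono_hat P b u"
  define j where "j = Suc NN"
  have j: "j > NN" "j \<noteq> 0" by (simp_all add: j_def)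
  define f :: "(nat \<Rightarrow> nat) \<Rightarrow> complex" where "f = (\<lambda>e. if e j = k \<and> e 0 = r then 1 else 0)"
  \<comment> \<open>The digits of p on the site legs and m on the auxiliary leg, so that passing to
    leg 0 by \<open>base\<close> returns p.\<close>
  define c where "c = (\<lambda>x. p div radix (spin2 P) x mod (spin2 P x + 1))(j := m)"
  define c' where "c' = base (spin2 P) NN c"
  have ir: "inrange (spin2 P) NN c"
    by (auto simp: inrange_def c_def j_def less_Suc_eq_le[symmetric])
  have c'j: "c' j = m" using j by (simp add: c'_def base_def c_def)
  have c'0: "c' 0 = p"
    unfolding c'_def base_def c_def enc_upd[OF j(1)] enc_surj using assms(5) by (simp add: qdim_radix)
  have Ph: "Ph g c = g c'" for g using ir by (simp add: Phi_def c'_def)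
  have cW: "Q.cmat (Suc b) (Suc b) W"
    unfolding W_def by (rule Q.cmat_mult[OF Q.cmat_mult[OF cmat_T_mono cmat_scal_K_mat[OF assms(2)]] cmat_T_mono_hat])
  have cK: "A.cmat (Suc b) (Suc b) (KN P b u)"
    unfolding KN_def by (rule A.fused_K_cmat[OF cmat_KN_half s0 assms(2)])
  have "c_factor P b u * A.Op (Suc b) j (KN P b u) f c' = Q.Op (Suc b) j W f c'"
    using fun_cong[OF rep_KN[OF assms(1,2) j(1), of f], of c] fun_cong[OF rep_transfer[OF j(1) assms(2), of b f], of c]
    unfolding W_def[symmetric] Ph by simp
  then show ?thesis
    unfolding W_def[symmetric] f_def A.Op_kernel[OF cK j(2) c'j c'0 assms(3,4,6)] Q.Op_kernel[OF cW j(2) c'j c'0 assms(3,4,6)] .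
qed

lemma K_dual_dims:
  assumes "u \<noteq> 0"
  shows "dim_row (K_dual P b u) = Suc b" "dim_col (K_dual P b u) = Suc b"
proof -
  have "inverse u * inverse (q_of P) \<noteq> 0" using assms s0 by (simp add: q_of_def)
  from cmat_K_mat[OF this] show "dim_row (K_dual P b u) = Suc b" "dim_col (K_dual P b u) = Suc b"
    by (simp_all add: K_dual_def cplx.cmat_def)
qed

lemma rep_gen_fun_T:
  assumes "1 \<le> b" "u \<noteq> 0"
  shows "c_factor P b u \<cdot>\<^sub>m \<psi> (gen_fun_T P b u) = transfer P b u"
proof -
  define M where "M = K_dual P b u"
  define K where "K = scal_mat (qend P) (K_mat ss (eps_plus P) (eps_minus P) (k_plus P) (k_minus P) b u)"
  let ?T = "T_mono P b u" and ?H = "T_mono_hat P b u"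
  define W where "W = ?T \<star>\<^bsub>qend P\<^esub> K \<star>\<^bsub>qend P\<^esub> ?H"
  note dM = K_dual_dims[OF assms(2), of b, folded M_def]
  have cM: "Q.cmat (Suc b) (Suc b) (scal_mat (qend P) M)" using Q.cmat_scal[of M] by (simp only: dM)
  have cK: "Q.cmat (Suc b) (Suc b) K" unfolding K_def by (rule cmat_scal_K_mat[OF assms(2)])
  note cTK = Q.cmat_mult[OF cmat_T_mono cK]
  have cW: "Q.cmat (Suc b) (Suc b) W" unfolding W_def by (rule Q.cmat_mult[OF cTK cmat_T_mono_hat])
  have cKN: "A.cmat (Suc b) (Suc b) (KN P b u)"
    unfolding KN_def by (rule A.fused_K_cmat[OF cmat_KN_half s0 assms(2)])
  have qpos: "0 < qdim P" by (simp add: qdim_radix radix_pos)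
  define X where "X = scal_mat (qend P) M \<star>\<^bsub>qend P\<^esub> ?T \<star>\<^bsub>qend P\<^esub> K \<star>\<^bsub>qend P\<^esub> ?H"
  have cMT: "Q.cmat (Suc b) (Suc b) (scal_mat (qend P) M \<star>\<^bsub>qend P\<^esub> ?T)" by (rule Q.cmat_mult[OF cM cmat_T_mono])
  have cX: "Q.cmat (Suc b) (Suc b) X" unfolding X_def by (intro Q.cmat_mult[OF Q.cmat_mult[OF cMT cK]] cmat_T_mono_hat)
  have cY: "Q.cmat (Suc b) (Suc b) (scal_mat (qend P) M \<star>\<^bsub>qend P\<^esub> W)" by (rule Q.cmat_mult[OF cM cW])
  have dY: "{0..<dim_row (scal_mat (qend P) M \<star>\<^bsub>qend P\<^esub> W)} = {..<Suc b}" using cY by (auto simp: Q.cmat_def)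
  have cXd: "X $$ (i, i) \<in> carrier (qend P)" if "i < Suc b" for i
    using cX that by (simp add: Q.cmat_def)
  have dX: "{0..<dim_row X} = {..<Suc b}" using cX by (auto simp: Q.cmat_def)
  have tX: "transfer P b u = finsum (qend P) (\<lambda>i. X $$ (i, i)) {..<Suc b}"
    unfolding transfer_def mat_trace_def M_def[symmetric] K_def[symmetric] X_def[symmetric] dX ..
  have tr: "transfer P b u \<in> carrier (qend P)"
    unfolding tX by (rule abelian_monoid.finsum_closed[OF Q.am]) (use cXd in auto)
  have gm: "gen_fun_T P b u \<in> carrier (AqN P)"
    unfolding gen_fun_T_def M_def[symmetric] by (rule A.kap_trace_scal(2)[OF dM cKN qpos])
  have hom: "\<psi> \<in> Ring.ring_hom (AqN P) (qend P)" using rep by (simp add: spin_chain_rep_def alg_hom_def)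
  have ps: "\<psi> (gen_fun_T P b u) \<in> carrier (qend P)" by (rule ring_hom_closed[OF hom gm])
  have "c_factor P b u * qkap (qdim P) (\<psi> (gen_fun_T P b u)) p r = qkap (qdim P) (transfer P b u) p r"
    if p: "p < qdim P" and r: "r < qdim P" for p r
  proof -
    have "qkap (qdim P) (transfer P b u) p r = (\<Sum>i<Suc b. qkap (qdim P) (X $$ (i, i)) p r)"
      unfolding tX by (rule Q.kap_finsum) (use cXd in auto)
    \<comment> \<open>The transfer matrix multiplies from the left, whereas the fused K corresponds
      to the block to the right of the dual K-matrix; regrouping needs associativity.\<close>
    also have "\<dots> = (\<Sum>i<Suc b. qkap (qdim P) ((scal_mat (qend P) M \<star>\<^bsub>qend P\<^esub> W) $$ (i, i)) p r)"
      unfolding X_def W_def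
      by (intro sum.cong refl Q.kap_mat_assoc[OF cM cmat_T_mono cK cmat_T_mono_hat _ _ r]) simp_all
    also have "\<dots> = qkap (qdim P) (mat_trace (qend P) (scal_mat (qend P) M \<star>\<^bsub>qend P\<^esub> W)) p r"
      unfolding mat_trace_def dY
      by (rule Q.kap_finsum[symmetric]) (use cY in \<open>auto simp: Q.cmat_def\<close>)
    also have "\<dots> = (\<Sum>i<Suc b. \<Sum>l<Suc b. M $$ (i, l) * qkap (qdim P) (W $$ (l, i)) p r)"
      by (rule Q.kap_trace_scal(1)[OF dM cW p])
    also have "\<dots> = (\<Sum>i<Suc b. \<Sum>l<Suc b. c_factor P b u * (M $$ (i, l) * qkap (qdim P) (\<psi> (KN P b u $$ (l, i))) p r))"
      using KN_kernel[OF assms _ _ p r, folded K_def, folded W_def]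
      by (intro sum.cong refl) (simp add: mult.left_commute)
    also have "\<dots> = c_factor P b u * qkap (qdim P) (\<psi> (gen_fun_T P b u)) p r"
      unfolding gen_fun_T_def M_def[symmetric] A.kap_trace_scal(1)[OF dM cKN p] sum_distrib_left ..
    finally show ?thesis ..
  qed
  then show ?thesis
    using tr ps by (intro eq_matI) (auto simp: qkap_def qend_def module_mat_simps)
qed

end

theorem proposition5p1:
  fixes P :: chain and \<psi> :: "falg set set \<Rightarrow> complex mat" and a :: nat and u :: complex
  assumes "q_of P \<noteq> 0" and "\<And>n::nat. n \<ge> 1 \<Longrightarrow> q_of P ^ n \<noteq> 1"
    and "k_plus P \<noteq> 0" and "k_minus P \<noteq> 0"
    and "chain_len P \<ge> 1"
    and "\<And>n. n \<in> {1..chain_len P} \<Longrightarrow> spin2 P n \<ge> 1"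
    and "\<And>n. n \<in> {1..chain_len P} \<Longrightarrow> inhom P n \<noteq> 0"
    and "a \<ge> 1"
    and "spin_chain_rep P \<psi>"
    and "u \<noteq> 0" and "c_factor P a u \<noteq> 0"
  shows "\<psi> (gen_fun_T P a u) = inverse (c_factor P a u) \<cdot>\<^sub>m transfer P a u"
proof -
  \<comment> \<open>A root of unity s would make its square q a root of unity of the same order or a
    divisor of it.\<close>
  have "root_q P ^ n \<noteq> 1" if "n \<ge> 1" for n
  proof
    assume "root_q P ^ n = 1"
    then have "q_of P ^ n = 1" by (simp add: q_of_def power2_eq_square power_mult_distrib)
    then show False using assms(2) that by blast
  qed
  then interpret represented_chain P \<psi>
    using assms by unfold_locales (auto simp: q_of_def)
  have "inverse (c_factor P a u) \<cdot>\<^sub>m transfer P a u = (inverse (c_factor P a u) * c_factor P a u) \<cdot>\<^sub>m \<psi> (gen_fun_T P a u)"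
    unfolding rep_gen_fun_T[OF assms(8,10), symmetric] by (auto simp: mult.assoc)
  also have "\<dots> = \<psi> (gen_fun_T P a u)" using assms(11) by (auto simp: intro!: eq_matI)
  finally show ?thesis ..
qed

end
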